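(* Let $\mathcal{A}$ be an abelian category, let $P\colon\mathcal{A}\to\mathcal{A}$ be a generating functor with a Nakayama functor $\nu$ relative to $P$, let $\nu^-$ be the right adjoint of $\nu$, and let $I:=\nu\circ P$. Assume $P$ is Iwanaga-Gorenstein. The following holds for every $A\in\mathcal{A}$: (1) $A\in\mathcal{GP}_P(\mathcal{A})$ if and only if $L_i\nu(A)=0$ for all $i>0$; (2) $A\in\mathcal{GI}_I(\mathcal{A})$ if and only if $R^i\nu^-(A)=0$ for all $i>0$.
   Context: All categories are preadditive, all functors additive, all subcategories full. A functor $P\colon\mathcal{A}\to\mathcal{A}$ is generating if for every $A\in\mathcal{A}$ there are $A'\in\mathcal{A}$ and an epimorphism $P(A')\to A$. A Nakayama functor relative to a generating functor $P$ is a functor $\nu\colon\mathcal{A}\to\mathcal{A}$ with a right adjoint $\nu^-$ such that (i) $\nu\circ P$ is right adjoint to $P$; (ii) the unit $\lambda\colon 1_{\mathcal{A}}\to\nu^-\circ\nu$ is an isomorphism on all objects $P(A)$, $A\in\mathcal{A}$. An object is $P$-projective (resp. $I$-injective) if it is a direct summand of some $P(A')$ (resp. $I(A')$). Derived functors: $L_i\nu(A)$ is the $i$-th homology of $\nu(Q_\bullet)$, where $\cdots\to Q_1\to Q_0\to A\to 0$ is exact with all $Q_i$ $P$-projective; $R^i\nu^-(A)$ is the $i$-th cohomology of $\nu^-(J_\bullet)$, where $0\to A\to J_0\to J_{-1}\to\cdots$ is exact with all $J_{-i}$ $I$-injective. (Such (co)resolutions exist, and these are the usual derived functors because the $P$-projectives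 are adapted to $\nu$ and the $I$-injectives are adapted to $\nu^-$.) $P$ is Iwanaga-Gorenstein if there exists $m\geq 0$ such that $L_i\nu(A)=0$ and $R^i\nu^-(A)=0$ for all $A\in\mathcal{A}$ and $i>m$. $\mathcal{GP}_P(\mathcal{A})$ consists of the Gorenstein $P$-projective objects: those $A$ for which there is an exact sequence $A_\bullet=\cdots\to A_1\xrightarrow{s_1}A_0\xrightarrow{s_0}A_{-1}\to\cdots$ (indexed by $\mathbb{Z}$) with all $A_i$ $P$-projective, with $\nu(A_\bullet)$ exact, and with $\operatorname{Ker}s_0=A$. $\mathcal{GI}_I(\mathcal{A})$ consists of the Gorenstein $I$-injective objects: those $A$ for which there is an exact sequence $A_\bullet$ indexed by $\mathbb{Z}$ with all $A_i$ $I$-injective, with $\nu^-(A_\bullet)$ exact, and with $\operatorname{Ker}s_0=A$. *)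

theory Defs
  imports "HOL-Algebra.Group"
begin

section \<open>Preadditive and abelian categories\<close>

text \<open>Objects and arrows are the members of the carriers \<open>Obj\<close> and \<open>Arr\<close>. All operations are total
  HOL functions, constrained only on composable (resp. parallel) arrows; composition is written in
  the usual order, \<open>g \<cdot> f\<close> being first \<open>f\<close>, then \<open>g\<close>.\<close>

record ('o, 'm) cat =
  Obj :: "'o set"
  Arr :: "'m set"
  src :: "'m \<Rightarrow> 'o"
  tgt :: "'m \<Rightarrow> 'o"
  idn :: "'o \<Rightarrow> 'm"
  cmp :: "'m \<Rightarrow> 'm \<Rightarrow> 'm"  (infixr \<open>\<cdot>\<index>\<close> 75)
  add :: "'m \<Rightarrow> 'm \<Rightarrow> 'm"  (infixl \<open>\<boxplus>\<index>\<close> 65)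
  zer :: "'o \<Rightarrow> 'o \<Rightarrow> 'm"

definition Hom :: "('o, 'm) cat \<Rightarrow> 'o \<Rightarrow> 'o \<Rightarrow> 'm set"
  where "Hom C A B = {f \<in> Arr C. src C f = A \<and> tgt C f = B}"

definition Hom_group :: "('o, 'm) cat \<Rightarrow> 'o \<Rightarrow> 'o \<Rightarrow> 'm monoid"
  where "Hom_group C A B = \<lparr>carrier = Hom C A B, monoid.mult = add C, one = zer C A B\<rparr>"

locale category =
  fixes C :: "('o, 'm) cat" (structure)
  assumes src_Obj: "f \<in> Arr C \<Longrightarrow> src C f \<in> Obj C"
    and tgt_Obj: "f \<in> Arr C \<Longrightarrow> tgt C f \<in> Obj C"
    and idn_Hom: "A \<in> Obj C \<Longrightarrow> idn C A \<in> Hom C A A"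
    and cmp_Hom: "\<lbrakk>g \<in> Hom C B D; f \<in> Hom C A B\<rbrakk> \<Longrightarrow> g \<cdot> f \<in> Hom C A D"
    and cmp_idn: "f \<in> Hom C A B \<Longrightarrow> f \<cdot> idn C A = f"
    and idn_cmp: "f \<in> Hom C A B \<Longrightarrow> idn C B \<cdot> f = f"
    and cmp_assoc: "\<lbrakk>h \<in> Hom C D E; g \<in> Hom C B D; f \<in> Hom C A B\<rbrakk> \<Longrightarrow> (h \<cdot> g) \<cdot> f = h \<cdot> (g \<cdot> f)"

locale preadditive_category = category +
  assumes Hom_comm_group: "\<lbrakk>A \<in> Obj C; B \<in> Obj C\<rbrakk> \<Longrightarrow> comm_group (Hom_group C A B)"
    and cmp_add: "\<lbrakk>g \<in> Hom C B D; f \<in> Hom C A B; f' \<in> Hom C A B\<rbrakk> \<Longrightarrow> g \<cdot> (f \<boxplus> f') = g \<cdot> f \<boxplus> g \<cdot> f'"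
    and add_cmp: "\<lbrakk>g \<in> Hom C B D; g' \<in> Hom C B D; f \<in> Hom C A B\<rbrakk> \<Longrightarrow> (g \<boxplus> g') \<cdot> f = g \<cdot> f \<boxplus> g' \<cdot> f"

context
  fixes C :: "('o, 'm) cat" (structure)
begin

definition is_mono :: "'m \<Rightarrow> bool"
  where "is_mono f \<longleftrightarrow> f \<in> Arr C \<and>
    (\<forall>X \<in> Obj C. \<forall>g \<in> Hom C X (src C f). \<forall>h \<in> Hom C X (src C f). f \<cdot> g = f \<cdot> h \<longrightarrow> g = h)"

definition is_epi :: "'m \<Rightarrow> bool"
  where "is_epi f \<longleftrightarrow> f \<in> Arr C \<and>
    (\<forall>X \<in> Obj C. \<forall>g \<in> Hom C (tgt C f) X. \<forall>h \<in> Hom C (tgt C f) X. g \<cdot> f = h \<cdot> f \<longrightarrow> g = h)"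

definition is_iso :: "'m \<Rightarrow> bool"
  where "is_iso f \<longleftrightarrow> f \<in> Arr C \<and>
    (\<exists>g \<in> Hom C (tgt C f) (src C f). g \<cdot> f = idn C (src C f) \<and> f \<cdot> g = idn C (tgt C f))"

definition zero_object :: "'o \<Rightarrow> bool"
  where "zero_object Z \<longleftrightarrow> Z \<in> Obj C \<and>
    (\<forall>A \<in> Obj C. (\<exists>!f. f \<in> Hom C A Z) \<and> (\<exists>!f. f \<in> Hom C Z A))"

definition is_biproduct :: "'o \<Rightarrow> 'o \<Rightarrow> 'o \<Rightarrow> 'm \<Rightarrow> 'm \<Rightarrow> 'm \<Rightarrow> 'm \<Rightarrow> bool"
  where "is_biproduct A B S i\<^sub>A i\<^sub>B p\<^sub>A p\<^sub>B \<longleftrightarrow> A \<in> Obj C \<and> B \<in> Obj C \<and> S \<in> Obj C \<and>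
    i\<^sub>A \<in> Hom C A S \<and> i\<^sub>B \<in> Hom C B S \<and> p\<^sub>A \<in> Hom C S A \<and> p\<^sub>B \<in> Hom C S B \<and>
    p\<^sub>A \<cdot> i\<^sub>A = idn C A \<and> p\<^sub>B \<cdot> i\<^sub>B = idn C B \<and>
    p\<^sub>B \<cdot> i\<^sub>A = zer C A B \<and> p\<^sub>A \<cdot> i\<^sub>B = zer C B A \<and>
    i\<^sub>A \<cdot> p\<^sub>A \<boxplus> i\<^sub>B \<cdot> p\<^sub>B = idn C S"

definition direct_summand :: "'o \<Rightarrow> 'o \<Rightarrow> bool"
  where "direct_summand A S \<longleftrightarrow> (\<exists>B i\<^sub>A i\<^sub>B p\<^sub>A p\<^sub>B. is_biproduct A B S i\<^sub>A i\<^sub>B p\<^sub>A p\<^sub>B)"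

definition is_kernel :: "'m \<Rightarrow> 'm \<Rightarrow> bool"
  where "is_kernel k f \<longleftrightarrow> f \<in> Arr C \<and> k \<in> Arr C \<and> tgt C k = src C f \<and>
    f \<cdot> k = zer C (src C k) (tgt C f) \<and>
    (\<forall>X \<in> Obj C. \<forall>h \<in> Hom C X (src C f). f \<cdot> h = zer C X (tgt C f) \<longrightarrow>
      (\<exists>!u. u \<in> Hom C X (src C k) \<and> k \<cdot> u = h))"

definition is_cokernel :: "'m \<Rightarrow> 'm \<Rightarrow> bool"
  where "is_cokernel q f \<longleftrightarrow> f \<in> Arr C \<and> q \<in> Arr C \<and> src C q = tgt C f \<and>
    q \<cdot> f = zer C (src C f) (tgt C q) \<and>
    (\<forall>X \<in> Obj C. \<forall>h \<in> Hom C (tgt C f) X. h \<cdot> f = zer C (src C f) X \<longrightarrow>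
      (\<exists>!u. u \<in> Hom C (tgt C q) X \<and> u \<cdot> q = h))"

definition is_image :: "'m \<Rightarrow> 'm \<Rightarrow> bool"
  where "is_image k f \<longleftrightarrow> (\<exists>q. is_cokernel q f \<and> is_kernel k q)"

text \<open>Exactness of \<open>X \<rightarrow> Y \<rightarrow> Z\<close> at \<open>Y\<close>: the image of the first arrow and the kernel of the
  second are the same subobject of \<open>Y\<close>.\<close>

definition exact_at :: "'m \<Rightarrow> 'm \<Rightarrow> bool"
  where "exact_at f g \<longleftrightarrow> tgt C f = src C g \<and> (\<exists>k. is_image k f \<and> is_kernel k g)"

text \<open>\<open>H\<close> is (up to isomorphism) the homology of \<open>X \<rightarrow> Y \<rightarrow> Z\<close> at \<open>Y\<close>: the cokernel of the
  arrow from \<open>X\<close> to the kernel of \<open>g\<close> that is induced by \<open>f\<close>.\<close>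

definition is_homology :: "'o \<Rightarrow> 'm \<Rightarrow> 'm \<Rightarrow> bool"
  where "is_homology H f g \<longleftrightarrow> (\<exists>k u q. is_kernel k g \<and>
    u \<in> Hom C (src C f) (src C k) \<and> k \<cdot> u = f \<and> is_cokernel q u \<and> tgt C q = H)"

end

locale abelian_category = preadditive_category +
  assumes has_zero_object: "\<exists>Z. zero_object C Z"
    and has_biproducts: "\<lbrakk>A \<in> Obj C; B \<in> Obj C\<rbrakk> \<Longrightarrow> \<exists>S i\<^sub>A i\<^sub>B p\<^sub>A p\<^sub>B. is_biproduct C A B S i\<^sub>A i\<^sub>B p\<^sub>A p\<^sub>B"
    and has_kernels: "f \<in> Arr C \<Longrightarrow> \<exists>k. is_kernel C k f"
    and has_cokernels: "f \<in> Arr C \<Longrightarrow> \<exists>q. is_cokernel C q f"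
    and mono_is_kernel: "is_mono C f \<Longrightarrow> \<exists>g. is_kernel C f g"
    and epi_is_cokernel: "is_epi C f \<Longrightarrow> \<exists>g. is_cokernel C f g"


section \<open>Additive endofunctors and adjunctions\<close>

record ('o, 'm) endofun =
  omap :: "'o \<Rightarrow> 'o"
  amap :: "'m \<Rightarrow> 'm"

definition id_endofun :: "('o, 'm) endofun"
  where "id_endofun = \<lparr>omap = id, amap = id\<rparr>"

definition comp_endofun :: "('o, 'm) endofun \<Rightarrow> ('o, 'm) endofun \<Rightarrow> ('o, 'm) endofun"
    (infixl \<open>\<odot>\<close> 70)
  where "F \<odot> G = \<lparr>omap = omap F \<circ> omap G, amap = amap F \<circ> amap G\<rparr>"

locale additive_functor = preadditive_category +
  fixes F :: "('o, 'm) endofun"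
  assumes omap_Obj: "A \<in> Obj C \<Longrightarrow> omap F A \<in> Obj C"
    and amap_Hom: "f \<in> Hom C A B \<Longrightarrow> amap F f \<in> Hom C (omap F A) (omap F B)"
    and amap_idn: "A \<in> Obj C \<Longrightarrow> amap F (idn C A) = idn C (omap F A)"
    and amap_cmp: "\<lbrakk>g \<in> Hom C B D; f \<in> Hom C A B\<rbrakk> \<Longrightarrow> amap F (g \<cdot> f) = amap F g \<cdot> amap F f"
    and amap_add: "\<lbrakk>f \<in> Hom C A B; g \<in> Hom C A B\<rbrakk> \<Longrightarrow> amap F (f \<boxplus> g) = amap F f \<boxplus> amap F g"

definition natural_transformation ::
    "('o, 'm) cat \<Rightarrow> ('o, 'm) endofun \<Rightarrow> ('o, 'm) endofun \<Rightarrow> ('o \<Rightarrow> 'm) \<Rightarrow> bool"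
  where "natural_transformation C F G \<tau> \<longleftrightarrow>
    (\<forall>A \<in> Obj C. \<tau> A \<in> Hom C (omap F A) (omap G A)) \<and>
    (\<forall>A \<in> Obj C. \<forall>B \<in> Obj C. \<forall>f \<in> Hom C A B. amap G f \<cdot>\<^bsub>C\<^esub> \<tau> A = \<tau> B \<cdot>\<^bsub>C\<^esub> amap F f)"

text \<open>\<open>F\<close> is left adjoint to \<open>G\<close>, with unit \<open>\<eta>\<close> and counit \<open>\<epsilon>\<close>.\<close>

definition adjunction ::
    "('o, 'm) cat \<Rightarrow> ('o, 'm) endofun \<Rightarrow> ('o, 'm) endofun \<Rightarrow> ('o \<Rightarrow> 'm) \<Rightarrow> ('o \<Rightarrow> 'm) \<Rightarrow> bool"
  where "adjunction C F G \<eta> \<epsilon> \<longleftrightarrow> additive_functor C F \<and> additive_functor C G \<and>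
    natural_transformation C id_endofun (G \<odot> F) \<eta> \<and>
    natural_transformation C (F \<odot> G) id_endofun \<epsilon> \<and>
    (\<forall>A \<in> Obj C. \<epsilon> (omap F A) \<cdot>\<^bsub>C\<^esub> amap F (\<eta> A) = idn C (omap F A)) \<and>
    (\<forall>A \<in> Obj C. amap G (\<epsilon> A) \<cdot>\<^bsub>C\<^esub> \<eta> (omap G A) = idn C (omap G A))"

definition is_right_adjoint ::
    "('o, 'm) cat \<Rightarrow> ('o, 'm) endofun \<Rightarrow> ('o, 'm) endofun \<Rightarrow> bool"
  where "is_right_adjoint C G F \<longleftrightarrow> (\<exists>\<eta> \<epsilon>. adjunction C F G \<eta> \<epsilon>)"


section \<open>Generating functors and Nakayama functors\<close>

definition generating_functor :: "('o, 'm) cat \<Rightarrow> ('o, 'm) endofun \<Rightarrow> bool"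
  where "generating_functor C P \<longleftrightarrow> additive_functor C P \<and>
    (\<forall>A \<in> Obj C. \<exists>A' \<in> Obj C. \<exists>f \<in> Hom C (omap P A') A. is_epi C f)"

text \<open>\<open>\<nu>\<close> is a Nakayama functor relative to \<open>P\<close> with right adjoint \<open>\<nu>\<^sup>-\<close>. The unit \<open>\<eta>\<close> is
  determined up to a natural automorphism of \<open>\<nu>\<^sup>-\<close>, so the second condition does not depend
  on its choice.\<close>

definition nakayama_functor ::
    "('o, 'm) cat \<Rightarrow> ('o, 'm) endofun \<Rightarrow> ('o, 'm) endofun \<Rightarrow> ('o, 'm) endofun \<Rightarrow> bool"
  where "nakayama_functor C P \<nu> \<nu>m \<longleftrightarrow>
    is_right_adjoint C (\<nu> \<odot> P) P \<and>
    (\<exists>\<eta> \<epsilon>. adjunction C \<nu> \<nu>m \<eta> \<epsilon> \<and> (\<forall>A \<in> Obj C. is_iso C (\<eta> (omap P A))))"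

definition P_projective :: "('o, 'm) cat \<Rightarrow> ('o, 'm) endofun \<Rightarrow> 'o \<Rightarrow> bool"
  where "P_projective C P A \<longleftrightarrow> (\<exists>A' \<in> Obj C. direct_summand C A (omap P A'))"

definition I_injective :: "('o, 'm) cat \<Rightarrow> ('o, 'm) endofun \<Rightarrow> 'o \<Rightarrow> bool"
  where "I_injective C I A \<longleftrightarrow> (\<exists>A' \<in> Obj C. direct_summand C A (omap I A'))"


section \<open>Derived functors\<close>

text \<open>Sequences are given by their arrows. A resolution \<open>\<dots> \<rightarrow> Q\<^sub>1 \<rightarrow> Q\<^sub>0 \<rightarrow> A \<rightarrow> 0\<close> is
  represented by \<open>d\<close> with \<open>d 0 : Q\<^sub>0 \<rightarrow> A\<close> and \<open>d (i + 1) : Q\<^bsub>i + 1\<^esub> \<rightarrow> Q\<^sub>i\<close>, so \<open>Q\<^sub>i\<close> is the source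
  of \<open>d i\<close>. A coresolution \<open>0 \<rightarrow> A \<rightarrow> J\<^sub>0 \<rightarrow> J\<^bsub>-1\<^esub> \<rightarrow> \<dots>\<close> is represented by \<open>d\<close> with
  \<open>d 0 : A \<rightarrow> J\<^sub>0\<close> and \<open>d (i + 1) : J\<^bsub>-i\<^esub> \<rightarrow> J\<^bsub>-i-1\<^esub>\<close>, so \<open>J\<^bsub>-i\<^esub>\<close> is the target of \<open>d i\<close>.\<close>

definition projective_resolution ::
    "('o, 'm) cat \<Rightarrow> ('o, 'm) endofun \<Rightarrow> 'o \<Rightarrow> (nat \<Rightarrow> 'm) \<Rightarrow> bool"
  where "projective_resolution C P A d \<longleftrightarrow> tgt C (d 0) = A \<and>
    (\<forall>i. P_projective C P (src C (d i))) \<and>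
    (\<exists>Z. zero_object C Z \<and> exact_at C (d 0) (zer C A Z)) \<and>
    (\<forall>i. exact_at C (d (Suc i)) (d i))"

definition injective_coresolution ::
    "('o, 'm) cat \<Rightarrow> ('o, 'm) endofun \<Rightarrow> 'o \<Rightarrow> (nat \<Rightarrow> 'm) \<Rightarrow> bool"
  where "injective_coresolution C I A d \<longleftrightarrow> src C (d 0) = A \<and>
    (\<forall>i. I_injective C I (tgt C (d i))) \<and>
    (\<exists>Z. zero_object C Z \<and> exact_at C (zer C Z A) (d 0)) \<and>
    (\<forall>i. exact_at C (d i) (d (Suc i)))"

text \<open>The objects \<open>L\<^sub>i F (A)\<close> and \<open>R\<^sup>i G (A)\<close>, which are determined only up to isomorphism, so
  that one of the possible objects is chosen. In degree 0 the
  (co)augmentation is replaced by the zero arrow to (from) a zero object.\<close>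

definition left_derived ::
    "('o, 'm) cat \<Rightarrow> ('o, 'm) endofun \<Rightarrow> ('o, 'm) endofun \<Rightarrow> nat \<Rightarrow> 'o \<Rightarrow> 'o"
  where "left_derived C P F i A = (SOME H. \<exists>d Z. projective_resolution C P A d \<and> zero_object C Z \<and>
    is_homology C H (amap F (d (Suc i)))
      (if i = 0 then zer C (omap F (src C (d 0))) Z else amap F (d i)))"

definition right_derived ::
    "('o, 'm) cat \<Rightarrow> ('o, 'm) endofun \<Rightarrow> ('o, 'm) endofun \<Rightarrow> nat \<Rightarrow> 'o \<Rightarrow> 'o"
  where "right_derived C I G i A = (SOME H. \<exists>d Z. injective_coresolution C I A d \<and> zero_object C Z \<and>
    is_homology C H
      (if i = 0 then zer C Z (omap G (tgt C (d 0))) else amap G (d i)) (amap G (d (Suc i))))"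

definition iwanaga_gorenstein ::
    "('o, 'm) cat \<Rightarrow> ('o, 'm) endofun \<Rightarrow> ('o, 'm) endofun \<Rightarrow> ('o, 'm) endofun \<Rightarrow> bool"
  where "iwanaga_gorenstein C P \<nu> \<nu>m \<longleftrightarrow> (\<exists>m. \<forall>A \<in> Obj C. \<forall>i>m.
    zero_object C (left_derived C P \<nu> i A) \<and> zero_object C (right_derived C (\<nu> \<odot> P) \<nu>m i A))"


section \<open>Gorenstein projective and injective objects\<close>

text \<open>A sequence indexed by the integers is given by its arrows \<open>s i : A\<^sub>i \<rightarrow> A\<^bsub>i - 1\<^esub>\<close>, so \<open>A\<^sub>i\<close> is
  the source of \<open>s i\<close>; the condition \<open>Ker s\<^sub>0 = A\<close> is read as: \<open>A\<close> is the source of a kernel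
  of \<open>s 0\<close>.\<close>

definition exact_sequence :: "('o, 'm) cat \<Rightarrow> (int \<Rightarrow> 'm) \<Rightarrow> bool"
  where "exact_sequence C s \<longleftrightarrow> (\<forall>i. exact_at C (s (i + 1)) (s i))"

definition gorenstein_projectives ::
    "('o, 'm) cat \<Rightarrow> ('o, 'm) endofun \<Rightarrow> ('o, 'm) endofun \<Rightarrow> 'o set"
  where "gorenstein_projectives C P \<nu> = {A \<in> Obj C. \<exists>s.
    (\<forall>i. P_projective C P (src C (s i))) \<and> exact_sequence C s \<and>
    exact_sequence C (\<lambda>i. amap \<nu> (s i)) \<and> (\<exists>k. is_kernel C k (s 0) \<and> src C k = A)}"

definition gorenstein_injectives ::
    "('o, 'm) cat \<Rightarrow> ('o, 'm) endofun \<Rightarrow> ('o, 'm) endofun \<Rightarrow> 'o set"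
  where "gorenstein_injectives C I \<nu>m = {A \<in> Obj C. \<exists>s.
    (\<forall>i. I_injective C I (src C (s i))) \<and> exact_sequence C s \<and>
    exact_sequence C (\<lambda>i. amap \<nu>m (s i)) \<and> (\<exists>k. is_kernel C k (s 0) \<and> src C k = A)}"

end

theory Submission
  imports Defs
begin

text \<open>Write \<open>N\<close> for \<open>\<nu>\<close> and \<open>M\<close> for \<open>\<nu>\<^sup>-\<close>, so that \<open>I = N P\<close>, \<open>P\<close> is left adjoint to \<open>I\<close> and \<open>N\<close> is left
  adjoint to \<open>M\<close>. The counit \<open>c : P I \<rightarrow> 1\<close> is epi because \<open>P\<close> is generating, and the unit \<open>u : 1 \<rightarrow> I P\<close> is
  mono because \<open>u f = 0\<close> gives \<open>P f = 0\<close>, hence \<open>P I f = P N (P f) = 0\<close>, hence \<open>f c = 0\<close>. Being isomorphic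
  to \<open>M N P = M I\<close>, the functor \<open>P\<close> is left exact as well as right exact; so is \<open>I = N P\<close>. An object is
  \<open>P\<close>-projective iff \<open>c\<close> splits there. All of this is invariant under reversing the arrows and
  exchanging \<open>P\<close> with \<open>I\<close> and \<open>N\<close> with \<open>M\<close> (locale \<open>nakayama_pair\<close>, lemma \<open>nakayama_opp\<close>), so only one
  half of the theorem needs an argument.

  The \<open>P\<close>-projectives need not be projective objects, so there may be no comparison maps between
  resolutions. Instead the covers \<open>c A : P I A \<rightarrow> A\<close> form a functorial and exact construction whose
  kernels, the syzygies, depend on \<open>A\<close> exactly, and \<open>N P I\<close> is exact. A snake argument then shows that
  \<open>N\<close> preserves short exact sequences ending in a \<open>P\<close>-projective (\<open>F_mono_rel_proj\<close>), and comparing two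
  covers of \<open>A\<close> by their fibre product shows that whether \<open>L\<^sub>i N (A)\<close> is zero can be read off from any
  resolution (\<open>syzygy_vanishes\<close>, \<open>resolution_exact_iff\<close>). In particular a Gorenstein \<open>P\<close>-projective
  object \<open>A\<close> has \<open>L\<^sub>i N (A) = 0\<close> for \<open>i > 0\<close>: half of its complete sequence is a resolution.

  Conversely let \<open>L\<^sub>i N (A) = 0\<close> for all \<open>i > 0\<close>. Applying \<open>N\<close> to the canonical resolution of \<open>A\<close> gives
  exact sequences \<open>0 \<rightarrow> N \<Omega>\<^sup>n\<^sup>+\<^sup>1 A \<rightarrow> J \<rightarrow> N \<Omega>\<^sup>n A \<rightarrow> 0\<close> with \<open>J\<close> \<open>I\<close>-injective, so that
  \<open>R\<^sup>i M (N A) = R\<^sup>i\<^sup>+\<^sup>n M (N \<Omega>\<^sup>n A)\<close> for \<open>i > 0\<close>, and this is zero for large \<open>n\<close> by the Iwanaga-Gorenstein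
  hypothesis. Hence \<open>M\<close> keeps these sequences exact, and comparison with the original resolution
  shows that the unit \<open>A \<rightarrow> M N A\<close> is an isomorphism (\<open>covanishes_N\<close>). So \<open>N\<close> and \<open>M\<close> exchange the objects
  with vanishing \<open>L\<^sub>i N\<close> and those with vanishing \<open>R\<^sup>i M\<close>. Applying \<open>M\<close> to \<open>N A \<rightarrow> I P N A\<close> and its cokernel
  embeds \<open>A\<close> in a \<open>P\<close>-projective with a quotient of the same kind (\<open>acyclic_cover\<close>); iterating this to the
  right and splicing with the canonical resolution on the left gives the complete sequence.\<close>

section \<open>Arrow calculus\<close>

text \<open>For automation, typing is expressed by membership in \<open>Arr\<close> and equations for source and target:
  these act as rewrite rules, whereas membership in \<open>Hom\<close> leaves the objects to be guessed.\<close>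

context category
begin

lemma Hom_iff: "f \<in> Hom C A B \<longleftrightarrow> f \<in> Arr C \<and> src C f = A \<and> tgt C f = B"
  by (auto simp: Hom_def)

lemma Hom_ObjD: "f \<in> Hom C A B \<Longrightarrow> A \<in> Obj C \<and> B \<in> Obj C"
  using src_Obj tgt_Obj by (auto simp: Hom_iff)

lemma Arr_Hom: "f \<in> Arr C \<Longrightarrow> f \<in> Hom C (src C f) (tgt C f)"
  by (simp add: Hom_iff)

lemma cmp_Arr [simp]:
  assumes "f \<in> Arr C" "g \<in> Arr C" "src C g = tgt C f"
  shows "g \<cdot> f \<in> Arr C" "src C (g \<cdot> f) = src C f" "tgt C (g \<cdot> f) = tgt C g"
  using cmp_Hom[of g "tgt C f" "tgt C g" f "src C f"] assms by (auto simp: Hom_iff)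

lemma idn_Arr [simp]:
  assumes "A \<in> Obj C"
  shows "idn C A \<in> Arr C" "src C (idn C A) = A" "tgt C (idn C A) = A"
  using idn_Hom[OF assms] by (auto simp: Hom_iff)

lemma cmp_idn_Arr [simp]: "f \<in> Arr C \<Longrightarrow> src C f = A \<Longrightarrow> f \<cdot> idn C A = f"
  using cmp_idn[of f A "tgt C f"] by (auto simp: Hom_iff)

lemma idn_cmp_Arr [simp]: "f \<in> Arr C \<Longrightarrow> tgt C f = B \<Longrightarrow> idn C B \<cdot> f = f"
  using idn_cmp[of f "src C f" B] by (auto simp: Hom_iff)

lemma cmp_assoc_Arr [simp]:
  "\<lbrakk>f \<in> Arr C; g \<in> Arr C; h \<in> Arr C; src C g = tgt C f; src C h = tgt C g\<rbrakk>
    \<Longrightarrow> (h \<cdot> g) \<cdot> f = h \<cdot> (g \<cdot> f)"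
  using cmp_assoc[of h "tgt C g" "tgt C h" g "tgt C f" f "src C f"] by (auto simp: Hom_iff)

lemma Arr_Obj [simp]: "f \<in> Arr C \<Longrightarrow> src C f \<in> Obj C" "f \<in> Arr C \<Longrightarrow> tgt C f \<in> Obj C"
  using src_Obj tgt_Obj by auto

text \<open>Nested composites are kept associated to the right; this rewrites their first two factors by
  a known equation.\<close>

lemma reassoc:
  "\<lbrakk>g \<cdot> f = h; f \<in> Arr C; g \<in> Arr C; src C g = tgt C f; x \<in> Arr C; tgt C x = src C f\<rbrakk>
    \<Longrightarrow> g \<cdot> (f \<cdot> x) = h \<cdot> x"
  using cmp_assoc_Arr[of x f g] by simp

lemma square:
  "\<lbrakk>g \<cdot> f = h \<cdot> k; f \<in> Arr C; g \<in> Arr C; h \<in> Arr C; k \<in> Arr C; src C g = tgt C f; src C h = tgt C k;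
    x \<in> Arr C; tgt C x = src C f; tgt C x = src C k\<rbrakk> \<Longrightarrow> g \<cdot> (f \<cdot> x) = h \<cdot> (k \<cdot> x)"
  using reassoc[of g f "h \<cdot> k" x] by simp

lemma is_mono_Arr: "is_mono C f \<Longrightarrow> f \<in> Arr C"
  by (simp add: is_mono_def)

lemma is_epi_Arr: "is_epi C f \<Longrightarrow> f \<in> Arr C"
  by (simp add: is_epi_def)

lemma mono_cancel:
  "\<lbrakk>is_mono C f; g \<in> Arr C; h \<in> Arr C; tgt C g = src C f; tgt C h = src C f; src C g = src C h;
    f \<cdot> g = f \<cdot> h\<rbrakk> \<Longrightarrow> g = h"
  unfolding is_mono_def using Hom_iff[of _ "src C h" "src C f"] Arr_Obj(1)[of h] by metis

lemma epi_cancel: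
  "\<lbrakk>is_epi C f; g \<in> Arr C; h \<in> Arr C; src C g = tgt C f; src C h = tgt C f; tgt C g = tgt C h;
    g \<cdot> f = h \<cdot> f\<rbrakk> \<Longrightarrow> g = h"
  unfolding is_epi_def using Hom_iff[of _ "tgt C f" "tgt C h"] Arr_Obj(2)[of h] by metis

lemma mono_cmp:
  assumes "is_mono C f" "is_mono C g" "src C g = tgt C f"
  shows "is_mono C (g \<cdot> f)"
proof -
  note [simp] = assms(3) is_mono_Arr[OF assms(1)] is_mono_Arr[OF assms(2)]
  show ?thesis
    unfolding is_mono_def
  proof (intro conjI ballI impI)
    fix X h k assume "h \<in> Hom C X (src C (g \<cdot> f))" "k \<in> Hom C X (src C (g \<cdot> f))"
      and eq: "(g \<cdot> f) \<cdot> h = (g \<cdot> f) \<cdot> k"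
    then have [simp]: "h \<in> Arr C" "k \<in> Arr C" "src C h = X" "src C k = X" "tgt C h = src C f"
      "tgt C k = src C f" by (auto simp: Hom_iff)
    have "f \<cdot> h = f \<cdot> k" by (rule mono_cancel[OF assms(2)]) (use eq in auto)
    then show "h = k" using mono_cancel[OF assms(1)] by simp
  qed simp
qed

lemma mono_cmpD:
  assumes "is_mono C (g \<cdot> f)" "f \<in> Arr C" "g \<in> Arr C" "src C g = tgt C f"
  shows "is_mono C f"
  unfolding is_mono_def
proof (intro conjI ballI impI)
  fix X h k assume "h \<in> Hom C X (src C f)" "k \<in> Hom C X (src C f)" and eq: "f \<cdot> h = f \<cdot> k"
  then have [simp]: "h \<in> Arr C" "k \<in> Arr C" "src C h = X" "src C k = X" "tgt C h = src C f"
    "tgt C k = src C f" by (auto simp: Hom_iff)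
  show "h = k" by (rule mono_cancel[OF assms(1)]) (use assms eq in auto)
qed (use assms in simp)

text \<open>In an abelian category a retract is the same as a direct summand, but no complement has to be
  exhibited, and the notion is visibly self-dual.\<close>

definition retract :: "'o \<Rightarrow> 'o \<Rightarrow> bool"
  where "retract A B \<longleftrightarrow> (\<exists>i \<in> Hom C A B. \<exists>p \<in> Hom C B A. p \<cdot> i = idn C A)"

lemma retractE:
  assumes "retract A B"
  obtains i p where "i \<in> Arr C" "p \<in> Arr C" "src C i = A" "tgt C i = B" "src C p = B" "tgt C p = A"
    "p \<cdot> i = idn C A" "A \<in> Obj C" "B \<in> Obj C"
  using assms unfolding retract_def by (metis Hom_iff Arr_Obj)

lemma is_isoE:
  assumes "is_iso C f"
  obtains g where "f \<in> Arr C" "g \<in> Arr C" "src C g = tgt C f" "tgt C g = src C f"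
    "g \<cdot> f = idn C (src C f)" "f \<cdot> g = idn C (tgt C f)"
  using assms unfolding is_iso_def by (auto simp: Hom_iff)

lemma split_mono:
  assumes "i \<in> Arr C" "p \<in> Arr C" "src C p = tgt C i" "p \<cdot> i = idn C (src C i)"
  shows "is_mono C i"
  by (rule mono_cmpD[of p]) (use assms in \<open>auto simp: is_mono_def Hom_iff\<close>)

lemma iso_mono: "is_iso C f \<Longrightarrow> is_mono C f"
  by (erule is_isoE) (auto intro: split_mono)

end


context preadditive_category
begin

lemma Hom_group_simps [simp]:
  "carrier (Hom_group C A B) = Hom C A B" "monoid.mult (Hom_group C A B) = add C"
  "one (Hom_group C A B) = zer C A B"
  by (auto simp: Hom_group_def)

lemma zer_Hom: "A \<in> Obj C \<Longrightarrow> B \<in> Obj C \<Longrightarrow> zer C A B \<in> Hom C A B"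
  using monoid.one_closed[OF group.is_monoid[OF comm_group.axioms(2)[OF Hom_comm_group]], of A B] by simp

lemma zer_Arr [simp]:
  assumes "A \<in> Obj C" "B \<in> Obj C"
  shows "zer C A B \<in> Arr C" "src C (zer C A B) = A" "tgt C (zer C A B) = B"
  using zer_Hom[OF assms] by (auto simp: Hom_iff)

lemma add_Hom: "f \<in> Hom C A B \<Longrightarrow> g \<in> Hom C A B \<Longrightarrow> f \<boxplus> g \<in> Hom C A B"
  using monoid.m_closed[OF group.is_monoid[OF comm_group.axioms(2)[OF Hom_comm_group]], of A B f g]
    Hom_ObjD by simp

lemma add_Arr [simp]:
  assumes "f \<in> Arr C" "g \<in> Arr C" "src C f = src C g" "tgt C f = tgt C g"
  shows "f \<boxplus> g \<in> Arr C" "src C (f \<boxplus> g) = src C g" "tgt C (f \<boxplus> g) = tgt C g"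
  using add_Hom[of f "src C g" "tgt C g" g] assms by (auto simp: Hom_iff)

lemma add_zer [simp]: "f \<in> Arr C \<Longrightarrow> src C f = A \<Longrightarrow> tgt C f = B \<Longrightarrow> f \<boxplus> zer C A B = f"
  using monoid.r_one[OF group.is_monoid[OF comm_group.axioms(2)[OF Hom_comm_group]], of A B f]
  by (auto simp: Hom_iff)

lemma zer_add [simp]: "f \<in> Arr C \<Longrightarrow> src C f = A \<Longrightarrow> tgt C f = B \<Longrightarrow> zer C A B \<boxplus> f = f"
  using monoid.l_one[OF group.is_monoid[OF comm_group.axioms(2)[OF Hom_comm_group]], of A B f]
  by (auto simp: Hom_iff)

lemma add_cancel:
  assumes "f \<boxplus> h = f" "f \<in> Arr C" "h \<in> Arr C" "src C f = A" "tgt C f = B" "src C h = A" "tgt C h = B"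
  shows "h = zer C A B"
  using group.l_cancel_one[OF comm_group.axioms(2)[OF Hom_comm_group], of A B f h] assms
  by (auto simp: Hom_iff)

text \<open>Subtraction as an existence statement, which avoids a negation operation.\<close>

lemma differenceE:
  assumes "f \<in> Arr C" "g \<in> Arr C" "src C f = src C g" "tgt C f = tgt C g"
  obtains h where "h \<in> Arr C" "src C h = src C g" "tgt C h = tgt C g" "f = g \<boxplus> h"
proof -
  interpret G: comm_group "Hom_group C (src C g) (tgt C g)" using Hom_comm_group assms by simp
  let ?h = "inv\<^bsub>Hom_group C (src C g) (tgt C g)\<^esub> g \<boxplus> f"
  have c: "f \<in> Hom C (src C g) (tgt C g)" "g \<in> Hom C (src C g) (tgt C g)" using assms by (auto simp: Hom_iff)
  have "?h \<in> Hom C (src C g) (tgt C g)" using G.m_closed[OF G.inv_closed, of g f] c by simp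
  moreover have "f = g \<boxplus> ?h" using G.m_assoc[of g "inv\<^bsub>Hom_group C (src C g) (tgt C g)\<^esub> g" f] c
    G.r_inv[of g] G.inv_closed[of g] G.l_one[of f] by simp
  ultimately show ?thesis using that by (auto simp: Hom_iff)
qed

lemma cmp_add_Arr:
  "\<lbrakk>g \<in> Arr C; f \<in> Arr C; f' \<in> Arr C; src C f = src C f'; tgt C f = tgt C f'; src C g = tgt C f'\<rbrakk>
    \<Longrightarrow> g \<cdot> (f \<boxplus> f') = g \<cdot> f \<boxplus> g \<cdot> f'"
  by (intro cmp_add) (auto simp: Hom_iff)

lemma add_cmp_Arr:
  "\<lbrakk>g \<in> Arr C; g' \<in> Arr C; f \<in> Arr C; src C g = src C g'; tgt C g = tgt C g'; src C g' = tgt C f\<rbrakk>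
    \<Longrightarrow> (g \<boxplus> g') \<cdot> f = g \<cdot> f \<boxplus> g' \<cdot> f"
  by (intro add_cmp) (auto simp: Hom_iff)

lemma cmp_zer [simp]:
  assumes "g \<in> Arr C" "src C g = B" "A \<in> Obj C"
  shows "g \<cdot> zer C A B = zer C A (tgt C g)"
proof -
  have B: "B \<in> Obj C" using assms by auto
  have "g \<cdot> zer C A B \<boxplus> g \<cdot> zer C A B = g \<cdot> zer C A B"
    using assms B cmp_add_Arr[of g "zer C A B" "zer C A B"] by simp
  then show ?thesis by (rule add_cancel) (use assms B in auto)
qed

lemma zer_cmp [simp]:
  assumes "f \<in> Arr C" "tgt C f = B" "D \<in> Obj C"
  shows "zer C B D \<cdot> f = zer C (src C f) D"
proof -
  have B: "B \<in> Obj C" using assms by auto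
  have "zer C B D \<cdot> f \<boxplus> zer C B D \<cdot> f = zer C B D \<cdot> f"
    using assms B add_cmp_Arr[of "zer C B D" "zer C B D" f] by simp
  then show ?thesis by (rule add_cancel) (use assms B in auto)
qed

lemma is_monoI:
  assumes f: "f \<in> Arr C"
    and *: "\<And>x. \<lbrakk>x \<in> Arr C; tgt C x = src C f; f \<cdot> x = zer C (src C x) (tgt C f)\<rbrakk>
      \<Longrightarrow> x = zer C (src C x) (src C f)"
  shows "is_mono C f"
  unfolding is_mono_def
proof (intro conjI ballI impI)
  fix X g h assume "g \<in> Hom C X (src C f)" "h \<in> Hom C X (src C f)" and eq: "f \<cdot> g = f \<cdot> h"
  then have [simp]: "g \<in> Arr C" "h \<in> Arr C" "src C g = X" "src C h = X" "tgt C g = src C f"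
    "tgt C h = src C f" by (auto simp: Hom_iff)
  obtain d where d [simp]: "d \<in> Arr C" "src C d = src C h" "tgt C d = tgt C h" and gd: "g = h \<boxplus> d"
    using differenceE[of g h] by auto
  have "f \<cdot> g = f \<cdot> h \<boxplus> f \<cdot> d" unfolding gd using f by (simp add: cmp_add_Arr)
  then have "f \<cdot> h \<boxplus> f \<cdot> d = f \<cdot> h" using eq by simp
  then have "f \<cdot> d = zer C (src C d) (tgt C f)" by (rule add_cancel) (use f in auto)
  then have "d = zer C (src C d) (src C f)" by (intro *) auto
  then show "g = h" using gd by simp
qed (rule f)

lemma mono_zer:
  assumes "is_mono C f" "f \<cdot> x = zer C A (tgt C f)" "x \<in> Arr C" "src C x = A" "tgt C x = src C f"
    "src C f = B"
  shows "x = zer C A B"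
  by (rule mono_cancel[OF assms(1)]) (use assms is_mono_Arr[OF assms(1)] in auto)

lemma epi_zer:
  assumes "is_epi C f" "x \<cdot> f = zer C (src C f) B" "x \<in> Arr C" "tgt C x = B" "src C x = tgt C f"
    "tgt C f = A"
  shows "x = zer C A B"
  by (rule epi_cancel[OF assms(1)]) (use assms is_epi_Arr[OF assms(1)] in auto)

lemma kernelD:
  assumes "is_kernel C k f"
  shows "k \<in> Arr C" "f \<in> Arr C" "tgt C k = src C f" "f \<cdot> k = zer C (src C k) (tgt C f)"
  using assms by (auto simp: is_kernel_def)

lemma kernel_mono: assumes "is_kernel C k f" shows "is_mono C k"
proof (rule is_monoI)
  note [simp] = kernelD[OF assms]
  show "k \<in> Arr C" by simp
  fix x assume x [simp]: "x \<in> Arr C" "tgt C x = src C k" and 0: "k \<cdot> x = zer C (src C x) (tgt C k)"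
  have "\<exists>!u. u \<in> Hom C (src C x) (src C k) \<and> k \<cdot> u = zer C (src C x) (src C f)"
    using assms unfolding is_kernel_def by (simp add: Hom_iff)
  moreover have "zer C (src C x) (src C k) \<in> Hom C (src C x) (src C k) \<and>
      k \<cdot> zer C (src C x) (src C k) = zer C (src C x) (src C f)" by (simp add: Hom_iff)
  moreover have "x \<in> Hom C (src C x) (src C k) \<and> k \<cdot> x = zer C (src C x) (src C f)"
    using 0 by (simp add: Hom_iff)
  ultimately show "x = zer C (src C x) (src C k)" by blast
qed

lemma kernel_lift:
  assumes "is_kernel C k f" "x \<in> Arr C" "tgt C x = src C f" "f \<cdot> x = zer C (src C x) (tgt C f)"
  obtains u where "u \<in> Arr C" "src C u = src C x" "tgt C u = src C k" "k \<cdot> u = x"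
proof -
  have "\<exists>!u. u \<in> Hom C (src C x) (src C k) \<and> k \<cdot> u = x"
    using assms unfolding is_kernel_def by (simp add: Hom_iff)
  then obtain u where "u \<in> Hom C (src C x) (src C k)" "k \<cdot> u = x" by blast
  then show ?thesis using that by (auto simp: Hom_iff)
qed

lemma is_kernelI:
  assumes f: "f \<in> Arr C" and m: "is_mono C k" and [simp]: "tgt C k = src C f"
    and fk: "f \<cdot> k = zer C (src C k) (tgt C f)"
    and *: "\<And>x. \<lbrakk>x \<in> Arr C; tgt C x = src C f; f \<cdot> x = zer C (src C x) (tgt C f)\<rbrakk>
      \<Longrightarrow> \<exists>u \<in> Arr C. src C u = src C x \<and> tgt C u = src C k \<and> k \<cdot> u = x"
  shows "is_kernel C k f"
  unfolding is_kernel_def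
proof (intro conjI ballI impI)
  fix X h assume "h \<in> Hom C X (src C f)" "f \<cdot> h = zer C X (tgt C f)"
  then obtain u where u: "u \<in> Arr C" "src C u = X" "tgt C u = src C k" "k \<cdot> u = h"
    using *[of h] by (auto simp: Hom_iff)
  show "\<exists>!u. u \<in> Hom C X (src C k) \<and> k \<cdot> u = h"
  proof (rule ex1I[of _ u])
    fix v assume "v \<in> Hom C X (src C k) \<and> k \<cdot> v = h"
    then show "v = u" using mono_cancel[OF m, of v u] u by (simp add: Hom_iff)
  qed (use u in \<open>simp add: Hom_iff\<close>)
qed (use f fk is_mono_Arr[OF m] in auto)

lemma cokernelD:
  assumes "is_cokernel C q f"
  shows "q \<in> Arr C" "f \<in> Arr C" "src C q = tgt C f" "q \<cdot> f = zer C (src C f) (tgt C q)"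
  using assms by (auto simp: is_cokernel_def)

lemma cokernel_desc:
  assumes "is_cokernel C q f" "x \<in> Arr C" "src C x = tgt C f" "x \<cdot> f = zer C (src C f) (tgt C x)"
  obtains u where "u \<in> Arr C" "src C u = tgt C q" "tgt C u = tgt C x" "u \<cdot> q = x"
proof -
  have "\<exists>!u. u \<in> Hom C (tgt C q) (tgt C x) \<and> u \<cdot> q = x"
    using assms unfolding is_cokernel_def by (simp add: Hom_iff)
  then obtain u where "u \<in> Hom C (tgt C q) (tgt C x)" "u \<cdot> q = x" by blast
  then show ?thesis using that by (auto simp: Hom_iff)
qed

text \<open>The kernel of a split epimorphism \<open>g\<close> is split: \<open>1 - s g\<close> factors through it.\<close>

lemma split_epi_kernel:
  assumes k: "is_kernel C k g" and s: "s \<in> Arr C" "src C s = tgt C g" "tgt C s = src C g"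
    and gs: "g \<cdot> s = idn C (tgt C g)"
  obtains r where "r \<in> Arr C" "src C r = src C g" "tgt C r = src C k" "r \<cdot> k = idn C (src C k)"
    "s \<cdot> g \<boxplus> k \<cdot> r = idn C (src C g)"
proof -
  note [simp] = kernelD[OF k] s gs
  obtain h where [simp]: "h \<in> Arr C" "src C h = src C g" "tgt C h = src C g"
    and h: "idn C (src C g) = s \<cdot> g \<boxplus> h"
    using differenceE[of "idn C (src C g)" "s \<cdot> g"] by auto
  have "g = g \<cdot> (s \<cdot> g \<boxplus> h)" by (simp flip: h)
  also have "\<dots> = g \<boxplus> g \<cdot> h" by (simp add: cmp_add_Arr reassoc[OF gs])
  finally have "g \<boxplus> g \<cdot> h = g" by (rule sym)
  then have "g \<cdot> h = zer C (src C h) (tgt C g)" by (rule add_cancel) auto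
  then obtain r where r [simp]: "r \<in> Arr C" "src C r = src C h" "tgt C r = src C k" and kr: "k \<cdot> r = h"
    using kernel_lift[OF k, of h] by auto
  have "k = (s \<cdot> g \<boxplus> h) \<cdot> k" by (simp flip: h)
  also have "\<dots> = h \<cdot> k" by (simp add: add_cmp_Arr)
  also have "\<dots> = k \<cdot> (r \<cdot> k)" by (simp add: reassoc[OF kr])
  finally have kk: "k = k \<cdot> (r \<cdot> k)" .
  have "r \<cdot> k = idn C (src C k)"
    by (rule mono_cancel[OF kernel_mono[OF k]]) (simp_all add: kk[symmetric])
  with r kr h show ?thesis by (intro that[of r]) auto
qed

text \<open>The complement of a retract is the kernel of its retraction.\<close>

lemma retract_iff_direct_summand:
  assumes ker: "\<And>f. f \<in> Arr C \<Longrightarrow> \<exists>k. is_kernel C k f"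
  shows "retract A B \<longleftrightarrow> direct_summand C A B"
proof
  assume "retract A B"
  then obtain i p where [simp]: "i \<in> Arr C" "p \<in> Arr C" "src C i = A" "tgt C i = B" "src C p = B"
      "tgt C p = A" and pi [simp]: "p \<cdot> i = idn C A" and [simp]: "A \<in> Obj C" "B \<in> Obj C" by (rule retractE)
  obtain k where k: "is_kernel C k p" using ker[of p] by auto
  note [simp] = kernelD[OF k]
  obtain r where r [simp]: "r \<in> Arr C" "src C r = B" "tgt C r = src C k" "r \<cdot> k = idn C (src C k)"
    "i \<cdot> p \<boxplus> k \<cdot> r = idn C B" using split_epi_kernel[OF k, of i] by auto
  have kri: "k \<cdot> (r \<cdot> i) = zer C A B"
  proof -
    have "i = (i \<cdot> p \<boxplus> k \<cdot> r) \<cdot> i" by (simp only: r) simp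
    also have "\<dots> = i \<boxplus> k \<cdot> (r \<cdot> i)" by (subst add_cmp_Arr) simp_all
    finally have "i \<boxplus> k \<cdot> (r \<cdot> i) = i" by (rule sym)
    then show ?thesis by (rule add_cancel) auto
  qed
  have "r \<cdot> i = zer C A (src C k)" by (rule mono_zer[OF kernel_mono[OF k]]) (simp_all add: kri)
  then have "is_biproduct C A (src C k) B i k p r" by (simp add: is_biproduct_def Hom_iff)
  then show "direct_summand C A B" unfolding direct_summand_def by blast
next
  assume "direct_summand C A B"
  then show "retract A B" unfolding direct_summand_def is_biproduct_def retract_def by blast
qed

end

section \<open>Duality\<close>

definition opp :: "('o, 'm) cat \<Rightarrow> ('o, 'm) cat"
  where "opp C = \<lparr>Obj = Obj C, Arr = Arr C, src = tgt C, tgt = src C, idn = idn C,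
    cmp = (\<lambda>g f. cmp C f g), add = add C, zer = (\<lambda>A B. zer C B A)\<rparr>"

lemma opp_simps [simp]:
  "Obj (opp C) = Obj C" "Arr (opp C) = Arr C" "src (opp C) = tgt C" "tgt (opp C) = src C"
  "idn (opp C) = idn C" "cmp (opp C) g f = cmp C f g" "add (opp C) = add C" "zer (opp C) A B = zer C B A"
  by (simp_all add: opp_def)

lemma opp_opp [simp]: "opp (opp C) = C"
  by (simp add: opp_def)

lemma Hom_opp [simp]: "Hom (opp C) A B = Hom C B A"
  by (auto simp: Hom_def)

lemma Hom_group_opp: "Hom_group (opp C) A B = Hom_group C B A"
  by (simp add: Hom_group_def)

lemma is_mono_opp [simp]: "is_mono (opp C) f = is_epi C f"
  by (simp add: is_mono_def is_epi_def)

lemma is_epi_opp [simp]: "is_epi (opp C) f = is_mono C f"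
  by (simp add: is_mono_def is_epi_def)

lemma is_kernel_opp [simp]: "is_kernel (opp C) k f = is_cokernel C k f"
  by (simp add: is_kernel_def is_cokernel_def)

lemma is_cokernel_opp [simp]: "is_cokernel (opp C) k f = is_kernel C k f"
  by (simp add: is_kernel_def is_cokernel_def)

lemma zero_object_opp [simp]: "zero_object (opp C) Z = zero_object C Z"
  by (auto simp: zero_object_def)

lemma is_biproduct_opp: "is_biproduct (opp C) A B S i j p q = is_biproduct C A B S p q i j"
  by (auto simp: is_biproduct_def)

lemma direct_summand_opp [simp]: "direct_summand (opp C) = direct_summand C"
  unfolding direct_summand_def is_biproduct_opp by (intro ext) blast

lemma (in category) category_opp: "category (opp C)"
  by unfold_locales (auto simp: Hom_iff)

lemma (in preadditive_category) preadditive_opp: "preadditive_category (opp C)"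
proof -
  interpret op: category "opp C" by (rule category_opp)
  show ?thesis
    by (intro preadditive_category.intro category_opp preadditive_category_axioms.intro)
      (simp_all add: Hom_comm_group Hom_group_opp Hom_iff cmp_add_Arr add_cmp_Arr)
qed

lemma (in abelian_category) abelian_opp: "abelian_category (opp C)"
proof -
  interpret op: preadditive_category "opp C" by (rule preadditive_opp)
  show ?thesis
  proof (intro abelian_category.intro preadditive_opp abelian_category_axioms.intro)
    fix A B assume "A \<in> Obj (opp C)" "B \<in> Obj (opp C)"
    then show "\<exists>S i j p q. is_biproduct (opp C) A B S i j p q"
      unfolding is_biproduct_opp using has_biproducts[of A B] by auto blast
  qed (use has_zero_object has_kernels has_cokernels mono_is_kernel epi_is_cokernel in simp_all)
qed


context category
begin

lemma epi_cmp: "\<lbrakk>is_epi C f; is_epi C g; src C g = tgt C f\<rbrakk> \<Longrightarrow> is_epi C (g \<cdot> f)"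
  using category.mono_cmp[OF category_opp, of g f] by simp

lemma epi_cmpD: "\<lbrakk>is_epi C (g \<cdot> f); f \<in> Arr C; g \<in> Arr C; src C g = tgt C f\<rbrakk> \<Longrightarrow> is_epi C g"
  using category.mono_cmpD[OF category_opp, of f g] by simp

lemma split_epi:
  "\<lbrakk>i \<in> Arr C; p \<in> Arr C; tgt C i = src C p; p \<cdot> i = idn C (tgt C p)\<rbrakk> \<Longrightarrow> is_epi C p"
  using category.split_mono[OF category_opp, of p i] by simp

lemma is_iso_opp [simp]: "is_iso (opp C) f = is_iso C f"
  by (auto simp: is_iso_def)

lemma iso_epi: "is_iso C f \<Longrightarrow> is_epi C f"
  using category.iso_mono[OF category_opp, of f] by simp

lemma retract_opp [simp]: "category.retract (opp C) A B = retract A B"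
  unfolding retract_def category.retract_def[OF category_opp] by auto

lemma retract_refl: "A \<in> Obj C \<Longrightarrow> retract A A"
  unfolding retract_def by (intro bexI[of _ "idn C A"]) (simp_all add: Hom_iff)

lemma iso_retract:
  assumes "is_iso C f"
  shows "retract (src C f) (tgt C f)" "retract (tgt C f) (src C f)"
  using assms by (auto elim!: is_isoE simp: retract_def Hom_iff intro!: bexI)

text \<open>An isomorphism has no other left inverse than its inverse.\<close>

lemma iso_left_inverse:
  assumes f: "is_iso C f" and g: "g \<in> Arr C" "src C g = tgt C f" "g \<cdot> f = idn C (src C f)"
  shows "is_iso C g"
proof -
  obtain h where h: "f \<in> Arr C" "h \<in> Arr C" "src C h = tgt C f" "tgt C h = src C f"
    "h \<cdot> f = idn C (src C f)" "f \<cdot> h = idn C (tgt C f)" using f by (rule is_isoE)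
  have tg: "tgt C g = src C f" using cmp_Arr(3)[of f g] g h by simp
  have "g = h" by (rule epi_cancel[OF iso_epi[OF f]]) (use g h tg in simp_all)
  then show ?thesis using h by (auto simp: is_iso_def Hom_iff)
qed

end


context preadditive_category
begin

lemma is_epiI:
  assumes "f \<in> Arr C"
    and "\<And>x. \<lbrakk>x \<in> Arr C; src C x = tgt C f; x \<cdot> f = zer C (src C f) (tgt C x)\<rbrakk>
      \<Longrightarrow> x = zer C (tgt C f) (tgt C x)"
  shows "is_epi C f"
  using preadditive_category.is_monoI[OF preadditive_opp, of f] assms by simp

lemma cokernel_epi: "is_cokernel C q f \<Longrightarrow> is_epi C q"
  using preadditive_category.kernel_mono[OF preadditive_opp, of q f] by simp

lemma add_right_cancel:
  assumes "f \<boxplus> h = g \<boxplus> h" "f \<in> Arr C" "g \<in> Arr C" "h \<in> Arr C" "src C f = src C h"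
    "tgt C f = tgt C h" "src C g = src C h" "tgt C g = tgt C h"
  shows "f = g"
proof -
  interpret G: comm_group "Hom_group C (src C h) (tgt C h)" using Hom_comm_group assms by simp
  show ?thesis using G.right_cancel[of h f g] assms by (simp add: Hom_iff)
qed

lemma zero_object_iff: "Z \<in> Obj C \<Longrightarrow> zero_object C Z \<longleftrightarrow> idn C Z = zer C Z Z"
proof
  assume Z: "Z \<in> Obj C" and 0: "zero_object C Z"
  have "\<exists>!f. f \<in> Hom C Z Z" using Z 0 unfolding zero_object_def by blast
  then show "idn C Z = zer C Z Z" using idn_Hom[OF Z] zer_Hom[OF Z Z] by blast
next
  assume Z: "Z \<in> Obj C" and 0: "idn C Z = zer C Z Z"
  have "\<exists>!f. f \<in> Hom C A Z" if A: "A \<in> Obj C" for A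
  proof (rule ex1I[of _ "zer C A Z"])
    show "zer C A Z \<in> Hom C A Z" using zer_Hom A Z by simp
    fix f assume "f \<in> Hom C A Z"
    then have [simp]: "f \<in> Arr C" "src C f = A" "tgt C f = Z" by (auto simp: Hom_iff)
    have "f = idn C Z \<cdot> f" by simp
    also have "\<dots> = zer C A Z" unfolding 0 using Z by simp
    finally show "f = zer C A Z" .
  qed
  moreover have "\<exists>!f. f \<in> Hom C Z A" if A: "A \<in> Obj C" for A
  proof (rule ex1I[of _ "zer C Z A"])
    show "zer C Z A \<in> Hom C Z A" using zer_Hom A Z by simp
    fix f assume "f \<in> Hom C Z A"
    then have [simp]: "f \<in> Arr C" "src C f = Z" "tgt C f = A" by (auto simp: Hom_iff)
    have "f = f \<cdot> idn C Z" by simp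
    also have "\<dots> = zer C Z A" unfolding 0 using Z A by simp
    finally show "f = zer C Z A" .
  qed
  ultimately show "zero_object C Z" using Z by (simp add: zero_object_def)
qed

end


section \<open>Images and fibre products\<close>

context abelian_category
begin

text \<open>A monomorphism is a kernel of some \<open>g\<close>; since \<open>g\<close> factors through the cokernel \<open>q\<close>, everything that
  \<open>q\<close> kills is killed by \<open>g\<close>.\<close>

lemma mono_kernel_of_cokernel:
  assumes m: "is_mono C m" and q: "is_cokernel C q m"
  shows "is_kernel C m q"
proof -
  note [simp] = cokernelD[OF q]
  obtain g where g: "is_kernel C m g" using mono_is_kernel[OF m] by blast
  note [simp] = kernelD[OF g]
  obtain g' where g' [simp]: "g' \<in> Arr C" "src C g' = tgt C q" "tgt C g' = tgt C g" "g' \<cdot> q = g"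
    using cokernel_desc[OF q, of g] by auto
  show ?thesis
  proof (rule is_kernelI)
    fix x assume [simp]: "x \<in> Arr C" "tgt C x = src C q" and qx: "q \<cdot> x = zer C (src C x) (tgt C q)"
    have "g \<cdot> x = g' \<cdot> (q \<cdot> x)" by (simp add: reassoc[OF g'(4)])
    also have "\<dots> = zer C (src C x) (tgt C g)" by (simp add: qx)
    finally obtain u where "u \<in> Arr C" "src C u = src C x" "tgt C u = src C m" "m \<cdot> u = x"
      using kernel_lift[OF g, of x] by auto
    then show "\<exists>u\<in>Arr C. src C u = src C x \<and> tgt C u = src C m \<and> m \<cdot> u = x" by blast
  qed (use m in simp_all)
qed

lemma epi_cokernel_of_kernel:
  assumes "is_epi C e" and "is_kernel C k e"
  shows "is_cokernel C e k"
  using abelian_category.mono_kernel_of_cokernel[OF abelian_opp, of e k] assms by simp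

text \<open>If the kernel of \<open>g\<close> is epi then \<open>g = 0\<close>, so the identity factors through that kernel.\<close>

lemma mono_epi_iso:
  assumes m: "is_mono C f" and e: "is_epi C f"
  shows "is_iso C f"
proof -
  obtain g where g: "is_kernel C f g" using mono_is_kernel[OF m] by blast
  note [simp] = kernelD[OF g]
  have "g = zer C (tgt C f) (tgt C g)" by (rule epi_zer[OF e]) simp_all
  then have "g \<cdot> idn C (tgt C f) = zer C (tgt C f) (tgt C g)" by (subst cmp_idn_Arr) simp_all
  then obtain u where u [simp]: "u \<in> Arr C" "src C u = tgt C f" "tgt C u = src C f"
      and fu: "f \<cdot> u = idn C (tgt C f)"
    using kernel_lift[OF g, of "idn C (tgt C f)"] by auto
  have "u \<cdot> f = idn C (src C f)"
    by (rule mono_cancel[OF m]) (simp_all add: reassoc[OF fu[simplified]])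
  with fu show ?thesis by (auto simp: is_iso_def Hom_iff)
qed

text \<open>The subobject \<open>m = ker (coker f)\<close> is the image: an arrow killing \<open>e\<close> has a kernel \<open>k\<close> through
  which \<open>e\<close> factors, so \<open>coker (m k)\<close> kills \<open>f\<close>, hence \<open>m\<close>, and \<open>k\<close> is split.\<close>

lemma image_factorization:
  assumes q: "is_cokernel C q f" and m: "is_kernel C m q"
  obtains e where "is_epi C e" "src C e = src C f" "tgt C e = src C m" "m \<cdot> e = f"
proof -
  note [simp] = cokernelD[OF q] kernelD[OF m]
  obtain e where e [simp]: "e \<in> Arr C" "src C e = src C f" "tgt C e = src C m" "m \<cdot> e = f"
    using kernel_lift[OF m, of f] by auto
  have "is_epi C e"
  proof (rule is_epiI)
    fix h assume h [simp]: "h \<in> Arr C" "src C h = tgt C e" and he: "h \<cdot> e = zer C (src C e) (tgt C h)"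
    obtain k where k: "is_kernel C k h" using has_kernels[of h] by auto
    note [simp] = kernelD[OF k]
    obtain e' where e' [simp]: "e' \<in> Arr C" "src C e' = src C e" "tgt C e' = src C k" "k \<cdot> e' = e"
      using kernel_lift[OF k, of e] he by auto
    have mk: "is_mono C (m \<cdot> k)"
      by (rule mono_cmp) (simp_all add: kernel_mono[OF k] kernel_mono[OF m])
    obtain p where p: "is_kernel C (m \<cdot> k) p" using mono_is_kernel[OF mk] by blast
    have [simp]: "p \<in> Arr C" "src C p = tgt C f" using kernelD(2,3)[OF p] by simp_all
    have pmk: "p \<cdot> (m \<cdot> k) = zer C (src C k) (tgt C p)" using kernelD(4)[OF p] by simp
    have "p \<cdot> f = p \<cdot> (m \<cdot> (k \<cdot> e'))" by simp
    also have "\<dots> = (p \<cdot> (m \<cdot> k)) \<cdot> e'" by (simp del: e'(4))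
    also have "\<dots> = zer C (src C f) (tgt C p)" by (simp add: pmk)
    finally obtain p' where p' [simp]: "p' \<in> Arr C" "src C p' = tgt C q" "tgt C p' = tgt C p" "p' \<cdot> q = p"
      using cokernel_desc[OF q, of p] by auto
    have "p \<cdot> m = p' \<cdot> (q \<cdot> m)" by (subst reassoc[OF p'(4)]) simp_all
    also have "\<dots> = zer C (src C m) (tgt C p)" by simp
    finally obtain t where t [simp]: "t \<in> Arr C" "src C t = src C m" "tgt C t = src C k"
        and mkt: "(m \<cdot> k) \<cdot> t = m"
      using kernel_lift[OF p, of m] by auto
    have kt: "k \<cdot> t = idn C (src C m)"
      by (rule mono_cancel[OF kernel_mono[OF m]]) (use mkt in simp_all)
    have "h = h \<cdot> (k \<cdot> t)" unfolding kt by simp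
    also have "\<dots> = zer C (tgt C e) (tgt C h)" by (simp add: reassoc[OF kernelD(4)[OF k]])
    finally show "h = zer C (tgt C e) (tgt C h)" .
  qed simp
  with e show ?thesis by (intro that[of e])
qed


text \<open>The fibre product is the kernel of the difference \<open>\<phi> = f p - y q\<close> on the biproduct of the sources.
  Epimorphisms are stable under it: if \<open>f\<close> is epi, then so is \<open>\<phi>\<close>, which is therefore the cokernel of
  its kernel \<open>\<kappa>\<close>. An \<open>h\<close> that kills \<open>q \<kappa>\<close> makes \<open>h q\<close> factor through \<open>\<phi>\<close> as \<open>h' \<phi>\<close>, and restricting
  to the source of \<open>f\<close> gives \<open>h' f = 0\<close>, so \<open>h' = 0\<close> and \<open>h = 0\<close>.\<close>

lemma pullback:
  assumes f [simp]: "f \<in> Arr C" and y [simp]: "y \<in> Arr C" and fy [simp]: "tgt C f = tgt C y"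
  obtains p e where "p \<in> Arr C" "e \<in> Arr C" "src C p = src C e" "tgt C p = src C f" "tgt C e = src C y"
    "f \<cdot> p = y \<cdot> e"
    "\<And>a b. \<lbrakk>a \<in> Arr C; b \<in> Arr C; src C a = src C b; tgt C a = src C f; tgt C b = src C y; f \<cdot> a = y \<cdot> b\<rbrakk>
      \<Longrightarrow> \<exists>u \<in> Arr C. src C u = src C b \<and> tgt C u = src C e \<and> p \<cdot> u = a \<and> e \<cdot> u = b"
    "\<And>u v. \<lbrakk>u \<in> Arr C; v \<in> Arr C; src C u = src C v; tgt C u = src C e; tgt C v = src C e;
      p \<cdot> u = p \<cdot> v; e \<cdot> u = e \<cdot> v\<rbrakk> \<Longrightarrow> u = v"
    "is_epi C f \<Longrightarrow> is_epi C e" "is_epi C y \<Longrightarrow> is_epi C p"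
proof -
  obtain S i j p q where b: "is_biproduct C (src C f) (src C y) S i j p q"
    using has_biproducts[of "src C f" "src C y"] by auto
  then have [simp]: "S \<in> Obj C" "i \<in> Arr C" "j \<in> Arr C" "p \<in> Arr C" "q \<in> Arr C"
      "src C i = src C f" "tgt C i = S" "src C j = src C y" "tgt C j = S"
      "src C p = S" "tgt C p = src C f" "src C q = S" "tgt C q = src C y"
    and pi [simp]: "p \<cdot> i = idn C (src C f)" and qj [simp]: "q \<cdot> j = idn C (src C y)"
    and qi [simp]: "q \<cdot> i = zer C (src C f) (src C y)" and pj [simp]: "p \<cdot> j = zer C (src C y) (src C f)"
    and one: "i \<cdot> p \<boxplus> j \<cdot> q = idn C S"
    by (auto simp: is_biproduct_def Hom_iff)
  (* y' is -y *)
  obtain y' where y' [simp]: "y' \<in> Arr C" "src C y' = src C y" "tgt C y' = tgt C y"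
      and yy': "zer C (src C y) (tgt C y) = y \<boxplus> y'"
    using differenceE[of "zer C (src C y) (tgt C y)" y] by auto
  define \<phi> where "\<phi> = f \<cdot> p \<boxplus> y' \<cdot> q"
  have \<phi> [simp]: "\<phi> \<in> Arr C" "src C \<phi> = S" "tgt C \<phi> = tgt C y" by (simp_all add: \<phi>_def)
  have \<phi>i: "\<phi> \<cdot> i = f" and \<phi>j: "\<phi> \<cdot> j = y'" by (simp_all add: \<phi>_def add_cmp_Arr)
  obtain \<kappa> where k: "is_kernel C \<kappa> \<phi>" using has_kernels[OF \<phi>(1)] by blast
  have [simp]: "\<kappa> \<in> Arr C" "tgt C \<kappa> = S" using kernelD[OF k] by auto
  have \<phi>\<kappa>: "\<phi> \<cdot> \<kappa> = zer C (src C \<kappa>) (tgt C y)" using kernelD(4)[OF k] by simp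
  have sum0: "y \<cdot> x \<boxplus> y' \<cdot> x = zer C (src C x) (tgt C y)" if "x \<in> Arr C" "tgt C x = src C y" for x
    using that by (simp flip: add_cmp_Arr yy')
  have \<phi>x: "\<phi> \<cdot> x = f \<cdot> (p \<cdot> x) \<boxplus> y' \<cdot> (q \<cdot> x)" if "x \<in> Arr C" "tgt C x = S" for x
    using that by (simp add: \<phi>_def add_cmp_Arr)
  have eq: "f \<cdot> (p \<cdot> \<kappa>) = y \<cdot> (q \<cdot> \<kappa>)"
    by (rule add_right_cancel[of _ "y' \<cdot> (q \<cdot> \<kappa>)"]) (simp_all add: sum0 \<phi>\<kappa> flip: \<phi>x)
  have jm: "u = v" if [simp]: "u \<in> Arr C" "v \<in> Arr C" "src C u = src C v" "tgt C u = src C \<kappa>" "tgt C v = src C \<kappa>"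
    and eq: "p \<cdot> (\<kappa> \<cdot> u) = p \<cdot> (\<kappa> \<cdot> v)" "q \<cdot> (\<kappa> \<cdot> u) = q \<cdot> (\<kappa> \<cdot> v)" for u v
  proof -
    have x: "(i \<cdot> p \<boxplus> j \<cdot> q) \<cdot> x = i \<cdot> (p \<cdot> x) \<boxplus> j \<cdot> (q \<cdot> x)" if "x \<in> Arr C" "tgt C x = S" for x
      using that by (simp add: add_cmp_Arr)
    have "(i \<cdot> p \<boxplus> j \<cdot> q) \<cdot> (\<kappa> \<cdot> u) = (i \<cdot> p \<boxplus> j \<cdot> q) \<cdot> (\<kappa> \<cdot> v)" by (simp add: x eq)
    then have "\<kappa> \<cdot> u = \<kappa> \<cdot> v" unfolding one by simp
    then show ?thesis by - (rule mono_cancel[OF kernel_mono[OF k] that(1-2)], simp_all)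
  qed
  have univ: "\<exists>u \<in> Arr C. src C u = src C b \<and> tgt C u = src C \<kappa> \<and> (p \<cdot> \<kappa>) \<cdot> u = a \<and> (q \<cdot> \<kappa>) \<cdot> u = b"
    if [simp]: "a \<in> Arr C" "b \<in> Arr C" "src C a = src C b" "tgt C a = src C f" "tgt C b = src C y"
      and ab: "f \<cdot> a = y \<cdot> b" for a b
  proof -
    have pw: "p \<cdot> (i \<cdot> a \<boxplus> j \<cdot> b) = a" and qw: "q \<cdot> (i \<cdot> a \<boxplus> j \<cdot> b) = b"
      by (simp_all add: cmp_add_Arr reassoc[OF pi] reassoc[OF pj] reassoc[OF qi] reassoc[OF qj])
    have "\<phi> \<cdot> (i \<cdot> a \<boxplus> j \<cdot> b) = zer C (src C b) (tgt C y)" by (simp add: \<phi>x pw qw ab sum0)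
    then obtain u where [simp]: "u \<in> Arr C" "src C u = src C b" "tgt C u = src C \<kappa>"
        and u: "\<kappa> \<cdot> u = i \<cdot> a \<boxplus> j \<cdot> b"
      using kernel_lift[OF k, of "i \<cdot> a \<boxplus> j \<cdot> b"] by auto
    then show ?thesis by (intro bexI[of _ u]) (simp_all add: pw qw)
  qed
  have epi: "is_epi C e" if \<phi>e: "is_epi C (\<phi> \<cdot> i')" and e: "e = p' \<cdot> \<kappa>"
    and i' [simp]: "i' \<in> Arr C" "tgt C i' = S"
    and p' [simp]: "p' \<in> Arr C" "src C p' = S" "p' \<cdot> i' = zer C (src C i') (tgt C p')" "is_epi C p'"
    for i' p' e
  proof (rule is_epiI)
    show e_arr [simp]: "e \<in> Arr C" unfolding e by simp
    have [simp]: "tgt C e = tgt C p'" "src C e = src C \<kappa>" unfolding e by simp_all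
    fix h assume [simp]: "h \<in> Arr C" "src C h = tgt C e" and he: "h \<cdot> e = zer C (src C e) (tgt C h)"
    have "is_epi C \<phi>" using epi_cmpD[OF \<phi>e] by simp
    then have co: "is_cokernel C \<phi> \<kappa>" using epi_cokernel_of_kernel k by blast
    have "(h \<cdot> p') \<cdot> \<kappa> = zer C (src C \<kappa>) (tgt C h)" using he unfolding e by simp
    then obtain h' where [simp]: "h' \<in> Arr C" "src C h' = tgt C y" "tgt C h' = tgt C h"
        and h': "h' \<cdot> \<phi> = h \<cdot> p'" using cokernel_desc[OF co, of "h \<cdot> p'"] by auto
    have "h' \<cdot> (\<phi> \<cdot> i') = zer C (src C i') (tgt C h)" by (simp add: reassoc[OF h'])
    then have "h' = zer C (tgt C y) (tgt C h)" by - (rule epi_zer[OF \<phi>e], simp_all)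
    then have "h \<cdot> p' = zer C S (tgt C h)" using h' by simp
    then show "h = zer C (tgt C e) (tgt C h)" by - (rule epi_zer[OF p'(4)], simp_all)
  qed
  have ep: "is_epi C p" by (rule split_epi[of i]) simp_all
  have eq': "is_epi C q" by (rule split_epi[of j]) simp_all
  have "is_epi C y'" if ye: "is_epi C y"
  proof (rule is_epiI)
    fix h assume [simp]: "h \<in> Arr C" "src C h = tgt C y'" and h: "h \<cdot> y' = zer C (src C y') (tgt C h)"
    have "h \<cdot> (y \<boxplus> y') = zer C (src C y) (tgt C h)" by (simp flip: yy')
    then have "h \<cdot> y = zer C (src C y) (tgt C h)" using h by (simp add: cmp_add_Arr)
    then show "h = zer C (tgt C y') (tgt C h)" by - (rule epi_zer[OF ye], simp_all)
  qed simp
  then show ?thesis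
    by (intro that[of "p \<cdot> \<kappa>" "q \<cdot> \<kappa>"])
      (simp_all add: eq univ jm epi[of i "q \<cdot> \<kappa>" q] epi[of j "p \<cdot> \<kappa>" p] ep eq' \<phi>i \<phi>j)
qed

lemma epi_lift:
  assumes "is_epi C f" "y \<in> Arr C" "tgt C y = tgt C f"
  obtains e x where "is_epi C e" "e \<in> Arr C" "tgt C e = src C y" "x \<in> Arr C" "src C x = src C e"
    "tgt C x = src C f" "f \<cdot> x = y \<cdot> e"
  using pullback[of f y] assms is_epi_Arr[of f] by (metis (full_types))

end

section \<open>Exactness\<close>

definition short_exact :: "('o, 'm) cat \<Rightarrow> 'm \<Rightarrow> 'm \<Rightarrow> bool"
  where "short_exact C f g \<longleftrightarrow> is_kernel C f g \<and> is_cokernel C g f"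

lemma short_exact_opp [simp]: "short_exact (opp C) g f = short_exact C f g"
  by (auto simp: short_exact_def)

text \<open>The generalized element \<open>y\<close> lies in the image of \<open>f\<close>: it lifts along \<open>f\<close> after passing to an epimorphic
  cover of its source. By the next lemmas, exactness and epimorphisms can be tested on generalized
  elements, which makes diagram chases work as for modules.\<close>

definition covers :: "('o, 'm) cat \<Rightarrow> 'm \<Rightarrow> 'm \<Rightarrow> bool"
  where "covers C f y \<longleftrightarrow> (\<exists>e x. is_epi C e \<and> tgt C e = src C y \<and> x \<in> Hom C (src C e) (src C f) \<and>
    cmp C f x = cmp C y e)"

context abelian_category
begin

lemma coversE:
  assumes "covers C f y"
  obtains e x where "is_epi C e" "e \<in> Arr C" "tgt C e = src C y" "x \<in> Arr C" "src C x = src C e"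
    "tgt C x = src C f" "f \<cdot> x = y \<cdot> e"
  using assms is_epi_Arr unfolding covers_def Hom_iff by blast

lemma coversI:
  assumes "is_epi C e" "tgt C e = src C y" "x \<in> Arr C" "src C x = src C e"
    "tgt C x = src C f" "f \<cdot> x = y \<cdot> e"
  shows "covers C f y"
  using assms unfolding covers_def Hom_iff by blast

lemma epi_covers: "is_epi C f \<Longrightarrow> y \<in> Arr C \<Longrightarrow> tgt C y = tgt C f \<Longrightarrow> covers C f y"
  by (rule epi_lift[of f y]) (auto intro: coversI)

lemma covers_epi:
  assumes f: "f \<in> Arr C" and *: "covers C f (idn C (tgt C f))"
  shows "is_epi C f"
proof -
  obtain e x where e: "is_epi C e" "e \<in> Arr C" "tgt C e = src C (idn C (tgt C f))" "x \<in> Arr C"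
    "src C x = src C e" "tgt C x = src C f" "f \<cdot> x = idn C (tgt C f) \<cdot> e"
    using * by (rule coversE)
  then have "is_epi C (f \<cdot> x)" using f by simp
  then show ?thesis using epi_cmpD[of f x] e f by simp
qed

lemma exact_atD:
  assumes "exact_at C f g"
  shows "f \<in> Arr C" "g \<in> Arr C" "tgt C f = src C g" "g \<cdot> f = zer C (src C f) (tgt C g)"
proof -
  obtain k q where k: "is_cokernel C q f" "is_kernel C k q" "is_kernel C k g" and [simp]: "tgt C f = src C g"
    using assms by (auto simp: exact_at_def is_image_def)
  note [simp] = cokernelD(1,2,4)[OF k(1)] kernelD[OF k(3)]
  have [simp]: "src C q = src C g" using cokernelD(3)[OF k(1)] by simp
  show "f \<in> Arr C" "g \<in> Arr C" "tgt C f = src C g" by simp_all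
  obtain e where [simp]: "e \<in> Arr C" "src C e = src C f" "tgt C e = src C k" and e: "k \<cdot> e = f"
    using kernel_lift[OF k(2), of f] by auto
  have "g \<cdot> f = g \<cdot> (k \<cdot> e)" by (simp only: e)
  also have "\<dots> = zer C (src C f) (tgt C g)" by (subst reassoc[OF kernelD(4)[OF k(3)]]) simp_all
  finally show "g \<cdot> f = zer C (src C f) (tgt C g)" .
qed

lemma exact_at_covers:
  assumes "exact_at C f g" and y: "y \<in> Arr C" "tgt C y = src C g" "g \<cdot> y = zer C (src C y) (tgt C g)"
  shows "covers C f y"
proof -
  note [simp] = exact_atD[OF assms(1)] y
  obtain k q where k: "is_cokernel C q f" "is_kernel C k q" "is_kernel C k g"
    using assms by (auto simp: exact_at_def is_image_def)
  note [simp] = kernelD(1,3)[OF k(3)]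
  obtain e where e: "is_epi C e" and [simp]: "src C e = src C f" "tgt C e = src C k" and ke: "k \<cdot> e = f"
    using image_factorization[OF k(1,2)] by blast
  note [simp] = is_epi_Arr[OF e]
  obtain t where [simp]: "t \<in> Arr C" "src C t = src C y" "tgt C t = src C k" and t: "k \<cdot> t = y"
    using kernel_lift[OF k(3), of y] by auto
  have "covers C e t" by (rule epi_covers) (simp_all add: e)
  then obtain d x where d: "is_epi C d" and [simp]: "d \<in> Arr C" "tgt C d = src C t" "x \<in> Arr C" "src C x = src C d"
    "tgt C x = src C e" and ex: "e \<cdot> x = t \<cdot> d" by (rule coversE)
  have "f \<cdot> x = k \<cdot> (e \<cdot> x)" by (subst reassoc[OF ke]) simp_all
  also have "\<dots> = y \<cdot> d" unfolding ex by (subst reassoc[OF t]) simp_all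
  finally show ?thesis using d by (intro coversI[of d _ x]) simp_all
qed

lemma exact_atI:
  assumes [simp]: "f \<in> Arr C" "g \<in> Arr C" "tgt C f = src C g" and gf: "g \<cdot> f = zer C (src C f) (tgt C g)"
    and *: "\<And>y. \<lbrakk>y \<in> Arr C; tgt C y = src C g; g \<cdot> y = zer C (src C y) (tgt C g)\<rbrakk> \<Longrightarrow> covers C f y"
  shows "exact_at C f g"
proof -
  obtain q where q: "is_cokernel C q f" using has_cokernels[of f] by auto
  have [simp]: "q \<in> Arr C" "src C q = src C g" using cokernelD[OF q] by simp_all
  obtain k where k: "is_kernel C k q" using has_kernels[of q] by auto
  note [simp] = kernelD(1,3)[OF k]
  obtain g' where [simp]: "g' \<in> Arr C" "src C g' = tgt C q" "tgt C g' = tgt C g" and g': "g' \<cdot> q = g"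
    using cokernel_desc[OF q, of g] gf by auto
  have "is_kernel C k g"
  proof (rule is_kernelI)
    show "is_mono C k" by (rule kernel_mono[OF k])
    have "g \<cdot> k = g' \<cdot> (q \<cdot> k)" by (subst reassoc[OF g']) simp_all
    then show "g \<cdot> k = zer C (src C k) (tgt C g)" using kernelD(4)[OF k] by simp
    fix y assume [simp]: "y \<in> Arr C" "tgt C y = src C g" and "g \<cdot> y = zer C (src C y) (tgt C g)"
    then have "covers C f y" by (intro *) simp_all
    then obtain e x where e: "is_epi C e" and [simp]: "e \<in> Arr C" "tgt C e = src C y" "x \<in> Arr C"
      "src C x = src C e" "tgt C x = src C f" and x: "f \<cdot> x = y \<cdot> e" by (rule coversE)
    have "(q \<cdot> y) \<cdot> e = q \<cdot> (f \<cdot> x)" by (simp add: x)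
    also have "\<dots> = zer C (src C e) (tgt C q)" by (subst reassoc[OF cokernelD(4)[OF q]]) simp_all
    finally have "q \<cdot> y = zer C (src C y) (tgt C q)" by - (rule epi_zer[OF e], simp_all)
    then obtain u where "u \<in> Arr C" "src C u = src C y" "tgt C u = src C k" "k \<cdot> u = y"
      using kernel_lift[OF k, of y] by auto
    then show "\<exists>u\<in>Arr C. src C u = src C y \<and> tgt C u = src C k \<and> k \<cdot> u = y" by blast
  qed simp_all
  then show ?thesis unfolding exact_at_def is_image_def using q k by auto
qed

lemma short_exactD:
  assumes "short_exact C f g"
  shows "f \<in> Arr C" "g \<in> Arr C" "tgt C f = src C g" "g \<cdot> f = zer C (src C f) (tgt C g)"
    "is_mono C f" "is_epi C g" "is_kernel C f g" "is_cokernel C g f"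
  using assms kernelD[of f g] kernel_mono[of f g] cokernel_epi[of g f] unfolding short_exact_def by auto

lemma short_exact_epiI: "is_kernel C f g \<Longrightarrow> is_epi C g \<Longrightarrow> short_exact C f g"
  using epi_cokernel_of_kernel by (auto simp: short_exact_def)

lemma short_exact_monoI: "is_cokernel C g f \<Longrightarrow> is_mono C f \<Longrightarrow> short_exact C f g"
  using mono_kernel_of_cokernel by (auto simp: short_exact_def)

lemma cokernel_exact:
  assumes q: "is_cokernel C q f"
  shows "exact_at C f q"
proof -
  note [simp] = cokernelD[OF q]
  obtain k where k: "is_kernel C k q" using has_kernels[of q] by auto
  then show ?thesis unfolding exact_at_def is_image_def using q by auto
qed

text \<open>With \<open>k\<close> the kernel of \<open>q\<close>, exactness makes \<open>f\<close> an epimorphism followed by \<open>k\<close>, so that \<open>f\<close> and \<open>k\<close> have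
  the same cokernel.\<close>

lemma epi_exact_cokernel:
  assumes e: "is_epi C q" and x: "exact_at C f q"
  shows "is_cokernel C q f"
proof -
  note [simp] = exact_atD[OF x]
  obtain p k where p: "is_cokernel C p f" "is_kernel C k p" "is_kernel C k q"
    using x by (auto simp: exact_at_def is_image_def)
  obtain d where d: "is_epi C d" "src C d = src C f" "tgt C d = src C k" "k \<cdot> d = f"
    using image_factorization[OF p(1,2)] by blast
  note [simp] = kernelD(1,3)[OF p(3)] d(2,3) is_epi_Arr[OF d(1)]
  have c: "is_cokernel C q k" using epi_cokernel_of_kernel[OF e p(3)] .
  interpret op: abelian_category "opp C" by (rule abelian_opp)
  have "is_kernel (opp C) q f"
  proof (rule op.is_kernelI)
    fix x assume "x \<in> Arr (opp C)" "tgt (opp C) x = src (opp C) f"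
      "cmp (opp C) f x = zer (opp C) (src (opp C) x) (tgt (opp C) f)"
    then have [simp]: "x \<in> Arr C" "src C x = src C q" and xf: "x \<cdot> f = zer C (src C f) (tgt C x)" by simp_all
    have "(x \<cdot> k) \<cdot> d = zer C (src C d) (tgt C x)" using xf d(4) by simp
    then have "x \<cdot> k = zer C (src C k) (tgt C x)" by - (rule epi_zer[OF d(1)], simp_all)
    then obtain u where "u \<in> Arr C" "src C u = tgt C q" "tgt C u = tgt C x" "u \<cdot> q = x"
      using cokernel_desc[OF c, of x] by auto
    then show "\<exists>u\<in>Arr (opp C). src (opp C) u = src (opp C) x \<and> tgt (opp C) u = src (opp C) q \<and> cmp (opp C) q u = x"
      by auto
  qed (use e in simp_all)
  then show ?thesis by simp
qed

text \<open>The definition compares the image of \<open>f\<close> with the kernel of \<open>g\<close>. Its dual compares the coimage of \<open>g\<close>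
  with the cokernel of \<open>f\<close>, and an epimorphism is the cokernel of its kernel.\<close>

lemma exact_at_oppI:
  assumes x: "exact_at C f g"
  shows "exact_at (opp C) g f"
proof -
  note [simp] = exact_atD[OF x]
  obtain q k where k: "is_cokernel C q f" "is_kernel C k q" "is_kernel C k g"
    using x by (auto simp: exact_at_def is_image_def)
  have "is_cokernel C q k" using epi_cokernel_of_kernel[OF cokernel_epi[OF k(1)] k(2)] .
  then show ?thesis using k by (auto simp: exact_at_def is_image_def)
qed

lemma exact_at_opp [simp]: "exact_at (opp C) g f = exact_at C f g"
  using exact_at_oppI[of f g] abelian_category.exact_at_oppI[OF abelian_opp, of g f] by auto

lemma short_exact_exact: "short_exact C f g \<Longrightarrow> exact_at C f g"
  by (simp add: short_exactD cokernel_exact)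

text \<open>This is how exact sequences are spliced: neither the image of the first arrow nor the kernel of the
  second one changes.\<close>

lemma exact_at_extend:
  assumes x: "exact_at C f g" and e: "is_epi C e" "tgt C e = src C f" and m: "is_mono C m" "src C m = tgt C g"
  shows "exact_at C (f \<cdot> e) (m \<cdot> g)"
proof -
  note [simp] = exact_atD[OF x] is_epi_Arr[OF e(1)] e(2) is_mono_Arr[OF m(1)] m(2)
  show ?thesis
  proof (rule exact_atI)
    show "(m \<cdot> g) \<cdot> (f \<cdot> e) = zer C (src C (f \<cdot> e)) (tgt C (m \<cdot> g))"
      by (simp add: reassoc[OF exact_atD(4)[OF x]])
    fix y assume [simp]: "y \<in> Arr C" "tgt C y = src C (m \<cdot> g)"
      and "(m \<cdot> g) \<cdot> y = zer C (src C y) (tgt C (m \<cdot> g))"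
    then have "m \<cdot> (g \<cdot> y) = zer C (src C y) (tgt C m)" by simp
    then have "g \<cdot> y = zer C (src C y) (tgt C g)" by - (rule mono_zer[OF m(1)], simp_all)
    then have "covers C f y" by (intro exact_at_covers[OF x]) simp_all
    then obtain d a where d: "is_epi C d" and [simp]: "d \<in> Arr C" "tgt C d = src C y" "a \<in> Arr C"
      "src C a = src C d" "tgt C a = src C f" and a: "f \<cdot> a = y \<cdot> d" by (rule coversE)
    have "covers C e a" by (rule epi_covers) (simp_all add: e)
    then obtain d' b where d': "is_epi C d'" and [simp]: "d' \<in> Arr C" "tgt C d' = src C a" "b \<in> Arr C"
      "src C b = src C d'" "tgt C b = src C e" and b: "e \<cdot> b = a \<cdot> d'" by (rule coversE)
    show "covers C (f \<cdot> e) y"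
      by (rule coversI[of "d \<cdot> d'" _ b]) (simp_all add: b reassoc[OF a] epi_cmp d d')
  qed simp_all
qed

lemma exact_at_kernel:
  assumes x: "exact_at C f g" and k: "is_kernel C k g"
  obtains e where "is_epi C e" "e \<in> Arr C" "src C e = src C f" "tgt C e = src C k" "k \<cdot> e = f"
proof -
  note [simp] = exact_atD[OF x] kernelD(1,3)[OF k]
  obtain e where [simp]: "e \<in> Arr C" "src C e = src C f" "tgt C e = src C k" and ke: "k \<cdot> e = f"
    using kernel_lift[OF k, of f] by auto
  have "covers C f k" by (rule exact_at_covers[OF x]) (simp_all add: kernelD(4)[OF k])
  then obtain d a where d: "is_epi C d" and [simp]: "d \<in> Arr C" "tgt C d = src C k" "a \<in> Arr C"
    "src C a = src C d" "tgt C a = src C f" and a: "f \<cdot> a = k \<cdot> d" by (rule coversE)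
  have "e \<cdot> a = d"
    by (rule mono_cancel[OF kernel_mono[OF k]]) (simp_all add: reassoc[OF ke] a)
  then have "is_epi C e" using epi_cmpD[of e a] d by simp
  then show ?thesis using ke by (intro that[of e]) simp_all
qed

lemma epi_iff_exact:
  assumes Z: "zero_object C Z" and f: "f \<in> Arr C"
  shows "exact_at C f (zer C (tgt C f) Z) \<longleftrightarrow> is_epi C f"
proof
  have [simp]: "Z \<in> Obj C" using Z by (simp add: zero_object_def)
  note [simp] = f
  {
    assume "exact_at C f (zer C (tgt C f) Z)"
    then have "covers C f (idn C (tgt C f))" by (rule exact_at_covers) simp_all
    then show "is_epi C f" by (rule covers_epi[OF f])
  next
    assume "is_epi C f"
    then show "exact_at C f (zer C (tgt C f) Z)" by (intro exact_atI epi_covers) simp_all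
  }
qed

lemma exact_at_mono_cancel:
  assumes x: "exact_at C f g" and m: "is_mono C m" and e: "e \<in> Arr C" "src C m = tgt C e" "m \<cdot> e = g"
  shows "exact_at C f e"
proof (rule exact_atI)
  note [simp] = exact_atD(1)[OF x] e(1,2) is_mono_Arr[OF m]
  have "src C (m \<cdot> e) = tgt C f" "tgt C (m \<cdot> e) = tgt C g" using exact_atD(3)[OF x] unfolding e(3) by simp_all
  then have [simp]: "src C e = tgt C f" "tgt C g = tgt C m" by simp_all
  show "f \<in> Arr C" "e \<in> Arr C" "tgt C f = src C e" by simp_all
  have "m \<cdot> (e \<cdot> f) = zer C (src C f) (tgt C m)" using exact_atD(4)[OF x] by (simp add: reassoc[OF e(3)])
  then show "e \<cdot> f = zer C (src C f) (tgt C e)" by - (rule mono_zer[OF m], simp_all)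
  fix y assume [simp]: "y \<in> Arr C" "tgt C y = src C e" and y: "e \<cdot> y = zer C (src C y) (tgt C e)"
  have "g \<cdot> y = m \<cdot> (e \<cdot> y)" by (subst reassoc[OF e(3)]) simp_all
  then show "covers C f y" using y by (intro exact_at_covers[OF x]) (simp_all flip: exact_atD(3)[OF x])
qed

text \<open>In an exact sequence, the kernel of \<open>h\<close> is also the cokernel of \<open>f\<close>; \<open>e\<close> is the projection onto it.\<close>

lemma exact_at_factor:
  assumes x: "exact_at C f g" and y: "exact_at C g h" and k: "is_kernel C k h"
  obtains e where "is_epi C e" "e \<in> Arr C" "src C e = src C g" "tgt C e = src C k" "k \<cdot> e = g" "exact_at C f e"
proof -
  obtain e where e: "is_epi C e" "e \<in> Arr C" "src C e = src C g" "tgt C e = src C k" "k \<cdot> e = g"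
    using exact_at_kernel[OF y k] by blast
  then have "exact_at C f e" by (intro exact_at_mono_cancel[OF x kernel_mono[OF k]]) simp_all
  then show ?thesis using e by (intro that[of e])
qed

lemma kernel_mono_cmp:
  assumes k: "is_kernel C k f" and m: "is_mono C m" "src C m = tgt C f"
  shows "is_kernel C k (m \<cdot> f)"
proof -
  note [simp] = kernelD(1-3)[OF k] is_mono_Arr[OF m(1)] m(2)
  show ?thesis
  proof (rule is_kernelI)
    show "(m \<cdot> f) \<cdot> k = zer C (src C k) (tgt C (m \<cdot> f))" by (simp add: kernelD(4)[OF k])
    fix x assume [simp]: "x \<in> Arr C" "tgt C x = src C (m \<cdot> f)" and "(m \<cdot> f) \<cdot> x = zer C (src C x) (tgt C (m \<cdot> f))"
    then have "m \<cdot> (f \<cdot> x) = zer C (src C x) (tgt C m)" by simp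
    then have "f \<cdot> x = zer C (src C x) (tgt C f)" by - (rule mono_zer[OF m(1)], simp_all)
    then obtain u where "u \<in> Arr C" "src C u = src C x" "tgt C u = src C k" "k \<cdot> u = x"
      using kernel_lift[OF k, of x] by auto
    then show "\<exists>u\<in>Arr C. src C u = src C x \<and> tgt C u = src C k \<and> k \<cdot> u = x" by blast
  qed (simp_all add: kernel_mono[OF k])
qed

lemma short_exact_iso:
  assumes fg: "short_exact C f g" and h: "is_iso C h" "tgt C h = src C f"
  shows "short_exact C (f \<cdot> h) g"
proof -
  note [simp] = short_exactD(1-3)[OF fg] h(2)
  obtain h' where [simp]: "h \<in> Arr C" "h' \<in> Arr C" "src C h' = tgt C h" "tgt C h' = src C h"
    and h': "h' \<cdot> h = idn C (src C h)" "h \<cdot> h' = idn C (tgt C h)" using h(1) by (rule is_isoE)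
  have "is_kernel C (f \<cdot> h) g"
  proof (rule is_kernelI)
    show "is_mono C (f \<cdot> h)" by (rule mono_cmp) (simp_all add: iso_mono[OF h(1)] short_exactD(5)[OF fg])
    show "g \<cdot> (f \<cdot> h) = zer C (src C (f \<cdot> h)) (tgt C g)" by (simp add: reassoc[OF short_exactD(4)[OF fg]])
    fix x assume [simp]: "x \<in> Arr C" "tgt C x = src C g" and "g \<cdot> x = zer C (src C x) (tgt C g)"
    then obtain u where [simp]: "u \<in> Arr C" "src C u = src C x" "tgt C u = src C f" and u: "f \<cdot> u = x"
      using kernel_lift[OF short_exactD(7)[OF fg], of x] by auto
    show "\<exists>u\<in>Arr C. src C u = src C x \<and> tgt C u = src C (f \<cdot> h) \<and> (f \<cdot> h) \<cdot> u = x"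
      by (intro bexI[of _ "h' \<cdot> u"]) (simp_all add: reassoc[OF h'(2)] u)
  qed simp_all
  then show ?thesis using short_exactD(6)[OF fg] by (rule short_exact_epiI)
qed

text \<open>The homology is the cokernel of the induced arrow \<open>u\<close> into the kernel, which is zero iff \<open>u\<close> is epi;
  by the lifting criterion this is exactness.\<close>

lemma homology_zero_iff:
  assumes "is_homology C H f g"
  shows "zero_object C H \<longleftrightarrow> exact_at C f g"
proof -
  obtain k u q where k: "is_kernel C k g" and u: "u \<in> Hom C (src C f) (src C k)" "k \<cdot> u = f"
    and q: "is_cokernel C q u" and H: "tgt C q = H"
    using assms unfolding is_homology_def by blast
  have [simp]: "u \<in> Arr C" "src C u = src C f" "tgt C u = src C k" using u by (auto simp: Hom_iff)
  note [simp] = kernelD(1-3)[OF k] cokernelD(1)[OF q]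
  have [simp]: "src C q = src C k" "tgt C q = H" using cokernelD[OF q] H by simp_all
  then have [simp]: "H \<in> Obj C" using Arr_Obj(2)[OF cokernelD(1)[OF q]] by simp
  have "k \<cdot> u \<in> Arr C" "tgt C (k \<cdot> u) = src C g" by simp_all
  then have [simp]: "f \<in> Arr C" "tgt C f = src C g" unfolding u(2) .
  have qu: "q \<cdot> u = zer C (src C f) H" using cokernelD(4)[OF q] by simp
  have "zero_object C H \<longleftrightarrow> is_epi C u"
  proof
    assume "zero_object C H"
    then have 0: "idn C H = zer C H H" using zero_object_iff by simp
    have "q = idn C H \<cdot> q" by simp
    also have "\<dots> = zer C (src C k) H" unfolding 0 by simp
    finally have q0: "q = zer C (src C k) H" .
    show "is_epi C u"
    proof (rule is_epiI)
      fix h assume [simp]: "h \<in> Arr C" "src C h = tgt C u" and "h \<cdot> u = zer C (src C u) (tgt C h)"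
      then obtain v where "v \<in> Arr C" "src C v = H" "tgt C v = tgt C h" "v \<cdot> q = h"
        using cokernel_desc[OF q, of h] by auto
      then show "h = zer C (tgt C u) (tgt C h)" unfolding q0 by simp
    qed simp
  next
    assume e: "is_epi C u"
    have "q = zer C (src C k) H" by (rule epi_zer[OF e]) (simp_all add: qu)
    then have "idn C H \<cdot> q = zer C (src C q) H" by simp
    then have "idn C H = zer C H H" by - (rule epi_zer[OF cokernel_epi[OF q]], simp_all)
    then show "zero_object C H" using zero_object_iff by simp
  qed
  also have "\<dots> \<longleftrightarrow> exact_at C f g"
  proof
    assume e: "is_epi C u"
    have gf: "g \<cdot> f = zer C (src C f) (tgt C g)"
      using reassoc[OF kernelD(4)[OF k], of u] u(2) by simp
    show "exact_at C f g"
    proof (rule exact_atI)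
      fix y assume [simp]: "y \<in> Arr C" "tgt C y = src C g" and "g \<cdot> y = zer C (src C y) (tgt C g)"
      then obtain t where [simp]: "t \<in> Arr C" "src C t = src C y" "tgt C t = src C k" and t: "k \<cdot> t = y"
        using kernel_lift[OF k, of y] by auto
      have "covers C u t" by (rule epi_covers) (simp_all add: e)
      then obtain d x where d: "is_epi C d" and [simp]: "d \<in> Arr C" "tgt C d = src C t" "x \<in> Arr C" "src C x = src C d"
        "tgt C x = src C u" and x: "u \<cdot> x = t \<cdot> d" by (rule coversE)
      have "f \<cdot> x = k \<cdot> (u \<cdot> x)" by (subst reassoc[OF u(2)]) simp_all
      also have "\<dots> = y \<cdot> d" unfolding x by (subst reassoc[OF t]) simp_all
      finally show "covers C f y" using d by (intro coversI[of d _ x]) simp_all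
    qed (simp_all add: gf)
  next
    assume "exact_at C f g"
    then obtain e where e: "is_epi C e" "e \<in> Arr C" "src C e = src C f" "tgt C e = src C k" "k \<cdot> e = f"
      using exact_at_kernel[OF _ k] by blast
    have "e = u" by (rule mono_cancel[OF kernel_mono[OF k]]) (simp_all add: e u)
    then show "is_epi C u" using e by simp
  qed
  finally show ?thesis .
qed

lemma homology_exists:
  assumes [simp]: "f \<in> Arr C" "g \<in> Arr C" "tgt C f = src C g" and gf: "g \<cdot> f = zer C (src C f) (tgt C g)"
  obtains H where "is_homology C H f g"
proof -
  obtain k where k: "is_kernel C k g" using has_kernels[of g] by auto
  obtain u where u: "u \<in> Arr C" "src C u = src C f" "tgt C u = src C k" "k \<cdot> u = f"
    using kernel_lift[OF k, of f] gf by auto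
  obtain q where q: "is_cokernel C q u" using has_cokernels[of u] u by auto
  show ?thesis using that k u q unfolding is_homology_def Hom_iff by blast
qed

text \<open>Parallel arrows of a fibre product have the same kernel. Besides joint monicity, the
  universal property is assumed for the pair \<open>(k, 0)\<close> alone; in this form the lemma applies to either
  projection.\<close>

lemma kernel_of_pullback:
  assumes k: "is_kernel C k f" and [simp]: "p \<in> Arr C" "e \<in> Arr C" "y \<in> Arr C" "src C p = src C e"
    "tgt C p = src C f" "tgt C e = src C y" "tgt C y = tgt C f" and eq: "f \<cdot> p = y \<cdot> e"
    and ex: "\<exists>u \<in> Arr C. src C u = src C k \<and> tgt C u = src C e \<and> p \<cdot> u = k \<and> e \<cdot> u = zer C (src C k) (src C y)"
    and jm: "\<And>u v. \<lbrakk>u \<in> Arr C; v \<in> Arr C; src C u = src C v; tgt C u = src C e; tgt C v = src C e;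
      p \<cdot> u = p \<cdot> v; e \<cdot> u = e \<cdot> v\<rbrakk> \<Longrightarrow> u = v"
  obtains k' where "is_kernel C k' e" "p \<cdot> k' = k" "src C k' = src C k"
proof -
  note [simp] = kernelD(1-3)[OF k]
  obtain k' where [simp]: "k' \<in> Arr C" "src C k' = src C k" "tgt C k' = src C e" and pk: "p \<cdot> k' = k"
    and ek: "e \<cdot> k' = zer C (src C k) (src C y)" using ex by blast
  have "is_kernel C k' e"
  proof (rule is_kernelI)
    show "is_mono C k'" using mono_cmpD[of p k'] kernel_mono[OF k] pk by simp
    fix x assume [simp]: "x \<in> Arr C" "tgt C x = src C e" and ex: "e \<cdot> x = zer C (src C x) (tgt C e)"
    have "f \<cdot> (p \<cdot> x) = zer C (src C x) (tgt C f)" by (simp add: reassoc[OF eq] ex)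
    then obtain t where [simp]: "t \<in> Arr C" "src C t = src C x" "tgt C t = src C k" and t: "k \<cdot> t = p \<cdot> x"
      using kernel_lift[OF k, of "p \<cdot> x"] by auto
    have "k' \<cdot> t = x" by (rule jm) (simp_all add: reassoc[OF pk] reassoc[OF ek] t ex)
    then show "\<exists>u\<in>Arr C. src C u = src C x \<and> tgt C u = src C k' \<and> k' \<cdot> u = x"
      by (intro bexI[of _ t]) simp_all
  qed (simp_all add: ek)
  then show ?thesis using that pk by simp
qed

lemma fibre_square:
  assumes f: "short_exact C k f" and y: "short_exact C l y" and [simp]: "tgt C f = tgt C y"
  obtains p e k' l' where "short_exact C k' e" "short_exact C l' p" "p \<cdot> k' = k" "e \<cdot> l' = l" "f \<cdot> p = y \<cdot> e"
    "src C k' = src C k" "src C l' = src C l" "tgt C p = src C f" "tgt C e = src C y" "src C p = src C e"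
proof -
  note [simp] = short_exactD(1,2)[OF f] short_exactD(1,2)[OF y]
  show ?thesis
  proof (rule pullback[of f y])
  fix p e assume [simp]: "p \<in> Arr C" "e \<in> Arr C" "src C p = src C e" "tgt C p = src C f" "tgt C e = src C y"
    and eq: "f \<cdot> p = y \<cdot> e"
    and univ: "\<And>a b. \<lbrakk>a \<in> Arr C; b \<in> Arr C; src C a = src C b; tgt C a = src C f; tgt C b = src C y; f \<cdot> a = y \<cdot> b\<rbrakk>
      \<Longrightarrow> \<exists>u \<in> Arr C. src C u = src C b \<and> tgt C u = src C e \<and> p \<cdot> u = a \<and> e \<cdot> u = b"
    and jm: "\<And>u v. \<lbrakk>u \<in> Arr C; v \<in> Arr C; src C u = src C v; tgt C u = src C e; tgt C v = src C e;
      p \<cdot> u = p \<cdot> v; e \<cdot> u = e \<cdot> v\<rbrakk> \<Longrightarrow> u = v"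
    and epi': "is_epi C f \<Longrightarrow> is_epi C e" "is_epi C y \<Longrightarrow> is_epi C p"
  note epi = epi'(1)[OF short_exactD(6)[OF f]] epi'(2)[OF short_exactD(6)[OF y]]
  have "\<exists>u \<in> Arr C. src C u = src C k \<and> tgt C u = src C e \<and> p \<cdot> u = k \<and> e \<cdot> u = zer C (src C k) (src C y)"
    using univ[of k "zer C (src C k) (src C y)"] short_exactD(3,4)[OF f] by simp
  then obtain k' where k': "is_kernel C k' e" "p \<cdot> k' = k" "src C k' = src C k"
    using kernel_of_pullback[OF short_exactD(7)[OF f], of p e y] eq jm by auto
  have "\<exists>u \<in> Arr C. src C u = src C l \<and> tgt C u = src C p \<and> e \<cdot> u = l \<and> p \<cdot> u = zer C (src C l) (src C f)"
    using univ[of "zer C (src C l) (src C f)" l] short_exactD(3,4)[OF y] by auto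
  then obtain l' where l': "is_kernel C l' p" "e \<cdot> l' = l" "src C l' = src C l"
    using kernel_of_pullback[OF short_exactD(7)[OF y], of e p f] eq jm by auto
  show ?thesis
    by (rule that[of k' e l' p]) (simp_all add: k' l' eq epi short_exact_epiI)
  qed simp_all
qed

text \<open>Part of the snake lemma. The rows are \<open>f', g'\<close> (exact) over \<open>f2, g2\<close> (a complex with \<open>f2\<close> mono), the
  vertical arrows between them are \<open>kX, kY, kZ\<close>, and \<open>f\<close> is induced on the targets of \<open>cX\<close> and \<open>cY\<close>. An
  element \<open>x\<close> killed by \<open>f\<close> lifts along \<open>cX\<close> to some \<open>t\<close>, and \<open>f2 t\<close> comes along \<open>kY\<close> from some \<open>w\<close>. As \<open>kZ\<close>
  is mono, \<open>g' w = 0\<close>, so \<open>w\<close> comes from the source of \<open>f'\<close>; hence \<open>t\<close> comes along \<open>kX\<close>, and \<open>x = 0\<close>.\<close>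

lemma snake_mono:
  assumes row: "exact_at C f' g'" and f2: "is_mono C f2" and kZ: "is_mono C kZ"
    and col: "exact_at C kY cY" and cX: "is_epi C cX" "kX \<in> Arr C" "tgt C kX = src C cX"
      "cX \<cdot> kX = zer C (src C kX) (tgt C cX)"
    and [simp]: "f \<in> Arr C" "g2 \<in> Arr C" "src C g2 = tgt C f2" "tgt C g2 = tgt C kZ"
    and [simp]: "src C f' = src C kX" "tgt C f' = src C kY" "tgt C g' = src C kZ" "src C f2 = tgt C kX"
      "tgt C f2 = tgt C kY" "src C f = tgt C cX" "tgt C f = tgt C cY"
    and 1: "kY \<cdot> f' = f2 \<cdot> kX" and 2: "kZ \<cdot> g' = g2 \<cdot> kY" and 3: "cY \<cdot> f2 = f \<cdot> cX"
    and 0: "g2 \<cdot> f2 = zer C (src C f2) (tgt C g2)"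
  shows "is_mono C f"
proof (rule is_monoI)
  note [simp] = exact_atD(1,2)[OF row] exact_atD(1,2)[OF col] is_mono_Arr[OF f2] is_mono_Arr[OF kZ]
    is_epi_Arr[OF cX(1)] cX(2,3)
  have [simp]: "src C g' = src C kY" "src C cY = tgt C kY"
    using exact_atD(3)[OF row] exact_atD(3)[OF col] by simp_all
  fix x assume [simp]: "x \<in> Arr C" "tgt C x = src C f" and fx: "f \<cdot> x = zer C (src C x) (tgt C f)"
  have "covers C cX x" by (rule epi_covers) (simp_all add: cX)
  then obtain e t where e: "is_epi C e" and [simp]: "e \<in> Arr C" "tgt C e = src C x" "t \<in> Arr C"
    "src C t = src C e" "tgt C t = src C cX" and t: "cX \<cdot> t = x \<cdot> e" by (rule coversE)
  have "cY \<cdot> (f2 \<cdot> t) = zer C (src C e) (tgt C cY)"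
    by (simp add: reassoc[OF 3] t reassoc[OF fx])
  then have "covers C kY (f2 \<cdot> t)" by (intro exact_at_covers[OF col]) simp_all
  then obtain d w where d: "is_epi C d" and [simp]: "d \<in> Arr C" "tgt C d = src C (f2 \<cdot> t)" "w \<in> Arr C"
    "src C w = src C d" "tgt C w = src C kY" and w: "kY \<cdot> w = (f2 \<cdot> t) \<cdot> d" by (rule coversE)
  have "kZ \<cdot> (g' \<cdot> w) = zer C (src C d) (tgt C kZ)"
    by (simp add: reassoc[OF 2] w reassoc[OF 0])
  then have "g' \<cdot> w = zer C (src C w) (tgt C g')" by - (rule mono_zer[OF kZ], simp_all)
  then have "covers C f' w" by (intro exact_at_covers[OF row]) simp_all
  then obtain b v where b: "is_epi C b" and [simp]: "b \<in> Arr C" "tgt C b = src C w" "v \<in> Arr C"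
    "src C v = src C b" "tgt C v = src C f'" and v: "f' \<cdot> v = w \<cdot> b" by (rule coversE)
  have "f2 \<cdot> (kX \<cdot> v) = f2 \<cdot> (t \<cdot> (d \<cdot> b))"
    using reassoc[OF w, of b] by (simp add: v square[OF 1[symmetric]])
  then have kv: "kX \<cdot> v = t \<cdot> (d \<cdot> b)" by - (rule mono_cancel[OF f2], simp_all)
  have "x \<cdot> (e \<cdot> (d \<cdot> b)) = cX \<cdot> (kX \<cdot> v)" unfolding kv by (simp add: reassoc[OF t])
  also have "\<dots> = zer C (src C (e \<cdot> (d \<cdot> b))) (tgt C x)" by (simp add: reassoc[OF cX(4)])
  finally show "x = zer C (src C x) (src C f)"
    by - (rule epi_zer[of "e \<cdot> (d \<cdot> b)"], simp_all add: epi_cmp e d b)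
qed simp

text \<open>An extension of two monomorphisms is a monomorphism, in a diagram whose upper row is exact only in
  the middle.\<close>

lemma mono_middle:
  assumes row: "exact_at C f' g'" and f2: "is_mono C f2" and kZ: "is_mono C kZ" and kX: "is_mono C kX"
    and [simp]: "kY \<in> Arr C" "g2 \<in> Arr C" "src C g2 = tgt C kY" "tgt C g2 = tgt C kZ"
      "src C f' = src C kX" "tgt C f' = src C kY" "tgt C g' = src C kZ" "src C f2 = tgt C kX" "tgt C f2 = tgt C kY"
    and 1: "kY \<cdot> f' = f2 \<cdot> kX" and 2: "kZ \<cdot> g' = g2 \<cdot> kY"
  shows "is_mono C kY"
proof (rule is_monoI)
  note [simp] = exact_atD(1,2)[OF row] is_mono_Arr[OF f2] is_mono_Arr[OF kZ] is_mono_Arr[OF kX]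
  have [simp]: "src C g' = src C kY" using exact_atD(3)[OF row] by simp
  fix w assume [simp]: "w \<in> Arr C" "tgt C w = src C kY" and w: "kY \<cdot> w = zer C (src C w) (tgt C kY)"
  have "kZ \<cdot> (g' \<cdot> w) = zer C (src C w) (tgt C kZ)" by (simp add: reassoc[OF 2] w)
  then have "g' \<cdot> w = zer C (src C w) (tgt C g')" by - (rule mono_zer[OF kZ], simp_all)
  then have "covers C f' w" by (intro exact_at_covers[OF row]) simp_all
  then obtain b v where b: "is_epi C b" and [simp]: "b \<in> Arr C" "tgt C b = src C w" "v \<in> Arr C"
    "src C v = src C b" "tgt C v = src C f'" and v: "f' \<cdot> v = w \<cdot> b" by (rule coversE)
  have "f2 \<cdot> (kX \<cdot> v) = zer C (src C v) (tgt C f2)"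
    by (simp add: v reassoc[OF w] square[OF 1[symmetric]])
  then have "kX \<cdot> v = zer C (src C v) (tgt C kX)" by - (rule mono_zer[OF f2], simp_all)
  then have "v = zer C (src C v) (src C kX)" by - (rule mono_zer[OF kX], simp_all)
  then have "f' \<cdot> v = f' \<cdot> zer C (src C v) (src C kX)" by (rule arg_cong)
  then have "w \<cdot> b = zer C (src C b) (src C kY)" unfolding v by simp
  then show "w = zer C (src C w) (src C kY)" by - (rule epi_zer[OF b], simp_all)
qed simp

text \<open>Two arrows \<open>i\<close> and \<open>i'\<close> into the same object, each followed by the projection \<open>g'\<close> or \<open>g\<close> that is meant to
  kill the other one: injectivity passes from \<open>g' i\<close> to \<open>g i'\<close>, because what \<open>g\<close> kills in the source
  of \<open>i'\<close> comes from the source of \<open>i\<close> and is killed by \<open>g'\<close>.\<close>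

lemma mono_exchange:
  assumes row: "exact_at C i g" and i': "is_mono C i'" and k: "is_mono C k"
    and [simp]: "g' \<in> Arr C" "src C g' = tgt C i'" "src C g = tgt C i'" "src C k = src C i" "tgt C k = tgt C g'"
    and 1: "g' \<cdot> i = k" and 2: "g' \<cdot> i' = zer C (src C i') (tgt C g')"
  shows "is_mono C (g \<cdot> i')"
proof (rule is_monoI)
  note [simp] = exact_atD(1,2)[OF row] is_mono_Arr[OF i'] is_mono_Arr[OF k]
  have [simp]: "tgt C i = tgt C i'" using exact_atD(3)[OF row] by simp
  show "g \<cdot> i' \<in> Arr C" by simp
  fix x assume [simp]: "x \<in> Arr C" and tx: "tgt C x = src C (g \<cdot> i')"
    and x: "(g \<cdot> i') \<cdot> x = zer C (src C x) (tgt C (g \<cdot> i'))"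
  have [simp]: "tgt C x = src C i'" using tx by simp
  have "covers C i (i' \<cdot> x)" using x by (intro exact_at_covers[OF row]) simp_all
  then obtain e y where e: "is_epi C e" and [simp]: "e \<in> Arr C" "tgt C e = src C (i' \<cdot> x)" "y \<in> Arr C"
    "src C y = src C e" "tgt C y = src C i" and y: "i \<cdot> y = (i' \<cdot> x) \<cdot> e" by (rule coversE)
  have "k \<cdot> y = g' \<cdot> (i \<cdot> y)" by (subst reassoc[OF 1]) simp_all
  also have "\<dots> = zer C (src C y) (tgt C k)" unfolding y by (simp add: reassoc[OF 2])
  finally have "y = zer C (src C y) (src C k)" by - (rule mono_zer[OF k], simp_all)
  then have "i \<cdot> y = i \<cdot> zer C (src C y) (src C k)" by (rule arg_cong)
  then have "i' \<cdot> (x \<cdot> e) = zer C (src C e) (tgt C i')" unfolding y by simp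
  then have "x \<cdot> e = zer C (src C e) (src C i')" by - (rule mono_zer[OF i'], simp_all)
  then show "x = zer C (src C x) (src C (g \<cdot> i'))" by - (rule epi_zer[OF e], simp_all)
qed

lemma nine_lemma:
  assumes r1: "short_exact C f g" and r2: "short_exact C f2 g2"
    and X: "short_exact C kX a" and Y: "short_exact C kY b" and Z: "short_exact C kZ c"
    and [simp]: "src C f2 = src C a" "tgt C f2 = src C b" "tgt C g2 = src C c"
      "src C f = tgt C a" "tgt C f = tgt C b" "tgt C g = tgt C c"
    and 1: "b \<cdot> f2 = f \<cdot> a" and 2: "c \<cdot> g2 = g \<cdot> b"
  obtains f' g' where "short_exact C f' g'" "src C f' = src C kX" "tgt C f' = src C kY" "tgt C g' = src C kZ"
    "kY \<cdot> f' = f2 \<cdot> kX" "kZ \<cdot> g' = g2 \<cdot> kY"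
proof -
  note [simp] = short_exactD(1,2)[OF r1] short_exactD(1,2)[OF r2] short_exactD(1-3)[OF X]
    short_exactD(1-3)[OF Y] short_exactD(1-3)[OF Z]
  have [simp]: "src C g2 = src C b" "src C g = tgt C b"
    using short_exactD(3)[OF r1] short_exactD(3)[OF r2] by simp_all
  note X0 = short_exactD(4)[OF X] and Y0 = short_exactD(4)[OF Y] and Z0 = short_exactD(4)[OF Z]
  note R1 = short_exactD(4)[OF r1] and R2 = short_exactD(4)[OF r2]
  have "b \<cdot> (f2 \<cdot> kX) = zer C (src C kX) (tgt C b)" by (simp add: reassoc[OF 1] X0)
  then obtain f' where [simp]: "f' \<in> Arr C" "src C f' = src C kX" "tgt C f' = src C kY" and f': "kY \<cdot> f' = f2 \<cdot> kX"
    using kernel_lift[OF short_exactD(7)[OF Y], of "f2 \<cdot> kX"] by auto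
  have "c \<cdot> (g2 \<cdot> kY) = zer C (src C kY) (tgt C c)" by (simp add: reassoc[OF 2] Y0)
  then obtain g' where [simp]: "g' \<in> Arr C" "src C g' = src C kY" "tgt C g' = src C kZ" and g': "kZ \<cdot> g' = g2 \<cdot> kY"
    using kernel_lift[OF short_exactD(7)[OF Z], of "g2 \<cdot> kY"] by auto
  have "is_kernel C f' g'"
  proof (rule is_kernelI)
    have "is_mono C (kY \<cdot> f')" unfolding f' by (rule mono_cmp) (simp_all add: short_exactD(5)[OF r2] short_exactD(5)[OF X])
    then show "is_mono C f'" by (rule mono_cmpD) simp_all
    have "kZ \<cdot> (g' \<cdot> f') = zer C (src C f') (tgt C kZ)" by (simp add: reassoc[OF g'] f' reassoc[OF R2])
    then show "g' \<cdot> f' = zer C (src C f') (tgt C g')" by - (rule mono_zer[OF short_exactD(5)[OF Z]], simp_all)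
    fix w assume [simp]: "w \<in> Arr C" "tgt C w = src C g'" and w: "g' \<cdot> w = zer C (src C w) (tgt C g')"
    have "g2 \<cdot> (kY \<cdot> w) = zer C (src C w) (tgt C g2)" by (simp add: w square[OF g'[symmetric]])
    then obtain t where [simp]: "t \<in> Arr C" "src C t = src C w" "tgt C t = src C a" and t: "f2 \<cdot> t = kY \<cdot> w"
      using kernel_lift[OF short_exactD(7)[OF r2], of "kY \<cdot> w"] by auto
    have "f \<cdot> (a \<cdot> t) = zer C (src C t) (tgt C f)" by (simp add: t reassoc[OF Y0] square[OF 1[symmetric]])
    then have "a \<cdot> t = zer C (src C t) (tgt C a)" by - (rule mono_zer[OF short_exactD(5)[OF r1]], simp_all)
    then obtain v where [simp]: "v \<in> Arr C" "src C v = src C w" "tgt C v = src C kX" and v: "kX \<cdot> v = t"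
      using kernel_lift[OF short_exactD(7)[OF X], of t] by auto
    have "f' \<cdot> v = w"
      by (rule mono_cancel[OF short_exactD(5)[OF Y]]) (simp_all add: reassoc[OF f'] v t)
    then show "\<exists>u\<in>Arr C. src C u = src C w \<and> tgt C u = src C f' \<and> f' \<cdot> u = w"
      by (intro bexI[of _ v]) simp_all
  qed simp_all
  moreover have "is_epi C g'"
  proof (rule covers_epi)
    have "covers C g2 kZ" by (rule epi_covers) (simp_all add: short_exactD(6)[OF r2])
    then obtain e t where e: "is_epi C e" and [simp]: "e \<in> Arr C" "tgt C e = src C kZ" "t \<in> Arr C"
      "src C t = src C e" "tgt C t = src C g2" and t: "g2 \<cdot> t = kZ \<cdot> e" by (rule coversE)
    have "g \<cdot> (b \<cdot> t) = zer C (src C t) (tgt C g)" by (simp add: t reassoc[OF Z0] square[OF 2[symmetric]])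
    then obtain x where [simp]: "x \<in> Arr C" "src C x = src C t" "tgt C x = src C f" and x: "f \<cdot> x = b \<cdot> t"
      using kernel_lift[OF short_exactD(7)[OF r1], of "b \<cdot> t"] by auto
    have "covers C a x" by (rule epi_covers) (simp_all add: short_exactD(6)[OF X])
    then obtain d s where d: "is_epi C d" and [simp]: "d \<in> Arr C" "tgt C d = src C x" "s \<in> Arr C"
      "src C s = src C d" "tgt C s = src C a" and s: "a \<cdot> s = x \<cdot> d" by (rule coversE)
    (* t d and f2 s have the same image under b, so their difference r lifts to the kernel of b *)
    obtain r where [simp]: "r \<in> Arr C" "src C r = src C d" "tgt C r = src C b" and r: "t \<cdot> d = f2 \<cdot> s \<boxplus> r"
      using differenceE[of "t \<cdot> d" "f2 \<cdot> s"] by auto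
    have bts: "b \<cdot> (t \<cdot> d) = b \<cdot> (f2 \<cdot> s)" using reassoc[OF x, of d] by (simp add: reassoc[OF 1] s)
    have "b \<cdot> (f2 \<cdot> s) \<boxplus> b \<cdot> r = b \<cdot> (t \<cdot> d)" unfolding r by (subst cmp_add_Arr) simp_all
    then have "b \<cdot> r = zer C (src C d) (tgt C b)" unfolding bts by (rule add_cancel) simp_all
    then obtain w where [simp]: "w \<in> Arr C" "src C w = src C d" "tgt C w = src C kY" and w: "kY \<cdot> w = r"
      using kernel_lift[OF short_exactD(7)[OF Y], of r] by auto
    have "g2 \<cdot> (t \<cdot> d) = g2 \<cdot> r" unfolding r by (simp add: cmp_add_Arr reassoc[OF R2])
    then have "kZ \<cdot> (g' \<cdot> w) = kZ \<cdot> (e \<cdot> d)" by (simp add: reassoc[OF g'] w reassoc[OF t])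
    then have "g' \<cdot> w = e \<cdot> d" by - (rule mono_cancel[OF short_exactD(5)[OF Z]], simp_all)
    then show "covers C g' (idn C (tgt C g'))" by (intro coversI[of "e \<cdot> d" _ w]) (simp_all add: epi_cmp e d)
  qed simp
  ultimately show ?thesis using f' g' by (intro that[of f' g'] short_exact_epiI) simp_all
qed

end


section \<open>Additive functors and adjoint pairs\<close>

context additive_functor
begin

lemma amap_Arr [simp]:
  assumes "f \<in> Arr C"
  shows "amap F f \<in> Arr C" "src C (amap F f) = omap F (src C f)" "tgt C (amap F f) = omap F (tgt C f)"
  using amap_Hom[OF Arr_Hom[OF assms]] by (auto simp: Hom_iff)

lemma omap_Obj_simp [simp]: "A \<in> Obj C \<Longrightarrow> omap F A \<in> Obj C"
  by (rule omap_Obj)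

lemma amap_cmp_Arr [simp]:
  "f \<in> Arr C \<Longrightarrow> g \<in> Arr C \<Longrightarrow> src C g = tgt C f \<Longrightarrow> amap F (g \<cdot> f) = amap F g \<cdot> amap F f"
  using amap_cmp[of g "tgt C f" "tgt C g" f "src C f"] by (simp add: Hom_iff)

lemma amap_idn_simp [simp]: "A \<in> Obj C \<Longrightarrow> amap F (idn C A) = idn C (omap F A)"
  by (rule amap_idn)

lemma amap_zer [simp]:
  assumes "A \<in> Obj C" "B \<in> Obj C"
  shows "amap F (zer C A B) = zer C (omap F A) (omap F B)"
proof -
  have "amap F (zer C A B) \<boxplus> amap F (zer C A B) = amap F (zer C A B)"
    using amap_add[of "zer C A B" A B "zer C A B"] assms by (simp add: zer_Hom)
  then show ?thesis by (rule add_cancel) (use assms in simp_all)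
qed

lemma amap_eq:
  "\<lbrakk>g \<cdot> f = g' \<cdot> f'; f \<in> Arr C; g \<in> Arr C; f' \<in> Arr C; g' \<in> Arr C; src C g = tgt C f; src C g' = tgt C f'\<rbrakk>
    \<Longrightarrow> amap F g \<cdot> amap F f = amap F g' \<cdot> amap F f'"
  using amap_cmp_Arr[of f g] amap_cmp_Arr[of f' g'] by simp

lemma amap_zer_cmp:
  "\<lbrakk>g \<cdot> f = zer C A B; f \<in> Arr C; g \<in> Arr C; src C g = tgt C f; src C f = A; tgt C g = B\<rbrakk>
    \<Longrightarrow> amap F g \<cdot> amap F f = zer C (omap F A) (omap F B)"
  using amap_cmp_Arr[of f g] by auto

lemma amap_idn_cmp:
  "\<lbrakk>g \<cdot> f = idn C A; f \<in> Arr C; g \<in> Arr C; src C g = tgt C f; A \<in> Obj C\<rbrakk>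
    \<Longrightarrow> amap F g \<cdot> amap F f = idn C (omap F A)"
  using amap_cmp_Arr[of f g] by auto

lemma is_iso_amap: "is_iso C f \<Longrightarrow> is_iso C (amap F f)"
proof (erule is_isoE)
  fix g assume [simp]: "f \<in> Arr C" "g \<in> Arr C" "src C g = tgt C f" "tgt C g = src C f"
    and 1: "g \<cdot> f = idn C (src C f)" and 2: "f \<cdot> g = idn C (tgt C f)"
  show "is_iso C (amap F f)" unfolding is_iso_def
    by (intro conjI bexI[of _ "amap F g"]) (simp_all add: amap_idn_cmp[OF 1] amap_idn_cmp[OF 2] Hom_iff)
qed

lemma additive_functor_opp: "additive_functor (opp C) F"
  by (intro additive_functor.intro preadditive_opp additive_functor_axioms.intro)
    (auto simp: Hom_iff intro!: amap_add)

end

lemma comp_endofun_simps [simp]: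
  "omap (F \<odot> G) A = omap F (omap G A)" "amap (F \<odot> G) f = amap F (amap G f)"
  by (simp_all add: comp_endofun_def)

lemma additive_functor_comp:
  assumes "additive_functor C F" "additive_functor C G"
  shows "additive_functor C (F \<odot> G)"
proof -
  interpret F: additive_functor C F by fact
  interpret G: additive_functor C G by fact
  show ?thesis
    by (intro additive_functor.intro F.preadditive_category_axioms additive_functor_axioms.intro)
      (auto simp: F.Hom_iff G.amap_add F.amap_add)
qed

locale adjoint_pair = F: additive_functor C F + G: additive_functor C G
  for C :: "('o, 'm) cat" (structure) and F G :: "('o, 'm) endofun" +
  fixes \<eta> \<epsilon> :: "'o \<Rightarrow> 'm"
  assumes unit_Hom: "A \<in> Obj C \<Longrightarrow> \<eta> A \<in> Hom C A (omap G (omap F A))"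
    and counit_Hom: "A \<in> Obj C \<Longrightarrow> \<epsilon> A \<in> Hom C (omap F (omap G A)) A"
    and unit_natural: "f \<in> Arr C \<Longrightarrow> amap G (amap F f) \<cdot> \<eta> (src C f) = \<eta> (tgt C f) \<cdot> f"
    and counit_natural: "f \<in> Arr C \<Longrightarrow> \<epsilon> (tgt C f) \<cdot> amap F (amap G f) = f \<cdot> \<epsilon> (src C f)"
    and triangle_left: "A \<in> Obj C \<Longrightarrow> \<epsilon> (omap F A) \<cdot> amap F (\<eta> A) = idn C (omap F A)"
    and triangle_right: "A \<in> Obj C \<Longrightarrow> amap G (\<epsilon> A) \<cdot> \<eta> (omap G A) = idn C (omap G A)"

lemma adjunction_adjoint_pair: "adjunction C F G \<eta> \<epsilon> \<Longrightarrow> adjoint_pair C F G \<eta> \<epsilon>"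
proof -
  assume a: "adjunction C F G \<eta> \<epsilon>"
  then interpret F: additive_functor C F unfolding adjunction_def by blast
  have "\<forall>A\<in>Obj C. \<forall>B\<in>Obj C. \<forall>f\<in>Hom C A B. cmp C f (\<epsilon> A) = cmp C (\<epsilon> B) (amap F (amap G f))"
    using a by (simp add: adjunction_def natural_transformation_def comp_endofun_def id_endofun_def)
  then have "cmp C (\<epsilon> (tgt C f)) (amap F (amap G f)) = cmp C f (\<epsilon> (src C f))" if "f \<in> Arr C" for f
    using F.Arr_Hom[OF that] F.Arr_Obj[OF that] by metis
  then show ?thesis
    using a by (auto simp: adjunction_def adjoint_pair_def adjoint_pair_axioms_def natural_transformation_def
      comp_endofun_def id_endofun_def F.Hom_iff)
qed

context adjoint_pair
begin

lemma unit_Arr [simp]: "A \<in> Obj C \<Longrightarrow> \<eta> A \<in> Arr C" "A \<in> Obj C \<Longrightarrow> src C (\<eta> A) = A"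
  "A \<in> Obj C \<Longrightarrow> tgt C (\<eta> A) = omap G (omap F A)"
  using unit_Hom by (auto simp: F.Hom_iff)

lemma counit_Arr [simp]: "A \<in> Obj C \<Longrightarrow> \<epsilon> A \<in> Arr C" "A \<in> Obj C \<Longrightarrow> tgt C (\<epsilon> A) = A"
  "A \<in> Obj C \<Longrightarrow> src C (\<epsilon> A) = omap F (omap G A)"
  using counit_Hom by (auto simp: F.Hom_iff)

lemma adjoint_pair_opp: "adjoint_pair (opp C) G F \<epsilon> \<eta>"
  by (intro adjoint_pair.intro F.additive_functor_opp G.additive_functor_opp adjoint_pair_axioms.intro)
    (simp_all add: unit_Hom counit_Hom unit_natural counit_natural triangle_left triangle_right)

lemma right_adjoint_mono:
  assumes m: "is_mono C k"
  shows "is_mono C (amap G k)"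
proof (rule F.is_monoI)
  note [simp] = F.is_mono_Arr[OF m]
  fix x assume [simp]: "x \<in> Arr C" "tgt C x = src C (amap G k)" and x: "amap G k \<cdot> x = zer C (src C x) (tgt C (amap G k))"
  have [simp]: "tgt C x = omap G (src C k)" by simp
  define x' where "x' = \<epsilon> (src C k) \<cdot> amap F x"
  have [simp]: "x' \<in> Arr C" "src C x' = omap F (src C x)" "tgt C x' = src C k" by (simp_all add: x'_def)
  have "k \<cdot> x' = \<epsilon> (tgt C k) \<cdot> (amap F (amap G k) \<cdot> amap F x)"
    unfolding x'_def by (simp add: F.reassoc[OF counit_natural])
  also have "\<dots> = zer C (src C x') (tgt C k)" by (subst F.amap_zer_cmp[OF x]) simp_all
  finally have x'0: "x' = zer C (src C x') (src C k)" by - (rule F.mono_zer[OF m], simp_all)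
  have "x = amap G (\<epsilon> (src C k)) \<cdot> (\<eta> (omap G (src C k)) \<cdot> x)"
    by (simp add: F.reassoc[OF triangle_right])
  also have "\<dots> = amap G (\<epsilon> (src C k)) \<cdot> (amap G (amap F x) \<cdot> \<eta> (src C x))"
    using unit_natural[of x] by simp
  also have "\<dots> = amap G x' \<cdot> \<eta> (src C x)" by (simp add: x'_def)
  also have "\<dots> = zer C (src C x) (src C (amap G k))" by (subst x'0) simp
  finally show "x = zer C (src C x) (src C (amap G k))" .
qed (simp add: F.is_mono_Arr[OF m])

text \<open>Right adjoints are left exact: a test arrow is transposed, factored through \<open>k\<close>, and transposed
  back.\<close>

lemma right_adjoint_kernel:
  assumes k: "is_kernel C k f"
  shows "is_kernel C (amap G k) (amap G f)"
proof (rule F.is_kernelI)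
  note [simp] = F.kernelD(1-3)[OF k]
  show "is_mono C (amap G k)" by (rule right_adjoint_mono[OF F.kernel_mono[OF k]])
  show "amap G f \<cdot> amap G k = zer C (src C (amap G k)) (tgt C (amap G f))"
    by (simp add: G.amap_zer_cmp[OF F.kernelD(4)[OF k]])
  fix x assume [simp]: "x \<in> Arr C" "tgt C x = src C (amap G f)" and x: "amap G f \<cdot> x = zer C (src C x) (tgt C (amap G f))"
  define x' where "x' = \<epsilon> (src C f) \<cdot> amap F x"
  have [simp]: "x' \<in> Arr C" "src C x' = omap F (src C x)" "tgt C x' = src C f" by (simp_all add: x'_def)
  have "f \<cdot> x' = \<epsilon> (tgt C f) \<cdot> (amap F (amap G f) \<cdot> amap F x)"
    unfolding x'_def by (simp add: F.reassoc[OF counit_natural])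
  also have "\<dots> = zer C (src C x') (tgt C f)" by (subst F.amap_zer_cmp[OF x]) simp_all
  finally obtain t where [simp]: "t \<in> Arr C" "src C t = src C x'" "tgt C t = src C k" and t: "k \<cdot> t = x'"
    using F.kernel_lift[OF k, of x'] by auto
  have "x = amap G (\<epsilon> (src C f)) \<cdot> (\<eta> (omap G (src C f)) \<cdot> x)"
    by (simp add: F.reassoc[OF triangle_right])
  also have "\<dots> = amap G (\<epsilon> (src C f)) \<cdot> (amap G (amap F x) \<cdot> \<eta> (src C x))"
    using unit_natural[of x] by simp
  also have "\<dots> = amap G x' \<cdot> \<eta> (src C x)" by (simp add: x'_def)
  also have "\<dots> = amap G k \<cdot> (amap G t \<cdot> \<eta> (src C x))" unfolding t[symmetric] by simp
  finally show "\<exists>u\<in>Arr C. src C u = src C x \<and> tgt C u = src C (amap G k) \<and> amap G k \<cdot> u = x"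
    by (intro bexI[of _ "amap G t \<cdot> \<eta> (src C x)"]) simp_all
qed (use F.kernelD[OF k] in simp_all)

lemma left_adjoint_cokernel: "is_cokernel C q f \<Longrightarrow> is_cokernel C (amap F q) (amap F f)"
  using adjoint_pair.right_adjoint_kernel[OF adjoint_pair_opp, of q f] by simp

lemma left_adjoint_epi: "is_epi C q \<Longrightarrow> is_epi C (amap F q)"
  using adjoint_pair.right_adjoint_mono[OF adjoint_pair_opp, of q] by simp

end

section \<open>Derived functors relative to a canonical cover\<close>

text \<open>The situation of a right exact functor \<open>F\<close> and an exact functor \<open>T\<close> with a natural epimorphism
  \<open>c : T \<rightarrow> 1\<close> that splits on the values of \<open>T\<close>. The objects on which \<open>c\<close> splits play the role of the
  projectives. Exactness of \<open>F T\<close> replaces the lifting property that they lack: it makes them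
  adapted to \<open>F\<close>.\<close>

locale relative_acyclicity = abelian_category C + F: additive_functor C F + T: additive_functor C T
  for C :: "('o, 'm) cat" (structure) and F T :: "('o, 'm) endofun" +
  fixes c :: "'o \<Rightarrow> 'm"
  assumes F_cokernel: "is_cokernel C q f \<Longrightarrow> is_cokernel C (amap F q) (amap F f)"
    and T_short_exact: "short_exact C f g \<Longrightarrow> short_exact C (amap T f) (amap T g)"
    and FT_mono: "is_mono C f \<Longrightarrow> is_mono C (amap F (amap T f))"
    and c_Hom: "A \<in> Obj C \<Longrightarrow> c A \<in> Hom C (omap T A) A"
    and c_natural: "f \<in> Arr C \<Longrightarrow> c (tgt C f) \<cdot> amap T f = f \<cdot> c (src C f)"
    and c_epi: "A \<in> Obj C \<Longrightarrow> is_epi C (c A)"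
    and c_split: "A \<in> Obj C \<Longrightarrow> \<exists>s \<in> Hom C (omap T A) (omap T (omap T A)). c (omap T A) \<cdot> s = idn C (omap T A)"
begin

lemma c_Arr [simp]: "A \<in> Obj C \<Longrightarrow> c A \<in> Arr C" "A \<in> Obj C \<Longrightarrow> src C (c A) = omap T A"
  "A \<in> Obj C \<Longrightarrow> tgt C (c A) = A"
  using c_Hom by (auto simp: Hom_iff)

definition rel_proj :: "'o \<Rightarrow> bool"
  where "rel_proj A \<longleftrightarrow> A \<in> Obj C \<and> (\<exists>s \<in> Hom C A (omap T A). c A \<cdot> s = idn C A)"

lemma rel_proj_T: "A \<in> Obj C \<Longrightarrow> rel_proj (omap T A)"
  using c_split by (simp add: rel_proj_def)

lemma rel_proj_retract:
  assumes "retract A B" "rel_proj B"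
  shows "rel_proj A"
proof -
  obtain i p where [simp]: "i \<in> Arr C" "p \<in> Arr C" "src C i = A" "tgt C i = B" "src C p = B" "tgt C p = A"
    and pi: "p \<cdot> i = idn C A" and [simp]: "A \<in> Obj C" "B \<in> Obj C" using assms(1) by (rule retractE)
  obtain s where [simp]: "s \<in> Arr C" "src C s = B" "tgt C s = omap T B" and s: "c B \<cdot> s = idn C B"
    using assms(2) by (auto simp: rel_proj_def Hom_iff)
  have n: "c A \<cdot> amap T p = p \<cdot> c B" using c_natural[of p] by simp
  have "c A \<cdot> (amap T p \<cdot> (s \<cdot> i)) = idn C A"
    by (simp add: square[OF n] reassoc[OF s] pi)
  then show ?thesis unfolding rel_proj_def by (intro conjI bexI[of _ "amap T p \<cdot> (s \<cdot> i)"]) (simp_all add: Hom_iff)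
qed

definition syz_arr :: "'o \<Rightarrow> 'm"
  where "syz_arr A = (SOME k. is_kernel C k (c A))"

definition syz :: "'o \<Rightarrow> 'o"
  where "syz A = src C (syz_arr A)"

lemma syz_short_exact: "A \<in> Obj C \<Longrightarrow> short_exact C (syz_arr A) (c A)"
  unfolding syz_arr_def using someI_ex[OF has_kernels[of "c A"]] by (intro short_exact_epiI c_epi) simp_all

lemma syz_Arr [simp]: "A \<in> Obj C \<Longrightarrow> syz_arr A \<in> Arr C" "src C (syz_arr A) = syz A"
  "A \<in> Obj C \<Longrightarrow> tgt C (syz_arr A) = omap T A" "A \<in> Obj C \<Longrightarrow> syz A \<in> Obj C"
  using short_exactD[OF syz_short_exact, of A] Arr_Obj(1)[of "syz_arr A"] by (auto simp: syz_def)

lemma syz_split: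
  assumes "rel_proj Q"
  obtains r where "r \<in> Arr C" "src C r = omap T Q" "tgt C r = syz Q" "r \<cdot> syz_arr Q = idn C (syz Q)"
proof -
  obtain s where [simp]: "Q \<in> Obj C" "s \<in> Arr C" "src C s = Q" "tgt C s = omap T Q" "c Q \<cdot> s = idn C Q"
    using assms by (auto simp: rel_proj_def Hom_iff)
  show ?thesis
    by (rule split_epi_kernel[OF short_exactD(7)[OF syz_short_exact], of Q s]) (simp_all add: that)
qed

lemma rel_proj_Obj: "rel_proj Q \<Longrightarrow> Q \<in> Obj C"
  by (simp add: rel_proj_def)

lemma rel_proj_syz: "rel_proj Q \<Longrightarrow> rel_proj (syz Q)"
proof -
  assume Q: "rel_proj Q"
  note [simp] = rel_proj_Obj[OF Q]
  obtain r where r: "r \<in> Arr C" "src C r = omap T Q" "tgt C r = syz Q" "r \<cdot> syz_arr Q = idn C (syz Q)"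
    using Q by (rule syz_split)
  then have "retract (syz Q) (omap T Q)"
    unfolding retract_def by (intro bexI[of _ "syz_arr Q"] bexI[of _ r]) (simp_all add: Hom_iff)
  then show ?thesis by (rule rel_proj_retract) (simp add: rel_proj_T)
qed

lemma F_syz_mono: "rel_proj Q \<Longrightarrow> is_mono C (amap F (syz_arr Q))"
proof -
  assume Q: "rel_proj Q"
  note [simp] = rel_proj_Obj[OF Q]
  obtain r where [simp]: "r \<in> Arr C" "src C r = omap T Q" "tgt C r = syz Q" and r: "r \<cdot> syz_arr Q = idn C (syz Q)"
    using Q by (rule syz_split)
  show ?thesis by (rule split_mono[of _ "amap F r"]) (simp_all add: F.amap_idn_cmp[OF r])
qed

lemma F_epi: "is_epi C e \<Longrightarrow> is_epi C (amap F e)"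
proof -
  assume e: "is_epi C e"
  obtain k where "is_kernel C k e" using has_kernels[OF is_epi_Arr[OF e]] by blast
  then show ?thesis using cokernel_epi[OF F_cokernel[OF epi_cokernel_of_kernel[OF e]]] by blast
qed

lemma F_exact: "short_exact C f g \<Longrightarrow> exact_at C (amap F f) (amap F g)"
  by (intro cokernel_exact F_cokernel short_exactD(8))

text \<open>The nine lemma for the canonical covers: taking syzygies is exact.\<close>

lemma syz_functor:
  assumes fg: "short_exact C f g"
  obtains f' g' where "short_exact C f' g'" "src C f' = syz (src C f)" "tgt C f' = syz (tgt C f)"
    "tgt C g' = syz (tgt C g)" "syz_arr (tgt C f) \<cdot> f' = amap T f \<cdot> syz_arr (src C f)"
    "syz_arr (tgt C g) \<cdot> g' = amap T g \<cdot> syz_arr (tgt C f)"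
proof -
  note [simp] = short_exactD(1,2)[OF fg]
  have [simp]: "src C g = tgt C f" using short_exactD(3)[OF fg] by simp
  show ?thesis
    by (rule nine_lemma[OF fg T_short_exact[OF fg] syz_short_exact syz_short_exact syz_short_exact,
          of "src C f" "tgt C f" "tgt C g"])
      (use c_natural[of f] c_natural[of g] in \<open>simp_all add: that\<close>)
qed

text \<open>This is where the relative projectives are seen to be adapted to \<open>F\<close>. Apply \<open>F\<close> to the diagram of
  syzygies and covers of \<open>f\<close> and \<open>g\<close>: the column over \<open>tgt g\<close> stays injective since it splits, the
  row of covers since \<open>F T\<close> is exact, and the snake lemma yields injectivity of \<open>F f\<close>.\<close>

lemma F_mono_rel_proj:
  assumes fg: "short_exact C f g" and Q: "rel_proj (tgt C g)"
  shows "is_mono C (amap F f)"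
proof -
  note [simp] = short_exactD(1,2)[OF fg]
  have [simp]: "src C g = tgt C f" using short_exactD(3)[OF fg] by simp
  obtain f' g' where s: "short_exact C f' g'" and [simp]: "src C f' = syz (src C f)" "tgt C f' = syz (tgt C f)"
    "tgt C g' = syz (tgt C g)" and 1: "syz_arr (tgt C f) \<cdot> f' = amap T f \<cdot> syz_arr (src C f)"
    and 2: "syz_arr (tgt C g) \<cdot> g' = amap T g \<cdot> syz_arr (tgt C f)" using fg by (rule syz_functor)
  note [simp] = short_exactD(1,2)[OF s]
  have [simp]: "src C g' = syz (tgt C f)" using short_exactD(3)[OF s] by simp
  have 3: "c (tgt C f) \<cdot> amap T f = f \<cdot> c (src C f)" by (rule c_natural) simp
  show ?thesis
  proof (rule snake_mono[OF F_exact[OF s] FT_mono[OF short_exactD(5)[OF fg]] F_syz_mono[OF Q]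
        F_exact[OF syz_short_exact] F_epi[OF c_epi], where ?g2.0 = "amap F (amap T g)" and kX = "amap F (syz_arr (src C f))"])
    show "amap F (c (src C f)) \<cdot> amap F (syz_arr (src C f))
        = zer C (src C (amap F (syz_arr (src C f)))) (tgt C (amap F (c (src C f))))"
      using F.amap_zer_cmp[OF short_exactD(4)[OF syz_short_exact, of "src C f"]] by simp
    show "amap F (syz_arr (tgt C f)) \<cdot> amap F f' = amap F (amap T f) \<cdot> amap F (syz_arr (src C f))"
      by (rule F.amap_eq[OF 1]) simp_all
    show "amap F (syz_arr (tgt C g)) \<cdot> amap F g' = amap F (amap T g) \<cdot> amap F (syz_arr (tgt C f))"
      by (rule F.amap_eq[OF 2]) simp_all
    show "amap F (c (tgt C f)) \<cdot> amap F (amap T f) = amap F f \<cdot> amap F (c (src C f))"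
      by (rule F.amap_eq[OF 3]) simp_all
    have "amap T g \<cdot> amap T f = zer C (omap T (src C f)) (omap T (tgt C g))"
      by (rule T.amap_zer_cmp[OF short_exactD(4)[OF fg]]) simp_all
    from F.amap_zer_cmp[OF this] show "amap F (amap T g) \<cdot> amap F (amap T f)
        = zer C (src C (amap F (amap T f))) (tgt C (amap F (amap T g)))" by simp
  qed simp_all
qed

text \<open>\<open>vanishes i A\<close> says that the \<open>(i + 1)\<close>-st derived functor of \<open>F\<close> is zero at \<open>A\<close>, since that object is
  the kernel of \<open>F\<close> applied to the inclusion of the \<open>(i + 1)\<close>-st syzygy into the cover of the \<open>i\<close>-th
  one. The index is shifted because acyclicity concerns the positive degrees.\<close>

definition vanishes :: "nat \<Rightarrow> 'o \<Rightarrow> bool"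
  where "vanishes i A \<longleftrightarrow> is_mono C (amap F (syz_arr ((syz ^^ i) A)))"

lemma vanishes_0: "vanishes 0 A \<longleftrightarrow> is_mono C (amap F (syz_arr A))"
  by (simp add: vanishes_def)

lemma vanishes_Suc: "vanishes (Suc i) A \<longleftrightarrow> vanishes i (syz A)"
  by (simp add: vanishes_def funpow_swap1)

text \<open>The long exact sequence would give this from the vanishing at \<open>tgt g\<close>. Taking syzygies preserves the
  situation, so only the first derived functor has to be compared, where the two implications are
  elementary.\<close>

lemma vanishes_extension:
  assumes "short_exact C f g" "rel_proj (tgt C g)"
  shows "vanishes i (src C f) \<longleftrightarrow> vanishes i (tgt C f)"
  using assms
proof (induction i arbitrary: f g)
  case (0 f g)
  note fg = 0(1) and Q = 0(2)
  note [simp] = short_exactD(1,2)[OF fg]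
  have [simp]: "src C g = tgt C f" using short_exactD(3)[OF fg] by simp
  obtain f' g' where s: "short_exact C f' g'" and [simp]: "src C f' = syz (src C f)" "tgt C f' = syz (tgt C f)"
    "tgt C g' = syz (tgt C g)" and 1: "syz_arr (tgt C f) \<cdot> f' = amap T f \<cdot> syz_arr (src C f)"
    and 2: "syz_arr (tgt C g) \<cdot> g' = amap T g \<cdot> syz_arr (tgt C f)" using fg by (rule syz_functor)
  note [simp] = short_exactD(1,2)[OF s]
  have [simp]: "src C g' = syz (tgt C f)" using short_exactD(3)[OF s] by simp
  have f': "is_mono C (amap F f')" using F_mono_rel_proj[OF s] rel_proj_syz[OF Q] by simp
  have 1: "amap F (syz_arr (tgt C f)) \<cdot> amap F f' = amap F (amap T f) \<cdot> amap F (syz_arr (src C f))"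
    by (rule F.amap_eq[OF 1]) simp_all
  have 2: "amap F (syz_arr (tgt C g)) \<cdot> amap F g' = amap F (amap T g) \<cdot> amap F (syz_arr (tgt C f))"
    by (rule F.amap_eq[OF 2]) simp_all
  show ?case unfolding vanishes_0
  proof
    assume "is_mono C (amap F (syz_arr (src C f)))"
    then show "is_mono C (amap F (syz_arr (tgt C f)))"
      by (intro mono_middle[OF F_exact[OF s] FT_mono[OF short_exactD(5)[OF fg]] F_syz_mono[OF Q] _ _ _ _ _ _ _ _ _ _ 1 2])
        simp_all
  next
    assume m: "is_mono C (amap F (syz_arr (tgt C f)))"
    have "is_mono C (amap F (syz_arr (tgt C f)) \<cdot> amap F f')" by (rule mono_cmp[OF f' m]) simp
    then show "is_mono C (amap F (syz_arr (src C f)))" unfolding 1 by (rule mono_cmpD) simp_all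
  qed
next
  case (Suc i f g)
  obtain f' g' where s: "short_exact C f' g'" "src C f' = syz (src C f)" "tgt C f' = syz (tgt C f)"
    "tgt C g' = syz (tgt C g)" using Suc.prems(1) by (rule syz_functor)
  show ?case unfolding vanishes_Suc
    using Suc.IH[OF s(1)] rel_proj_syz[OF Suc.prems(2)] s by simp
qed

text \<open>Replacement for the comparison of resolutions. The fibre product \<open>E\<close> of \<open>q\<close> with the canonical cover
  of \<open>A\<close> is an extension of a relatively projective object both by the source of \<open>k\<close> and by the syzygy
  of \<open>A\<close>, so that both have the same derived functors as \<open>E\<close>.\<close>

lemma syzygy_vanishes:
  assumes kq: "short_exact C k q" and Q: "rel_proj (src C q)"
  shows "is_mono C (amap F k) \<longleftrightarrow> vanishes 0 (tgt C q)"
    and "vanishes i (src C k) \<longleftrightarrow> vanishes (Suc i) (tgt C q)"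
proof -
  let ?A = "tgt C q"
  note [simp] = short_exactD(1,2)[OF kq]
  have sq [simp]: "tgt C k = src C q" using short_exactD(3)[OF kq] .
  have "tgt C q = tgt C (c ?A)" by simp
  then obtain p e k' l' where s: "short_exact C k' e" "short_exact C l' p" and
    pk: "p \<cdot> k' = k" and el: "e \<cdot> l' = syz_arr ?A" and [simp]: "src C k' = src C k" "src C l' = src C (syz_arr ?A)"
    "tgt C p = src C q" "tgt C e = src C (c ?A)" "src C p = src C e"
    using fibre_square[OF kq syz_short_exact[of ?A]] by (metis Arr_Obj(2) short_exactD(2)[OF kq])
  note [simp] = short_exactD(1,2)[OF s(1)] short_exactD(1,2)[OF s(2)]
  have t [simp]: "tgt C k' = src C e" "tgt C l' = src C e" using short_exactD(3)[OF s(1)] short_exactD(3)[OF s(2)] by simp_all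
  have T: "rel_proj (tgt C e)" by (simp add: rel_proj_T)
  have Q': "rel_proj (tgt C p)" using Q by simp
  have m: "is_mono C (amap F k')" "is_mono C (amap F l')"
    using F_mono_rel_proj[OF s(1) T] F_mono_rel_proj[OF s(2) Q'] .
  have pk: "amap F p \<cdot> amap F k' = amap F k" using arg_cong[OF pk, of "amap F"] by simp
  have el: "amap F e \<cdot> amap F l' = amap F (syz_arr ?A)" using arg_cong[OF el, of "amap F"] by simp
  have pl: "amap F p \<cdot> amap F l' = zer C (src C (amap F l')) (tgt C (amap F p))"
    using F.amap_zer_cmp[OF short_exactD(4)[OF s(2)]] by simp
  have ek: "amap F e \<cdot> amap F k' = zer C (src C (amap F k')) (tgt C (amap F e))"
    using F.amap_zer_cmp[OF short_exactD(4)[OF s(1)]] by simp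
  show "is_mono C (amap F k) \<longleftrightarrow> vanishes 0 (tgt C q)" unfolding vanishes_0
  proof
    assume k: "is_mono C (amap F k)"
    show "is_mono C (amap F (syz_arr ?A))" unfolding el[symmetric]
      by (rule mono_exchange[OF F_exact[OF s(1)] m(2) k _ _ _ _ _ pk pl]) simp_all
  next
    assume k: "is_mono C (amap F (syz_arr ?A))"
    show "is_mono C (amap F k)" unfolding pk[symmetric]
      by (rule mono_exchange[OF F_exact[OF s(2)] m(1) k _ _ _ _ _ el ek]) simp_all
  qed
  show "vanishes i (src C k) \<longleftrightarrow> vanishes (Suc i) (tgt C q)"
    unfolding vanishes_Suc using vanishes_extension[OF s(1) T] vanishes_extension[OF s(2) Q'] by simp
qed

text \<open>The resolutions of the theorem, with surjectivity of the augmentation stated directly.\<close>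

definition resolution :: "'o \<Rightarrow> (nat \<Rightarrow> 'm) \<Rightarrow> bool"
  where "resolution A d \<longleftrightarrow> tgt C (d 0) = A \<and> (\<forall>i. rel_proj (src C (d i))) \<and> is_epi C (d 0) \<and>
    (\<forall>i. exact_at C (d (Suc i)) (d i))"

lemma resolution_syzygy:
  assumes "resolution A d"
  obtains k e where "short_exact C k (d 0)" "is_epi C e" "src C e = src C (d (Suc 0))" "tgt C e = src C k"
    "k \<cdot> e = d (Suc 0)" "exact_at C (d (Suc (Suc 0))) e"
    "resolution (src C k) (\<lambda>n. if n = 0 then e else d (Suc n))"
proof -
  have e0: "is_epi C (d 0)" and x: "exact_at C (d (Suc i)) (d i)" and Q: "rel_proj (src C (d i))" for i
    using assms by (auto simp: resolution_def)
  obtain k where k: "is_kernel C k (d 0)" using has_kernels[of "d 0"] is_epi_Arr[OF e0] by auto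
  obtain e where e: "is_epi C e" "src C e = src C (d (Suc 0))" "tgt C e = src C k" and ke: "k \<cdot> e = d (Suc 0)"
    and xe: "exact_at C (d (Suc (Suc 0))) e"
    using exact_at_factor[OF x x k] by blast
  then have "resolution (src C k) (\<lambda>n. if n = 0 then e else d (Suc n))"
    unfolding resolution_def using e x Q by auto
  then show ?thesis using that[OF short_exact_epiI[OF k e0] e ke xe] by simp
qed

text \<open>Dimension shift: dropping the first term of a resolution of \<open>A\<close> leaves a resolution of the
  kernel of \<open>d 0\<close>, for which the claim is known one degree lower.\<close>

lemma resolution_exact_iff:
  assumes "resolution A d"
  shows "exact_at C (amap F (d (Suc (Suc i)))) (amap F (d (Suc i))) \<longleftrightarrow> vanishes i A"
  using assms
proof (induction i arbitrary: A d)
  case (0 A d)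
  have A: "tgt C (d 0) = A" and Q: "rel_proj (src C (d 0))" using 0 by (auto simp: resolution_def)
  obtain k e where kd: "short_exact C k (d 0)" and e: "is_epi C e" and [simp]: "src C e = src C (d (Suc 0))"
    "tgt C e = src C k" and ke: "k \<cdot> e = d (Suc 0)" and x: "exact_at C (d (Suc (Suc 0))) e"
    using 0 by (rule resolution_syzygy)
  note [simp] = short_exactD(1)[OF kd] exact_atD(1,2)[OF x]
  have t2 [simp]: "tgt C (d (Suc (Suc 0))) = src C (d (Suc 0))" using exact_atD(3)[OF x] by simp
  have co: "is_cokernel C (amap F e) (amap F (d (Suc (Suc 0))))"
    by (intro F_cokernel epi_exact_cokernel e x)
  have Fd: "amap F (d (Suc 0)) = amap F k \<cdot> amap F e" using arg_cong[OF ke, of "amap F"] by simp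
  have Fx: "exact_at C (amap F (d (Suc (Suc 0)))) (amap F e)" by (rule cokernel_exact[OF co])
  have "exact_at C (amap F (d (Suc (Suc 0)))) (amap F k \<cdot> amap F e) \<longleftrightarrow> is_mono C (amap F k)"
  proof
    assume ex: "exact_at C (amap F (d (Suc (Suc 0)))) (amap F k \<cdot> amap F e)"
    show "is_mono C (amap F k)"
    proof (rule is_monoI)
      fix x assume [simp]: "x \<in> Arr C" "tgt C x = src C (amap F k)"
        and x0: "amap F k \<cdot> x = zer C (src C x) (tgt C (amap F k))"
      have "covers C (amap F e) x" by (rule epi_covers) (simp_all add: F_epi e)
      then obtain b y where b: "is_epi C b" and [simp]: "b \<in> Arr C" "tgt C b = src C x" "y \<in> Arr C"
        "src C y = src C b" "tgt C y = src C (amap F e)" and y: "amap F e \<cdot> y = x \<cdot> b" by (rule coversE)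
      have "(amap F k \<cdot> amap F e) \<cdot> y = zer C (src C y) (tgt C (amap F k \<cdot> amap F e))"
        using reassoc[OF x0, of b] by (simp add: y)
      then have "covers C (amap F (d (Suc (Suc 0)))) y" by (intro exact_at_covers[OF ex]) simp_all
      then obtain b' z where b': "is_epi C b'" and [simp]: "b' \<in> Arr C" "tgt C b' = src C y" "z \<in> Arr C"
        "src C z = src C b'" "tgt C z = src C (amap F (d (Suc (Suc 0))))"
        and z: "amap F (d (Suc (Suc 0))) \<cdot> z = y \<cdot> b'" by (rule coversE)
      have "x \<cdot> (b \<cdot> b') = amap F e \<cdot> (y \<cdot> b')" by (simp add: reassoc[OF y])
      also have "\<dots> = zer C (src C (b \<cdot> b')) (tgt C x)"
        unfolding z[symmetric] using reassoc[OF cokernelD(4)[OF co], of z] by simp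
      finally show "x = zer C (src C x) (src C (amap F k))"
        by - (rule epi_zer[of "b \<cdot> b'"], simp_all add: epi_cmp b b')
    qed simp
  next
    assume m: "is_mono C (amap F k)"
    have "is_epi C (idn C (omap F (src C (d (Suc (Suc 0))))))"
      by (rule split_epi[of "idn C (omap F (src C (d (Suc (Suc 0)))))"]) simp_all
    then have "exact_at C (amap F (d (Suc (Suc 0))) \<cdot> idn C (omap F (src C (d (Suc (Suc 0)))))) (amap F k \<cdot> amap F e)"
      by (intro exact_at_extend[OF Fx _ _ m]) simp_all
    then show "exact_at C (amap F (d (Suc (Suc 0)))) (amap F k \<cdot> amap F e)" by simp
  qed
  also have "\<dots> \<longleftrightarrow> vanishes 0 A" using syzygy_vanishes(1)[OF kd Q] A by simp
  finally show ?case unfolding Fd .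
next
  case (Suc i A d)
  have A: "tgt C (d 0) = A" and Q: "rel_proj (src C (d 0))" using Suc.prems by (auto simp: resolution_def)
  obtain k e where kd: "short_exact C k (d 0)"
    and r: "resolution (src C k) (\<lambda>n. if n = 0 then e else d (Suc n))"
    using Suc.prems by (rule resolution_syzygy)
  show ?case using Suc.IH[OF r] syzygy_vanishes(2)[OF kd Q] A by simp
qed

lemma resolution_exists:
  assumes [simp]: "A \<in> Obj C"
  obtains d where "resolution A d"
proof -
  define W where "W i = (syz ^^ i) A" for i
  have [simp]: "W i \<in> Obj C" for i by (induction i) (simp_all add: W_def)
  have W: "syz (W i) = W (Suc i)" "W 0 = A" for i by (simp_all add: W_def)
  define d where "d i = (case i of 0 \<Rightarrow> c A | Suc j \<Rightarrow> syz_arr (W j) \<cdot> c (W (Suc j)))" for i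
  have src: "src C (d i) = omap T (W i)" for i by (cases i) (simp_all add: d_def W)
  have ex: "exact_at C (d (Suc i)) (d i)" for i
  proof (cases i)
    case 0
    have "exact_at C (syz_arr A \<cdot> c (W (Suc 0))) (idn C A \<cdot> c A)"
      using W(1)[of 0] by (intro exact_at_extend short_exact_exact syz_short_exact c_epi)
        (simp_all add: W(2) split_mono[of "idn C A" "idn C A"])
    then show ?thesis using 0 by (simp add: d_def W)
  next
    case (Suc j)
    then show ?thesis unfolding d_def
      by (simp add: W) (intro exact_at_extend short_exact_exact syz_short_exact c_epi short_exactD(5)[OF syz_short_exact];
        simp add: W)
  qed
  have "resolution A d" unfolding resolution_def using ex src by (simp add: rel_proj_T c_epi d_def)
  then show ?thesis by (rule that)
qed

end

section \<open>Gorenstein objects and duality\<close>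

lemma gorenstein_projectivesE:
  fixes C :: "('o, 'm) cat"
  assumes "A \<in> gorenstein_projectives C P N"
  obtains s :: "int \<Rightarrow> 'm" and k where "A \<in> Obj C" "\<And>i. P_projective C P (src C (s i))"
    "\<And>i. exact_at C (s (i + 1)) (s i)" "\<And>i. exact_at C (amap N (s (i + 1))) (amap N (s i))"
    "is_kernel C k (s 0)" "src C k = A"
proof -
  obtain s k where "A \<in> Obj C" "\<forall>i. P_projective C P (src C (s i))"
    "exact_sequence C s" "exact_sequence C (\<lambda>i. amap N (s i))" "is_kernel C k (s 0)" "src C k = A"
    using assms unfolding gorenstein_projectives_def by blast
  then show ?thesis by (intro that[of s k]) (simp_all add: exact_sequence_def)
qed

context abelian_category
begin

text \<open>A complete sequence can be read backwards, since its cycles are at the same time its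
  cocycles.\<close>

lemma gorenstein_projectives_reverse:
  "A \<in> gorenstein_projectives C P N \<Longrightarrow> A \<in> gorenstein_projectives (opp C) P N"
proof -
  assume "A \<in> gorenstein_projectives C P N"
  then obtain s :: "int \<Rightarrow> 'b" and k where A: "A \<in> Obj C" and P: "\<And>i. P_projective C P (src C (s i))"
    and s: "\<And>i. exact_at C (s (i + 1)) (s i)" and Fs: "\<And>i. exact_at C (amap N (s (i + 1))) (amap N (s i))"
    and k: "is_kernel C k (s 0)" "src C k = A"
    by (rule gorenstein_projectivesE) blast
  (* The reflection i -> 2 - i makes the kernel of s 0, which is the cokernel of s 2, the kernel of
     the reversed arrow in degree 0. *)
  have j: "2 - i = (1 - i) + 1" "1 - i = 2 - (i + 1)" for i :: int by simp_all
  have t: "tgt C (s (2 - i)) = src C (s (1 - i))" for i unfolding j(1) by (rule exact_atD(3)[OF s])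
  have "P_projective (opp C) P (src (opp C) (s (2 - i)))" for i
    using P[of "1 - i"] unfolding t[symmetric] P_projective_def by simp
  moreover have "exact_at C (s (2 - i)) (s (2 - (i + 1)))" for i
    using s[of "1 - i"] unfolding j[symmetric] .
  moreover have "exact_at C (amap N (s (2 - i))) (amap N (s (2 - (i + 1))))" for i
    using Fs[of "1 - i"] unfolding j[symmetric] .
  moreover have "\<exists>q. is_cokernel C q (s 2) \<and> tgt C q = A"
  proof -
    have x1: "exact_at C (s 1) (s 0)" and x2: "exact_at C (s 2) (s 1)" using s[of 0] s[of 1] by simp_all
    obtain e where e: "is_epi C e" "tgt C e = src C k" "exact_at C (s 2) e"
      using exact_at_factor[OF x2 x1 k(1)] by blast
    then show ?thesis using epi_exact_cokernel[OF e(1,3)] k(2) by auto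
  qed
  ultimately show ?thesis unfolding gorenstein_projectives_def exact_sequence_def
    using A by (auto intro!: exI[of _ "\<lambda>i. s (2 - i)"])
qed

text \<open>The two classes of Gorenstein objects are given by the same condition on sequences, so the only point
  is the reversal.\<close>

lemma gorenstein_injectives_eq_opp: "gorenstein_injectives C I M = gorenstein_projectives (opp C) I M"
proof -
  have "gorenstein_injectives C I M = gorenstein_projectives C I M"
    by (simp add: gorenstein_projectives_def gorenstein_injectives_def P_projective_def I_injective_def)
  then show ?thesis
    using gorenstein_projectives_reverse[of _ I M]
      abelian_category.gorenstein_projectives_reverse[OF abelian_opp, of _ I M] by auto
qed

lemma injective_coresolution_eq_opp:
  "injective_coresolution C I A d \<longleftrightarrow> projective_resolution (opp C) I A d"
  by (simp add: injective_coresolution_def projective_resolution_def P_projective_def I_injective_def)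

end


context relative_acyclicity
begin

lemma projective_resolution_iff:
  assumes P: "\<And>X. P_projective C P X \<longleftrightarrow> rel_proj X"
  shows "projective_resolution C P A d \<longleftrightarrow> resolution A d"
proof -
  have "(\<exists>Z. zero_object C Z \<and> exact_at C (d 0) (zer C A Z)) \<longleftrightarrow> is_epi C (d 0)" if "tgt C (d 0) = A"
    using has_zero_object that epi_iff_exact[of _ "d 0"] exact_atD(1)[of "d 0"] is_epi_Arr[of "d 0"] by blast
  then show ?thesis unfolding projective_resolution_def resolution_def P by blast
qed

lemma resolution_homology_exists:
  assumes "resolution A d"
  obtains H where "is_homology C H (amap F (d (Suc (Suc i)))) (amap F (d (Suc i)))"
proof -
  have x: "exact_at C (d (Suc (Suc i))) (d (Suc i))" using assms by (simp add: resolution_def)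
  note [simp] = exact_atD(1-3)[OF x]
  show ?thesis
    by (rule homology_exists[of "amap F (d (Suc (Suc i)))" "amap F (d (Suc i))"])
      (simp_all add: F.amap_zer_cmp[OF exact_atD(4)[OF x]] that)
qed

text \<open>The chosen object is the homology for one particular resolution, but exactness there does not depend
  on the resolution.\<close>

lemma left_derived_zero_iff:
  assumes P: "\<And>X. P_projective C P X \<longleftrightarrow> rel_proj X" and A: "A \<in> Obj C"
  shows "zero_object C (left_derived C P F (Suc i) A) \<longleftrightarrow> vanishes i A"
proof -
  let ?Q = "\<lambda>H d Z. projective_resolution C P A d \<and> zero_object C Z \<and>
    is_homology C H (amap F (d (Suc (Suc i)))) (amap F (d (Suc i)))"
  obtain d where d: "resolution A d" using resolution_exists[OF A] by blast
  obtain H where "is_homology C H (amap F (d (Suc (Suc i)))) (amap F (d (Suc i)))"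
    using resolution_homology_exists[OF d] by blast
  then have "\<exists>H d Z. ?Q H d Z" using d has_zero_object unfolding projective_resolution_iff[OF P] by blast
  then have "\<exists>d Z. ?Q (SOME H. \<exists>d Z. ?Q H d Z) d Z" by (rule someI_ex)
  then obtain d where d: "resolution A d"
    and H: "is_homology C (left_derived C P F (Suc i) A) (amap F (d (Suc (Suc i)))) (amap F (d (Suc i)))"
    unfolding projective_resolution_iff[OF P] left_derived_def by auto
  show ?thesis unfolding homology_zero_iff[OF H] by (rule resolution_exact_iff[OF d])
qed

text \<open>A complex that is spliced from short exact sequences whose last terms have vanishing first
  derived functor stays exact under \<open>F\<close>.\<close>

lemma spliced_exact:
  fixes p q :: "int \<Rightarrow> 'm"
  assumes pq: "\<And>i. short_exact C (p i) (q i)" and link: "\<And>i. src C (p (i - 1)) = tgt C (q i)"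
    and proj: "\<And>i. rel_proj (tgt C (p i))" and van: "\<And>i. vanishes 0 (tgt C (q i))"
  shows "exact_sequence C (\<lambda>i. p (i - 1) \<cdot> q i)" "exact_sequence C (\<lambda>i. amap F (p (i - 1) \<cdot> q i))"
proof -
  have [simp]: "p i \<in> Arr C" "q i \<in> Arr C" for i using short_exactD(1,2)[OF pq] by simp_all
  have link': "tgt C (q (i + 1)) = src C (p i)" for i using link[of "i + 1"] by simp
  have "exact_at C (p i \<cdot> q (i + 1)) (p (i - 1) \<cdot> q i)" for i
    by (intro exact_at_extend short_exact_exact pq short_exactD(5,6)[OF pq]) (simp_all add: link link')
  then show "exact_sequence C (\<lambda>i. p (i - 1) \<cdot> q i)" by (simp add: exact_sequence_def)
  have m: "is_mono C (amap F (p i))" for i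
    using syzygy_vanishes(1)[OF pq] proj van short_exactD(3)[OF pq] by simp
  have "exact_at C (amap F (p i) \<cdot> amap F (q (i + 1))) (amap F (p (i - 1)) \<cdot> amap F (q i))" for i
    by (intro exact_at_extend F_exact pq m F_epi short_exactD(6)[OF pq]) (simp_all add: link link')
  then show "exact_sequence C (\<lambda>i. amap F (p (i - 1) \<cdot> q i))" by (simp add: exact_sequence_def link link')
qed

end


section \<open>Acyclic objects under the Nakayama adjunction\<close>

text \<open>The consequences of the hypotheses on \<open>P\<close> and \<open>\<nu>\<close>, in a form that is literally self-dual. The dual
  of the equation \<open>I = N P\<close> holds only up to isomorphism, \<open>P \<cong> M I\<close>; therefore both enter through exactness
  and retract conditions on \<open>N P\<close> and \<open>M I\<close>.\<close>

locale nakayama_pair = abelian_category C + PI: adjoint_pair C P I u c + NM: adjoint_pair C N M \<eta> \<epsilon>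
  for C :: "('o, 'm) cat" (structure) and P I N M :: "('o, 'm) endofun" and u c \<eta> \<epsilon> :: "'o \<Rightarrow> 'm" +
  assumes counit_epi: "A \<in> Obj C \<Longrightarrow> is_epi C (c A)"
    and unit_mono: "A \<in> Obj C \<Longrightarrow> is_mono C (u A)"
    and P_kernel: "is_kernel C k f \<Longrightarrow> is_kernel C (amap P k) (amap P f)"
    and I_cokernel: "is_cokernel C q f \<Longrightarrow> is_cokernel C (amap I q) (amap I f)"
    and NP_mono: "is_mono C f \<Longrightarrow> is_mono C (amap N (amap P f))"
    and MI_epi: "is_epi C f \<Longrightarrow> is_epi C (amap M (amap I f))"
    and NP_retract: "A \<in> Obj C \<Longrightarrow> \<exists>B \<in> Obj C. retract (omap N (omap P A)) (omap I B)"
    and MI_retract: "A \<in> Obj C \<Longrightarrow> \<exists>B \<in> Obj C. retract (omap M (omap I A)) (omap P B)"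
    and eta_iso: "A \<in> Obj C \<Longrightarrow> is_iso C (\<eta> (omap P A))"
    and epsilon_iso: "A \<in> Obj C \<Longrightarrow> is_iso C (\<epsilon> (omap I A))"
begin

sublocale relative_acyclicity C N "P \<odot> I" c
proof (intro relative_acyclicity.intro relative_acyclicity_axioms.intro abelian_category_axioms
    NM.F.additive_functor_axioms additive_functor_comp PI.F.additive_functor_axioms PI.G.additive_functor_axioms)
  show "short_exact C (amap (P \<odot> I) f) (amap (P \<odot> I) g)" if "short_exact C f g" for f g
    using that by (simp add: short_exact_def P_kernel I_cokernel PI.right_adjoint_kernel PI.left_adjoint_cokernel)
  show "is_mono C (amap N (amap (P \<odot> I) f))" if "is_mono C f" for f
    using that by (simp add: NP_mono PI.right_adjoint_mono)
  show "c (tgt C f) \<cdot> amap (P \<odot> I) f = f \<cdot> c (src C f)" if "f \<in> Arr C" for f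
    using PI.counit_natural[OF that] by simp
  show "\<exists>s \<in> Hom C (omap (P \<odot> I) A) (omap (P \<odot> I) (omap (P \<odot> I) A)). c (omap (P \<odot> I) A) \<cdot> s = idn C (omap (P \<odot> I) A)"
    if "A \<in> Obj C" for A
    using that PI.triangle_left[of "omap I A"] by (intro bexI[of _ "amap P (u (omap I A))"]) (simp_all add: Hom_iff)
qed (simp_all add: NM.left_adjoint_cokernel counit_epi PI.counit_Hom)

lemma rel_proj_P: "A \<in> Obj C \<Longrightarrow> rel_proj (omap P A)"
  unfolding rel_proj_def using PI.triangle_left[of A]
  by (auto intro!: bexI[of _ "amap P (u A)"] simp: Hom_iff)

text \<open>A retract of \<open>P B\<close> inherits the splitting of \<open>c\<close> that the unit provides; conversely a splitting at \<open>A\<close>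
  makes \<open>A\<close> a retract of \<open>P (I A)\<close>.\<close>

lemma P_projective_iff: "P_projective C P A \<longleftrightarrow> rel_proj A"
proof -
  have "P_projective C P A \<longleftrightarrow> (\<exists>B \<in> Obj C. retract A (omap P B))"
    unfolding P_projective_def using retract_iff_direct_summand[OF has_kernels] by blast
  also have "\<dots> \<longleftrightarrow> rel_proj A"
  proof
    assume "\<exists>B\<in>Obj C. retract A (omap P B)"
    then show "rel_proj A" using rel_proj_retract rel_proj_P by blast
  next
    assume A: "rel_proj A"
    note [simp] = rel_proj_Obj[OF A]
    have "retract A (omap P (omap I A))" using A unfolding rel_proj_def retract_def
      using PI.counit_Hom[of A] by auto
    then show "\<exists>B\<in>Obj C. retract A (omap P B)" by (intro bexI[of _ "omap I A"]) simp_all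
  qed
  finally show ?thesis .
qed

lemma nakayama_opp: "nakayama_pair (opp C) I P M N c u \<epsilon> \<eta>"
  by (intro nakayama_pair.intro abelian_opp PI.adjoint_pair_opp NM.adjoint_pair_opp nakayama_pair_axioms.intro)
    (simp_all add: counit_epi unit_mono P_kernel I_cokernel NP_mono MI_epi NP_retract MI_retract eta_iso epsilon_iso)

interpretation R: nakayama_pair "opp C" I P M N c u \<epsilon> \<eta>
  by (rule nakayama_opp)

text \<open>The dual of \<open>vanishes\<close>: \<open>R\<^sup>i\<^sup>+\<^sup>1 M\<close> is zero at the object.\<close>

abbreviation "covanishes \<equiv> relative_acyclicity.vanishes (opp C) M u"

definition acyclic :: "'o \<Rightarrow> bool"
  where "acyclic A \<longleftrightarrow> A \<in> Obj C \<and> (\<forall>i. vanishes i A)"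

lemma short_exact_N:
  assumes "short_exact C f g" "rel_proj (src C g)" "vanishes 0 (tgt C g)"
  shows "short_exact C (amap N f) (amap N g)"
  using syzygy_vanishes(1)[OF assms(1,2)] assms(3)
  by (intro short_exact_monoI[OF F_cokernel[OF short_exactD(8)[OF assms(1)]]]) simp

lemma corel_proj_N: "A \<in> Obj C \<Longrightarrow> R.rel_proj (omap N (omap P A))"
  using NP_retract[of A] R.rel_proj_retract R.rel_proj_P by auto

text \<open>Since \<open>A\<close> is acyclic, \<open>N\<close> keeps the sequences \<open>W (n + 1) \<rightarrow> P I (W n) \<rightarrow> W n\<close> of its syzygies exact, and
  their middle terms become \<open>I\<close>-injective. So \<open>N (W n)\<close> is the first cosyzygy of \<open>N (W (n + 1))\<close>, and
  the vanishing of the derived functors of \<open>M\<close> in high degrees shifts down to all degrees. Then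
  \<open>M\<close> keeps the sequences exact as well, and the unit maps the original sequences to the resulting
  ones. It is an isomorphism in the middle; hence it is epi at every \<open>W n\<close>, and because it is epi at
  \<open>W 1\<close> it is mono at \<open>W 0 = A\<close>.\<close>

lemma covanishes_N:
  assumes m: "\<And>A i. A \<in> Obj C \<Longrightarrow> i \<ge> m \<Longrightarrow> covanishes i A" and A: "acyclic A"
  shows "covanishes i (omap N A)" and "is_iso C (\<eta> A)"
proof -
  define W where "W n = (syz ^^ n) A" for n
  have W [simp]: "W n \<in> Obj C" for n using A by (induction n) (simp_all add: W_def acyclic_def)
  have Wsyz [simp]: "syz (W n) = W (Suc n)" and W0: "W 0 = A" for n by (simp_all add: W_def)
  have van: "vanishes 0 (W n)" for n
    using A by (simp add: acyclic_def vanishes_def W_def)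
  have s: "short_exact C (amap N (syz_arr (W n))) (amap N (c (W n)))" for n
    by (rule short_exact_N[OF syz_short_exact]) (simp_all add: rel_proj_P van)
  have inj: "R.rel_proj (omap N (omap P (omap I (W n))))" for n by (rule corel_proj_N) simp
  have sz: "is_epi C (amap M (amap N (c (W n)))) \<longleftrightarrow> covanishes 0 (omap N (W (Suc n)))"
    "covanishes i (omap N (W n)) \<longleftrightarrow> covanishes (Suc i) (omap N (W (Suc n)))" for n i
    using R.syzygy_vanishes[of "amap N (c (W n))" "amap N (syz_arr (W n))"] s[of n] inj[of n] by simp_all
  have "covanishes i (omap N (W n)) \<longleftrightarrow> covanishes (i + j) (omap N (W (n + j)))" for i j n
  proof (induction j)
    case (Suc j)
    then show ?case using sz(2)[of "i + j" "n + j"] by simp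
  qed simp
  from this[of _ _ m] have cov: "covanishes i (omap N (W n))" for i n using m by simp
  then show "covanishes i (omap N A)" using W0 by metis
  have nat: "amap M (amap N (c (W n))) \<cdot> \<eta> (omap P (omap I (W n))) = \<eta> (W n) \<cdot> c (W n)" for n
    using NM.unit_natural[of "c (W n)"] by simp
  have nat': "amap M (amap N (syz_arr (W n))) \<cdot> \<eta> (W (Suc n)) = \<eta> (omap P (omap I (W n))) \<cdot> syz_arr (W n)" for n
    using NM.unit_natural[of "syz_arr (W n)"] by simp
  have epi: "is_epi C (\<eta> (W n))" for n
  proof -
    have "is_epi C (\<eta> (W n) \<cdot> c (W n))" unfolding nat[symmetric]
      using sz(1) cov iso_epi[OF eta_iso] by (intro epi_cmp) simp_all
    then show ?thesis by (rule epi_cmpD) simp_all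
  qed
  obtain Z where Z: "zero_object C Z" using has_zero_object by blast
  then have [simp]: "Z \<in> Obj C" by (simp add: zero_object_def)
  (* The four lemma is the case of the snake lemma with a zero object in the third column. *)
  have "is_mono C (\<eta> (W 0))"
  proof (rule snake_mono[where kX = "syz_arr (W 0)" and cX = "c (W 0)" and ?f2.0 = "\<eta> (omap P (omap I (W 0)))"
        and kY = "amap M (amap N (syz_arr (W 0)))" and cY = "amap M (amap N (c (W 0)))" and f' = "\<eta> (W (Suc 0))"
        and g' = "zer C (omap M (omap N (W (Suc 0)))) Z" and kZ = "idn C Z" and ?g2.0 = "zer C (omap M (omap N (omap P (omap I (W 0))))) Z"])
    show "exact_at C (\<eta> (W (Suc 0))) (zer C (omap M (omap N (W (Suc 0)))) Z)"
      using epi_iff_exact[OF Z, of "\<eta> (W (Suc 0))"] epi by simp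
    show "is_mono C (\<eta> (omap P (omap I (W 0))))" by (simp add: iso_mono eta_iso)
    show "is_mono C (idn C Z)" by (rule split_mono[of _ "idn C Z"]) simp_all
    have "is_kernel C (amap M (amap N (syz_arr (W 0)))) (amap M (amap N (c (W 0))))"
      by (rule NM.right_adjoint_kernel[OF short_exactD(7)[OF s]])
    then have "short_exact C (amap M (amap N (syz_arr (W 0)))) (amap M (amap N (c (W 0))))"
      using sz(1) cov by (auto intro: short_exact_epiI)
    then show "exact_at C (amap M (amap N (syz_arr (W 0)))) (amap M (amap N (c (W 0))))" by (rule short_exact_exact)
    show "c (W 0) \<cdot> syz_arr (W 0) = zer C (src C (syz_arr (W 0))) (tgt C (c (W 0)))"
      by (rule short_exactD(4)[OF syz_short_exact]) simp
  qed (simp_all add: nat nat' counit_epi)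
  then show "is_iso C (\<eta> A)" using mono_epi_iso epi[of 0] unfolding W0 by blast
qed

text \<open>One step of the coresolution: with \<open>B = N A\<close>, the functor \<open>M\<close> keeps \<open>B \<rightarrow> I P B\<close> and its cokernel exact,
  the unit identifies \<open>A\<close> with \<open>M B\<close>, and the quotient is acyclic by the dual of the previous lemma.\<close>

lemma acyclic_cover:
  assumes m: "\<And>A i. A \<in> Obj C \<Longrightarrow> i \<ge> m \<Longrightarrow> covanishes i A" "\<And>A i. A \<in> Obj C \<Longrightarrow> i \<ge> m \<Longrightarrow> vanishes i A"
    and A: "acyclic A"
  obtains a b where "short_exact C a b" "src C a = A" "rel_proj (tgt C a)" "acyclic (tgt C b)"
proof -
  have [simp]: "A \<in> Obj C" using A by (simp add: acyclic_def)
  let ?B = "omap N A"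
  have cov: "covanishes i ?B" for i using covanishes_N(1)[OF m(1) A] by simp
  have iso: "is_iso C (\<eta> A)" using covanishes_N(2)[OF m(1) A] by simp
  define q where "q = R.syz_arr ?B"
  have uq: "short_exact C (u ?B) q" using R.syz_short_exact[of ?B] by (simp add: q_def)
  have [simp]: "q \<in> Arr C" "tgt C q = R.syz ?B" "src C q = omap I (omap P ?B)"
    using R.syz_Arr[of ?B] by (simp_all add: q_def)
  have "nakayama_pair.acyclic (opp C) M u (R.syz ?B)"
    unfolding nakayama_pair.acyclic_def[OF nakayama_opp] using cov R.syz_Arr(4)[of ?B]
    by (simp flip: R.vanishes_Suc)
  then have "vanishes i (omap M (R.syz ?B))" for i
    using nakayama_pair.covanishes_N(1)[OF nakayama_opp, where m = m and A = "R.syz ?B" and i = i] m(2) by simp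
  then have K: "acyclic (omap M (R.syz ?B))" using R.syz_Arr(4)[of ?B] by (simp add: acyclic_def)
  have "is_epi C (amap M q)" using cov[of 0] unfolding R.vanishes_0 q_def by simp
  then have "short_exact C (amap M (u ?B)) (amap M q)"
    by (rule short_exact_epiI[OF NM.right_adjoint_kernel[OF short_exactD(7)[OF uq]]])
  then have "short_exact C (amap M (u ?B) \<cdot> \<eta> A) (amap M q)" using iso by (rule short_exact_iso) simp
  moreover have "rel_proj (tgt C (amap M (u ?B) \<cdot> \<eta> A))"
    using MI_retract[of "omap P ?B"] rel_proj_retract rel_proj_P by auto
  ultimately show ?thesis using K by (intro that[of "amap M (u ?B) \<cdot> \<eta> A" "amap M q"]) simp_all
qed

theorem gorenstein_projective_iff_acyclic:
  assumes m: "\<And>A i. A \<in> Obj C \<Longrightarrow> i \<ge> m \<Longrightarrow> covanishes i A" "\<And>A i. A \<in> Obj C \<Longrightarrow> i \<ge> m \<Longrightarrow> vanishes i A"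
  shows "A \<in> gorenstein_projectives C P N \<longleftrightarrow> acyclic A"
proof
  assume "A \<in> gorenstein_projectives C P N"
  then obtain s :: "int \<Rightarrow> 'm" and k where A: "A \<in> Obj C" and P: "\<And>i. rel_proj (src C (s i))"
    and s: "\<And>i. exact_at C (s (i + 1)) (s i)" and Fs: "\<And>i. exact_at C (amap N (s (i + 1))) (amap N (s i))"
    and k: "is_kernel C k (s 0)" "src C k = A"
    unfolding P_projective_iff[symmetric] by (rule gorenstein_projectivesE) blast
  have x1: "exact_at C (s 1) (s 0)" and x2: "exact_at C (s 2) (s 1)" using s[of 0] s[of 1] by simp_all
  obtain e where e: "is_epi C e" "src C e = src C (s 1)" "tgt C e = src C k" and x: "exact_at C (s 2) e"
    using exact_at_factor[OF x2 x1 k(1)] by blast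
  (* The terms of positive index of the complete sequence resolve A. *)
  define d where "d n = (if n = 0 then e else s (int n + 1))" for n
  have "exact_at C (d (Suc n)) (d n)" for n
    using x s[of "int n + 1"] by (auto simp: d_def add.commute)
  then have r: "resolution A d" unfolding resolution_def using e k P by (simp add: d_def)
  have "vanishes i A" for i
    using resolution_exact_iff[OF r, of i] Fs[of "int i + 2"] by (simp add: d_def add.commute add.left_commute)
  then show "acyclic A" using A by (simp add: acyclic_def)
next
  assume A: "acyclic A"
  then have [simp]: "A \<in> Obj C" by (simp add: acyclic_def)
  let ?ok = "\<lambda>r. short_exact C (fst r) (snd r) \<and> rel_proj (tgt C (fst r)) \<and> acyclic (tgt C (snd r))"
  have "\<exists>r. ?ok r \<and> src C (fst r) = B" if B: "acyclic B" for B
  proof -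
    obtain a b where "short_exact C a b" "src C a = B" "rel_proj (tgt C a)" "acyclic (tgt C b)"
      using acyclic_cover[OF m B] by blast
    then show ?thesis by (intro exI[of _ "(a, b)"]) simp
  qed
  then have "\<exists>r. \<forall>n. (?ok (r n) \<and> (n = 0 \<longrightarrow> src C (fst (r n)) = A)) \<and> src C (fst (r (Suc n))) = tgt C (snd (r n))"
    using A by (intro dependent_nat_choice) (auto 4 4)
  then obtain r where ok: "\<And>n. ?ok (r n)" and r0: "src C (fst (r 0)) = A"
    and link: "\<And>n. src C (fst (r (Suc n))) = tgt C (snd (r n))" by blast
  define W where "W n = (syz ^^ n) A" for n
  have W [simp]: "W n \<in> Obj C" for n using A by (induction n) (simp_all add: W_def acyclic_def)
  have Wsyz [simp]: "syz (W n) = W (Suc n)" and W0: "W 0 = A" for n by (simp_all add: W_def)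
  have van: "vanishes 0 (W n)" for n
    using A by (simp add: acyclic_def vanishes_def W_def)
  (* Middle terms of index at most 0 come from the iterated coresolution, those of positive index from
     the canonical resolution; p 0 starts at A, so that A is the kernel in degree 0. *)
  define p q where "p i = (if i \<le> 0 then fst (r (nat (- i))) else syz_arr (W (nat (i - 1))))"
    and "q i = (if i \<le> 0 then snd (r (nat (- i))) else c (W (nat (i - 1))))" for i :: int
  have pq: "short_exact C (p i) (q i)" for i using ok by (simp add: p_def q_def syz_short_exact)
  have l: "src C (p (i - 1)) = tgt C (q i)" for i
  proof -
    consider "i \<le> 0" | "i = 1" | "i \<ge> 2" by linarith
    then show ?thesis
    proof cases
      case 1
      then have "nat (- (i - 1)) = Suc (nat (- i))" by simp
      then show ?thesis using 1 link[of "nat (- i)"] by (simp add: p_def q_def)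
    next
      case 2
      then show ?thesis using r0 W0 by (simp add: p_def q_def)
    next
      case 3
      then have "nat (i - 1) = Suc (nat (i - 1 - 1))" by simp
      then show ?thesis using 3 by (simp add: p_def q_def)
    qed
  qed
  have proj: "rel_proj (tgt C (p i))" for i using ok rel_proj_P by (simp add: p_def)
  have v: "vanishes 0 (tgt C (q i))" for i using ok van by (simp add: q_def acyclic_def)
  note [simp] = short_exactD(1-3)[OF pq]
  have "is_kernel C (p 0) (p (0 - 1) \<cdot> q 0)"
    by (rule kernel_mono_cmp[OF short_exactD(7)[OF pq] short_exactD(5)[OF pq] l])
  moreover have "src C (p 0) = A" using r0 by (simp add: p_def)
  moreover have "rel_proj (src C (p (i - 1) \<cdot> q i))" for i using proj[of i] l[of i] by simp
  moreover have "exact_sequence C (\<lambda>i. p (i - 1) \<cdot> q i)" "exact_sequence C (\<lambda>i. amap N (p (i - 1) \<cdot> q i))"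
    by (rule spliced_exact[of p q]; use pq l proj v in simp)+
  ultimately show "A \<in> gorenstein_projectives C P N"
    unfolding gorenstein_projectives_def P_projective_iff
    by (intro CollectI conjI exI[of _ "\<lambda>i. p (i - 1) \<cdot> q i"] exI[of _ "p 0"] allI) simp_all
qed

text \<open>Homology is computed in the original category, but its vanishing is exactness, which is self-dual.\<close>

lemma right_derived_zero_iff:
  assumes A: "A \<in> Obj C"
  shows "zero_object C (right_derived C I M (Suc i) A) \<longleftrightarrow> covanishes i A"
proof -
  let ?Q = "\<lambda>H d Z. injective_coresolution C I A d \<and> zero_object C Z \<and>
    is_homology C H (amap M (d (Suc i))) (amap M (d (Suc (Suc i))))"
  note co = injective_coresolution_eq_opp R.projective_resolution_iff[OF R.P_projective_iff]
  obtain d where d: "R.resolution A d" using R.resolution_exists[of A] A by auto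
  have x: "exact_at C (d (Suc i)) (d (Suc (Suc i)))" using d by (simp add: R.resolution_def)
  note [simp] = exact_atD(1-3)[OF x]
  obtain H where "is_homology C H (amap M (d (Suc i))) (amap M (d (Suc (Suc i))))"
    by (rule homology_exists[of "amap M (d (Suc i))" "amap M (d (Suc (Suc i)))"])
      (simp_all add: NM.G.amap_zer_cmp[OF exact_atD(4)[OF x]])
  then have "\<exists>H d Z. ?Q H d Z" using d has_zero_object unfolding co by blast
  then have "\<exists>d Z. ?Q (SOME H. \<exists>d Z. ?Q H d Z) d Z" by (rule someI_ex)
  then obtain d where d: "R.resolution A d"
    and H: "is_homology C (right_derived C I M (Suc i) A) (amap M (d (Suc i))) (amap M (d (Suc (Suc i))))"
    unfolding co right_derived_def by auto
  show ?thesis unfolding homology_zero_iff[OF H] using R.resolution_exact_iff[OF d, of i] by simp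
qed

end

text \<open>The counit is epi because any epimorphism from some \<open>P B\<close> factors through it. If \<open>u x = 0\<close>, then
  \<open>P x = 0\<close>, so \<open>P N P x = 0\<close>, and naturality of the counit gives \<open>x c = 0\<close>. Finally \<open>P\<close> preserves kernels
  because it is isomorphic, by the unit of the second adjunction, to the composite \<open>M N P\<close> of two
  right adjoints.\<close>

lemma nakayama_functor_pair:
  assumes "abelian_category C" "generating_functor C P" "nakayama_functor C P N M"
  obtains u c \<eta> \<epsilon> where "nakayama_pair C P (N \<odot> P) N M u c \<eta> \<epsilon>"
proof -
  interpret abelian_category C by fact
  obtain u c where "adjunction C P (N \<odot> P) u c"
    using assms(3) unfolding nakayama_functor_def is_right_adjoint_def by blast
  then interpret PI: adjoint_pair C P "N \<odot> P" u c by (rule adjunction_adjoint_pair)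
  obtain \<eta> \<epsilon> where "adjunction C N M \<eta> \<epsilon>" and eta: "\<And>A. A \<in> Obj C \<Longrightarrow> is_iso C (\<eta> (omap P A))"
    using assms(3) unfolding nakayama_functor_def by blast
  then interpret NM: adjoint_pair C N M \<eta> \<epsilon> by (intro adjunction_adjoint_pair)
  have counit_epi: "is_epi C (c A)" if A [simp]: "A \<in> Obj C" for A
  proof -
    obtain B e where [simp]: "B \<in> Obj C" "e \<in> Arr C" "src C e = omap P B" "tgt C e = A" and e: "is_epi C e"
      using assms(2) A unfolding generating_functor_def Bex_def Hom_iff by blast
    have n: "c A \<cdot>\<^bsub>C\<^esub> amap P (amap N (amap P e)) = e \<cdot>\<^bsub>C\<^esub> c (omap P B)"
      using PI.counit_natural[of e] by simp
    have "c A \<cdot>\<^bsub>C\<^esub> (amap P (amap N (amap P e)) \<cdot>\<^bsub>C\<^esub> amap P (u B)) = e"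
      using square[OF n, of "amap P (u B)"] PI.triangle_left[of B] by simp
    then have "is_epi C (c A \<cdot>\<^bsub>C\<^esub> (amap P (amap N (amap P e)) \<cdot>\<^bsub>C\<^esub> amap P (u B)))" using e by simp
    then show ?thesis by (rule epi_cmpD) simp_all
  qed
  have unit_mono: "is_mono C (u A)" if [simp]: "A \<in> Obj C" for A
  proof (rule is_monoI)
    fix x assume [simp]: "x \<in> Arr C" "tgt C x = src C (u A)" and ux: "u A \<cdot>\<^bsub>C\<^esub> x = zer C (src C x) (tgt C (u A))"
    have "amap P x = c (omap P A) \<cdot>\<^bsub>C\<^esub> (amap P (u A) \<cdot>\<^bsub>C\<^esub> amap P x)"
      using reassoc[OF PI.triangle_left[of A], of "amap P x"] by simp
    also have "\<dots> = zer C (omap P (src C x)) (omap P A)"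
      by (subst PI.F.amap_zer_cmp[OF ux]) simp_all
    finally have "amap P (amap (N \<odot> P) x) = zer C (omap P (omap (N \<odot> P) (src C x))) (omap P (omap (N \<odot> P) A))"
      by simp
    then have "x \<cdot>\<^bsub>C\<^esub> c (src C x) = zer C (src C (c (src C x))) A"
      using PI.counit_natural[of x] by simp
    then have "x = zer C (src C x) A" by - (rule epi_zer[OF counit_epi[of "src C x"]], simp_all)
    then show "x = zer C (src C x) (src C (u A))" by simp
  qed simp
  have nat: "amap M (amap N (amap P f)) \<cdot>\<^bsub>C\<^esub> \<eta> (omap P (src C f)) = \<eta> (omap P (tgt C f)) \<cdot>\<^bsub>C\<^esub> amap P f"
    if "f \<in> Arr C" for f using NM.unit_natural[of "amap P f"] that by simp
  have MNP_mono: "is_mono C (amap M (amap N (amap P f)))" if "is_mono C f" for f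
    using NM.right_adjoint_mono[OF PI.right_adjoint_mono[OF that]] by simp
  have P_kernel: "is_kernel C (amap P k) (amap P f)" if k: "is_kernel C k f" for k f
  proof -
    note [simp] = kernelD(1-3)[OF k]
    have K: "is_kernel C (amap M (amap N (amap P k))) (amap M (amap N (amap P f)))"
      using NM.right_adjoint_kernel[OF PI.right_adjoint_kernel[OF k]] by simp
    note eta_m = iso_mono[OF eta]
    show ?thesis
    proof (rule is_kernelI)
      have "is_mono C (\<eta> (omap P (src C f)) \<cdot>\<^bsub>C\<^esub> amap P k)"
        using nat[of k] mono_cmp[OF eta_m MNP_mono[OF kernel_mono[OF k]], of "src C k"] by simp
      then show "is_mono C (amap P k)" by (rule mono_cmpD) simp_all
      show "amap P f \<cdot>\<^bsub>C\<^esub> amap P k = zer C (src C (amap P k)) (tgt C (amap P f))"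
        by (simp add: PI.F.amap_zer_cmp[OF kernelD(4)[OF k]])
      fix x assume [simp]: "x \<in> Arr C" "tgt C x = src C (amap P f)"
        and x: "amap P f \<cdot>\<^bsub>C\<^esub> x = zer C (src C x) (tgt C (amap P f))"
      have "amap M (amap N (amap P f)) \<cdot>\<^bsub>C\<^esub> (\<eta> (omap P (src C f)) \<cdot>\<^bsub>C\<^esub> x) = zer C (src C x) (omap M (omap N (omap P (tgt C f))))"
        using square[OF nat[of f], of x] x by simp
      then obtain w where [simp]: "w \<in> Arr C" "src C w = src C x" "tgt C w = omap M (omap N (omap P (src C k)))"
        and w: "amap M (amap N (amap P k)) \<cdot>\<^bsub>C\<^esub> w = \<eta> (omap P (src C f)) \<cdot>\<^bsub>C\<^esub> x"
        using kernel_lift[OF K, of "\<eta> (omap P (src C f)) \<cdot>\<^bsub>C\<^esub> x"] by auto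
      obtain h where [simp]: "h \<in> Arr C" "src C h = omap M (omap N (omap P (src C k)))" "tgt C h = omap P (src C k)"
        and h: "\<eta> (omap P (src C k)) \<cdot>\<^bsub>C\<^esub> h = idn C (omap M (omap N (omap P (src C k))))"
        using is_isoE[OF eta[of "src C k"]] by auto
      have n: "amap M (amap N (amap P k)) \<cdot>\<^bsub>C\<^esub> \<eta> (omap P (src C k)) = \<eta> (omap P (src C f)) \<cdot>\<^bsub>C\<^esub> amap P k"
        using nat[of k] by simp
      have "\<eta> (omap P (src C f)) \<cdot>\<^bsub>C\<^esub> (amap P k \<cdot>\<^bsub>C\<^esub> (h \<cdot>\<^bsub>C\<^esub> w)) = \<eta> (omap P (src C f)) \<cdot>\<^bsub>C\<^esub> x"
        using square[OF n, of "h \<cdot>\<^bsub>C\<^esub> w"] reassoc[OF h, of w] w by simp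
      then have "amap P k \<cdot>\<^bsub>C\<^esub> (h \<cdot>\<^bsub>C\<^esub> w) = x"
        by - (rule mono_cancel[OF eta_m[of "src C f"]], simp_all)
      then show "\<exists>v\<in>Arr C. src C v = src C x \<and> tgt C v = src C (amap P k) \<and> amap P k \<cdot>\<^bsub>C\<^esub> v = x"
        by (intro bexI[of _ "h \<cdot>\<^bsub>C\<^esub> w"]) simp_all
    qed (use kernelD[OF k] in simp_all)
  qed
  have epsilon_iso: "is_iso C (\<epsilon> (omap (N \<odot> P) A))" if "A \<in> Obj C" for A
    by (rule iso_left_inverse[OF NM.F.is_iso_amap[OF eta[OF that]]]) (use that NM.triangle_left[of "omap P A"] in simp_all)
  have "nakayama_pair C P (N \<odot> P) N M u c \<eta> \<epsilon>"
  proof (intro nakayama_pair.intro nakayama_pair_axioms.intro abelian_category_axioms PI.adjoint_pair_axioms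
      NM.adjoint_pair_axioms counit_epi unit_mono P_kernel eta epsilon_iso)
    show "is_cokernel C (amap (N \<odot> P) q) (amap (N \<odot> P) f)" if "is_cokernel C q f" for q f
      using NM.left_adjoint_cokernel[OF PI.left_adjoint_cokernel[OF that]] by simp
    show "is_mono C (amap N (amap P f))" if "is_mono C f" for f
      using PI.right_adjoint_mono[OF that] by simp
    show "is_epi C (amap M (amap (N \<odot> P) f))" if f: "is_epi C f" for f
    proof -
      note [simp] = is_epi_Arr[OF f]
      have "is_epi C (\<eta> (omap P (tgt C f)) \<cdot>\<^bsub>C\<^esub> amap P f)"
        by (rule epi_cmp) (simp_all add: PI.left_adjoint_epi f iso_epi eta)
      then show ?thesis unfolding nat[OF is_epi_Arr[OF f], symmetric] by (auto dest: epi_cmpD)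
    qed
    show "\<exists>B\<in>Obj C. retract (omap N (omap P A)) (omap (N \<odot> P) B)" if "A \<in> Obj C" for A
      using that by (auto intro!: bexI[of _ A] retract_refl)
    show "\<exists>B\<in>Obj C. retract (omap M (omap (N \<odot> P) A)) (omap P B)" if "A \<in> Obj C" for A
      using that iso_retract(2)[OF eta[OF that]] by auto
  qed
  then show ?thesis by (rule that)
qed

theorem theorem4p2p2:
  fixes C :: "('o, 'm) cat"
    and P \<nu> \<nu>m I :: "('o, 'm) endofun"
    and A :: 'o
  assumes "abelian_category C"
    and "generating_functor C P"
    and "nakayama_functor C P \<nu> \<nu>m"
    and "I = \<nu> \<odot> P"
    and "iwanaga_gorenstein C P \<nu> \<nu>m"
    and "A \<in> Obj C"
  shows "(A \<in> gorenstein_projectives C P \<nu> \<longleftrightarrow> (\<forall>i>0. zero_object C (left_derived C P \<nu> i A))) \<and>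
    (A \<in> gorenstein_injectives C I \<nu>m \<longleftrightarrow> (\<forall>i>0. zero_object C (right_derived C I \<nu>m i A)))"
proof -
  obtain u c \<eta> \<epsilon> where "nakayama_pair C P I \<nu> \<nu>m u c \<eta> \<epsilon>"
    using nakayama_functor_pair[OF assms(1-3)] assms(4) by blast
  then interpret nakayama_pair C P I \<nu> \<nu>m u c \<eta> \<epsilon> .
  interpret R: nakayama_pair "opp C" I P \<nu>m \<nu> c u \<epsilon> \<eta> by (rule nakayama_opp)
  note left = left_derived_zero_iff[OF P_projective_iff] and right = right_derived_zero_iff
  obtain m where "\<forall>A\<in>Obj C. \<forall>i>m. zero_object C (left_derived C P \<nu> i A) \<and> zero_object C (right_derived C I \<nu>m i A)"
    using assms(4,5) unfolding iwanaga_gorenstein_def by blast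
  then have van: "vanishes i B" "covanishes i B" if "B \<in> Obj C" "m \<le> i" for i B
    using left[OF that(1), of i] right[OF that(1), of i] that by (simp_all add: less_Suc_eq_le)
  have pos: "(\<forall>i>0. Q i) \<longleftrightarrow> (\<forall>i. Q (Suc i))" for Q :: "nat \<Rightarrow> bool"
    using gr0_conv_Suc by auto
  have "A \<in> gorenstein_projectives C P \<nu> \<longleftrightarrow> (\<forall>i. vanishes i A)"
    using gorenstein_projective_iff_acyclic[of m A] van assms(6) by (simp add: acyclic_def)
  moreover have "A \<in> gorenstein_injectives C I \<nu>m \<longleftrightarrow> (\<forall>i. covanishes i A)"
    unfolding gorenstein_injectives_eq_opp
    using R.gorenstein_projective_iff_acyclic[of m A] van assms(6) by (simp add: R.acyclic_def)
  ultimately show ?thesis unfolding pos using left[OF assms(6)] right[OF assms(6)] by simp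
qed

end
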